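(* Let $G$ be a finite, connected metric tree. Let $\lambda_1(G) \leq \lambda_2(G) \leq \dots$ be the eigenvalues of the standard Laplacian $-\Delta_G$ and $\lambda_1^{\mathrm{D}}(G) \leq \lambda_2^{\mathrm{D}}(G) \leq \dots$ the eigenvalues of the Dirichlet Laplacian $-\Delta_G^{\mathrm{D}}$, each counted with multiplicities. Then $$\lambda_{k+1}(G) \leq \lambda_k^{\mathrm{D}}(G)$$ holds for all $k \in \mathbb{N} = \{1,2,\dots\}$. Moreover, this inequality is strict for all $k \in \mathbb{N}$ if and only if $G$ contains two edges with rationally independent lengths.
   Context: A finite metric graph $G$ consists of a finite vertex set $V$, a finite edge set $E$ (with at least one edge) and a length function $L : E \to (0,\infty)$; each edge $e$ is identified with the interval $[0, L(e)]$, running from its originating vertex $o(e)$ (coordinate $0$) to its terminal vertex $t(e)$ (coordinate $L(e)$). $G$ is a tree if it is connected and contains no cycles (equivalently, it is connected and $|V| = |E|+1$). Two edges $e, \hat e$ have rationally independent lengths if $L(e)$ and $L(\hat e)$ are linearly independent over $\mathbb{Q}$, i.e. $L(e)/L(\hat e) \notin \mathbb{Q}$. $L^2(G)$ is the space of square-integrable functions $f : G \to \mathbb{C}$, and $f_e$ denotes the restriction of $f$ to $e$, viewed as a function on $[0,L(e)]$. Let $\widetilde H^k(G) = \bigoplus_{e \in E} H^k(e)$ and let $H^1(G)$ be the set of $f \in \widetilde H^1(G)$ that are continuous on $G$ (the limit values at each vertex $v$ coincide along all edges incident to $v$). For $f \in H^1(G) \cap \widetilde H^2(G)$ and $v \in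 V$ put $\partial_\nu f(v) = \sum_{t(e)=v} f_e'(L(e)) - \sum_{o(e)=v} f_e'(0)$. The standard Laplacian $-\Delta_G$ in $L^2(G)$ acts by $(-\Delta_G f)_e = -f_e''$ on the domain of all $f \in H^1(G) \cap \widetilde H^2(G)$ with $\partial_\nu f(v) = 0$ for all $v \in V$. It is selfadjoint with purely discrete, nonnegative spectrum; its eigenvalues, counted with multiplicities and listed in nondecreasing order, are $0 = \lambda_1(G) \leq \lambda_2(G) \leq \dots$, and they satisfy $$\lambda_k(G) = \min_{F \subset H^1(G),\ \dim F = k}\ \max_{f \in F,\ f \neq 0} \frac{\int_G |f'|^2\,dx}{\int_G |f|^2\,dx}, \quad k = 1, 2, \dots.$$ The Dirichlet Laplacian $-\Delta_G^{\mathrm{D}}$ is the selfadjoint operator in $L^2(G)$ acting by $(-\Delta_G^{\mathrm{D}} f)_e = -f_e''$ on the domain of all $f \in \widetilde H^2(G) \cap H^1(G)$ with $f(v) = 0$ for all $v \in V$. Its eigenvalues, counted with multiplicities and listed in nondecreasing order, are $\lambda_1^{\mathrm{D}}(G) \leq \lambda_2^{\mathrm{D}}(G) \leq \dots$; they are given by the numbers $m^2\pi^2/L(e)^2$, $e \in E$, $m = 1, 2, \dots$, where numbers appearing several times have the respective multiplicities. *)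

theory Defs
  imports
    "HOL-Analysis.Analysis"
    "HOL-Library.Function_Algebras"
    "Graph_Theory.Digraph_Component"
begin

section \<open>Metric graphs and trees\<close>

text \<open>
  The combinatorial graph is a finite multidigraph (loops and parallel edges are allowed), where
  \<open>tail\<close> and \<open>head\<close> give the originating and the terminal vertex. The orientation only serves to
  parametrise the edge \<open>e\<close> by \<open>[0, L e]\<close>.
\<close>

locale metric_graph = fin_digraph G
  for G :: "('v, 'e) pre_digraph" and L :: "'e \<Rightarrow> real" +
  assumes arcs_nonempty: "arcs G \<noteq> {}"
    and length_pos: "e \<in> arcs G \<Longrightarrow> 0 < L e"

definition joins :: "('v, 'e) pre_digraph \<Rightarrow> 'e \<Rightarrow> 'v \<Rightarrow> 'v \<Rightarrow> bool" where
  "joins G e u v \<longleftrightarrow> e \<in> arcs G \<and>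
     (tail G e = u \<and> head G e = v \<or> tail G e = v \<and> head G e = u)"

text \<open>
  Cycles ignore the orientation, in contrast to \<^const>\<open>pre_digraph.cycle\<close>. A loop is a cycle of
  length 1 and two parallel edges form a cycle of length 2; distinctness of the edges excludes
  going back and forth along a single edge.
\<close>

definition undirected_cycle :: "('v, 'e) pre_digraph \<Rightarrow> 'v list \<Rightarrow> 'e list \<Rightarrow> bool" where
  "undirected_cycle G vs es \<longleftrightarrow>
     es \<noteq> [] \<and> length vs = length es \<and> distinct vs \<and> distinct es \<and>
     (\<forall>i < length es. joins G (es ! i) (vs ! i) (vs ! (Suc i mod length vs)))"

text \<open>
  \<^const>\<open>Digraph_Component.connected\<close> is connectedness of the underlying undirected graph.
\<close>

definition metric_tree :: "('v, 'e) pre_digraph \<Rightarrow> ('e \<Rightarrow> real) \<Rightarrow> bool" where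
  "metric_tree G L \<longleftrightarrow> metric_graph G L \<and> Digraph_Component.connected G \<and>
     \<not> (\<exists>vs es. undirected_cycle G vs es)"

section \<open>Sobolev spaces on an interval\<close>

definition L2_interval :: "real \<Rightarrow> (real \<Rightarrow> complex) set" where
  "L2_interval l = {f. set_borel_measurable lborel {0..l} f \<and>
                       set_integrable lborel {0..l} (\<lambda>x. (cmod (f x))\<^sup>2)}"

text \<open>
  \<open>sobolev_deriv l f g\<close>: on \<open>[0, l]\<close>, \<open>f\<close> is the (absolutely) continuous representative of an
  element of \<open>H\<^sup>1(0, l)\<close> and \<open>g\<close> is a representative of its derivative in \<open>L\<^sup>2(0, l)\<close>. Elements of
  \<open>H\<^sup>1\<close> and \<open>H\<^sup>2\<close> are always taken to be their continuous representatives, so that point values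
  make sense.
\<close>

definition sobolev_deriv :: "real \<Rightarrow> (real \<Rightarrow> complex) \<Rightarrow> (real \<Rightarrow> complex) \<Rightarrow> bool" where
  "sobolev_deriv l f g \<longleftrightarrow> g \<in> L2_interval l \<and>
     (\<forall>x\<in>{0..l}. f x = f 0 + (LBINT t:{0..x}. g t))"

definition H1_interval :: "real \<Rightarrow> (real \<Rightarrow> complex) set" where
  "H1_interval l = {f. \<exists>g. sobolev_deriv l f g}"

definition H2_interval :: "real \<Rightarrow> (real \<Rightarrow> complex) set" where
  "H2_interval l = {f. \<exists>g\<in>H1_interval l. sobolev_deriv l f g}"

section \<open>Functions on a metric graph\<close>

text \<open>
  A function on the metric graph is the family of its restrictions \<open>f e\<close> to the edges. It is
  required to vanish off the edges, so that different families are different functions;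
  this matters when dimensions of spaces of functions are taken.
\<close>

type_synonym 'e edge_fun = "'e \<Rightarrow> real \<Rightarrow> complex"

definition graph_functions :: "('v, 'e) pre_digraph \<Rightarrow> ('e \<Rightarrow> real) \<Rightarrow> 'e edge_fun set" where
  "graph_functions G L = {f. \<forall>e x. \<not> (e \<in> arcs G \<and> x \<in> {0..L e}) \<longrightarrow> f e x = 0}"

definition H2_tilde :: "('v, 'e) pre_digraph \<Rightarrow> ('e \<Rightarrow> real) \<Rightarrow> 'e edge_fun set" where
  "H2_tilde G L = {f \<in> graph_functions G L. \<forall>e\<in>arcs G. f e \<in> H2_interval (L e)}"

text \<open>
  In the definition of \<open>H\<^sup>1(G)\<close>, \<open>u v\<close> is the common limit value at the vertex \<open>v\<close> along all
  incident edges.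
\<close>

definition H1_graph :: "('v, 'e) pre_digraph \<Rightarrow> ('e \<Rightarrow> real) \<Rightarrow> 'e edge_fun set" where
  "H1_graph G L = {f \<in> graph_functions G L. (\<forall>e\<in>arcs G. f e \<in> H1_interval (L e)) \<and>
     (\<exists>u. \<forall>e\<in>arcs G. f e 0 = u (tail G e) \<and> f e (L e) = u (head G e))}"

definition normal_deriv ::
    "('v, 'e) pre_digraph \<Rightarrow> ('e \<Rightarrow> real) \<Rightarrow> 'e edge_fun \<Rightarrow> 'v \<Rightarrow> complex" where
  "normal_deriv G L f v =
     (\<Sum>e\<in>in_arcs G v. vector_derivative (f e) (at (L e) within {0..L e})) -
     (\<Sum>e\<in>out_arcs G v. vector_derivative (f e) (at 0 within {0..L e}))"

section \<open>The Laplacians\<close>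

text \<open>
  An operator in \<open>L\<^sup>2(G)\<close> is given by its graph, a set of pairs \<open>(f, h)\<close>. As elements of \<open>L\<^sup>2(G)\<close>
  are classes modulo null sets, \<open>h\<close> may be any representative of the image of \<open>f\<close>, whereas \<open>f\<close> is
  the continuous representative.
\<close>

definition neg_second_deriv ::
    "('v, 'e) pre_digraph \<Rightarrow> ('e \<Rightarrow> real) \<Rightarrow> 'e edge_fun \<Rightarrow> 'e edge_fun \<Rightarrow> bool" where
  "neg_second_deriv G L f h \<longleftrightarrow> h \<in> graph_functions G L \<and>
     (\<forall>e\<in>arcs G. \<exists>g. sobolev_deriv (L e) (f e) g \<and> sobolev_deriv (L e) g (\<lambda>x. - h e x))"

definition standard_laplacian ::
    "('v, 'e) pre_digraph \<Rightarrow> ('e \<Rightarrow> real) \<Rightarrow> ('e edge_fun \<times> 'e edge_fun) set" where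
  "standard_laplacian G L = {(f, h). f \<in> H1_graph G L \<inter> H2_tilde G L \<and>
     (\<forall>v\<in>verts G. normal_deriv G L f v = 0) \<and> neg_second_deriv G L f h}"

definition dirichlet_laplacian ::
    "('v, 'e) pre_digraph \<Rightarrow> ('e \<Rightarrow> real) \<Rightarrow> ('e edge_fun \<times> 'e edge_fun) set" where
  "dirichlet_laplacian G L = {(f, h). f \<in> H2_tilde G L \<inter> H1_graph G L \<and>
     (\<forall>e\<in>arcs G. f e 0 = 0 \<and> f e (L e) = 0) \<and> neg_second_deriv G L f h}"

section \<open>Eigenvalues counted with multiplicities\<close>

definition scale_fun :: "complex \<Rightarrow> 'e edge_fun \<Rightarrow> 'e edge_fun" where
  "scale_fun c f = (\<lambda>e x. c * f e x)"

interpretation edge_fun: vector_space scale_fun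
  by unfold_locales (auto simp: scale_fun_def fun_eq_iff algebra_simps)

text \<open>
  The operators considered are selfadjoint, so only real eigenvalues are relevant.
\<close>

definition eigenspace :: "('e edge_fun \<times> 'e edge_fun) set \<Rightarrow> real \<Rightarrow> 'e edge_fun set" where
  "eigenspace A \<mu> = {f. (f, scale_fun (complex_of_real \<mu>) f) \<in> A}"

definition eigenvalue_mult :: "('e edge_fun \<times> 'e edge_fun) set \<Rightarrow> real \<Rightarrow> nat" where
  "eigenvalue_mult A \<mu> = edge_fun.dim (eigenspace A \<mu>)"

text \<open>
  The \<open>k\<close>-th eigenvalue (\<open>k \<ge> 1\<close>) is the smallest \<open>x\<close> such that at least \<open>k\<close> eigenvalues, counted
  with multiplicities, are \<open>\<le> x\<close>. By \<open>kth_eigenvalue_listing\<close> below this is the \<open>k\<close>-th entry of the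
  list of all eigenvalues in nondecreasing order with multiplicities.
\<close>

definition kth_eigenvalue :: "('e edge_fun \<times> 'e edge_fun) set \<Rightarrow> nat \<Rightarrow> real" where
  "kth_eigenvalue A k =
     Inf {x. \<exists>M. finite M \<and> M \<subseteq> {..x} \<and> k \<le> (\<Sum>\<mu>\<in>M. eigenvalue_mult A \<mu>)}"

lemma kth_eigenvalue_listing:
  fixes ev :: "nat \<Rightarrow> real"
  assumes mono: "\<And>i j. 1 \<le> i \<Longrightarrow> i \<le> j \<Longrightarrow> ev i \<le> ev j"
    and fin: "\<And>\<mu>. finite {i. 1 \<le> i \<and> ev i = \<mu>}"
    and mult: "\<And>\<mu>. card {i. 1 \<le> i \<and> ev i = \<mu>} = eigenvalue_mult A \<mu>"
    and k: "1 \<le> k"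
  shows "kth_eigenvalue A k = ev k"
proof -
  let ?I = "\<lambda>\<mu>. {i. 1 \<le> i \<and> ev i = \<mu>}"
  have sum_eq: "(\<Sum>\<mu>\<in>M. eigenvalue_mult A \<mu>) = card (\<Union>\<mu>\<in>M. ?I \<mu>)" if "finite M" for M
    unfolding mult[symmetric] by (rule card_UN_disjoint[symmetric]) (use that fin in auto)
  have "{x. \<exists>M. finite M \<and> M \<subseteq> {..x} \<and> k \<le> (\<Sum>\<mu>\<in>M. eigenvalue_mult A \<mu>)} = {ev k..}"
  proof (intro equalityI subsetI)
    fix x assume "x \<in> {x. \<exists>M. finite M \<and> M \<subseteq> {..x} \<and> k \<le> (\<Sum>\<mu>\<in>M. eigenvalue_mult A \<mu>)}"
    then obtain M where M: "finite M" "M \<subseteq> {..x}" "k \<le> card (\<Union>\<mu>\<in>M. ?I \<mu>)"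
      using sum_eq by auto
    show "x \<in> {ev k..}"
    proof (rule ccontr)
      assume "x \<notin> {ev k..}"
      hence "(\<Union>\<mu>\<in>M. ?I \<mu>) \<subseteq> {1..<k}"
        using M(2) mono[OF k] by (fastforce simp: not_le[symmetric])
      hence "card (\<Union>\<mu>\<in>M. ?I \<mu>) \<le> card {1..<k}"
        by (intro card_mono) auto
      thus False using M(3) k by simp
    qed
  next
    fix x assume x: "x \<in> {ev k..}"
    let ?M = "ev ` {1..k}"
    have "card {1..k} \<le> card (\<Union>\<mu>\<in>?M. ?I \<mu>)"
      by (rule card_mono) (use fin in auto)
    hence "k \<le> (\<Sum>\<mu>\<in>?M. eigenvalue_mult A \<mu>)"
      using sum_eq[of ?M] by simp
    moreover have "?M \<subseteq> {..x}"
      using x mono by fastforce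
    ultimately show "x \<in> {x. \<exists>M. finite M \<and> M \<subseteq> {..x} \<and> k \<le> (\<Sum>\<mu>\<in>M. eigenvalue_mult A \<mu>)}"
      by blast
  qed
  thus ?thesis by (simp add: kth_eigenvalue_def)
qed

end

theory Submission
  imports Defs
begin

text \<open>
  Let \<open>\<kappa> > 0\<close>. The Dirichlet Laplacian has
  \<open>N_D(\<kappa>) = (\<Sum>e. \<lfloor>\<kappa> L(e) / \<pi>\<rfloor>)\<close> eigenvalues \<open>\<le> \<kappa>\<^sup>2\<close>, because \<open>sin (\<kappa> L(e)) = 0\<close>
  decides edge by edge (\<open>dirichlet_mult\<close>, \<open>dirichlet_reaches_iff\<close>). The theorem amounts to three
  statements about the number of eigenvalues of the standard Laplacian: at least \<open>N_D(\<kappa>) + 1\<close> of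
  them are \<open>\<le> \<kappa>\<^sup>2\<close>; at least \<open>N_D(\<kappa>) + 1\<close> of them are \<open>< \<kappa>\<^sup>2\<close> if \<open>\<kappa> L(e) \<notin> \<pi>\<int>\<close> for some \<open>e\<close>; and at
  most \<open>N_D(\<kappa>)\<close> of them are \<open>< \<kappa>\<^sup>2\<close> if \<open>\<kappa> L(e) \<in> \<pi>\<int>\<close> for all \<open>e\<close>. A frequency of the last kind
  exists exactly if all quotients of lengths are rational.

  \<^bold>\<open>Reduction to finite dimension.\<close> Subdivide the edges into cells so short that \<open>\<kappa> h < \<pi>\<close> for
  each cell length \<open>h\<close>. For every frequency \<open>s \<le> \<kappa>\<close> a solution of \<open>- f'' = s\<^sup>2 f\<close> is determined on a
  cell by its values at the two ends, and \<open>\<integral>|f'|\<^sup>2 - s\<^sup>2 |f|\<^sup>2\<close> becomes a Hermitian form \<open>H s\<close> in the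
  values at the nodes. Its coefficients are built from \<open>s cot (s h / 2)\<close> and \<open>s tan (s h / 2)\<close>, hence
  \<open>H s\<close> is continuous and strictly decreasing in \<open>s\<close>, and \<open>H 0 \<ge> 0\<close>. Being in the kernel of \<open>H s\<close>
  means that the pieces fit together to a function satisfying the Kirchhoff conditions, so that the
  kernel is isomorphic to the eigenspace for \<open>s\<^sup>2\<close> (\<open>standard_mult\<close>).

  \<^bold>\<open>Spectral flow.\<close> As \<open>s\<close> grows from \<open>0\<close> to \<open>\<kappa>\<close>, the number of negative squares of \<open>H s\<close> starts at
  \<open>0\<close>, never decreases, and jumps exactly by the dimension of the kernel. Therefore the number of
  negative squares of \<open>H \<kappa>\<close> is the number of eigenvalues below \<open>\<kappa>\<^sup>2\<close> (\<open>flow_lower\<close>, \<open>flow_upper\<close>). This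
  replaces the min-max principle and at the same time yields the existence of the eigenvalues.

  \<^bold>\<open>Trial space.\<close> Let \<open>r(e) = \<lfloor>\<kappa> L(e) / \<pi>\<rfloor>\<close> and cut the edge \<open>e\<close> into \<open>2 r(e)\<close> cells if
  \<open>r(e) > 0\<close>. These cells have length at least \<open>\<pi> / (2 \<kappa>)\<close>, so their
  diagonal coefficients in \<open>H \<kappa>\<close> are \<open>\<le> 0\<close>, and functions supported on the nodes with odd number, no two of which are neighbours, form an \<open>N_D(\<kappa>)\<close>-dimensional space
  on which \<open>H \<kappa> \<le> 0\<close>. On a tree there is a function \<open>\<phi>\<close> on the vertices that increases by \<open>L(e)\<close> along
  each edge \<open>e\<close>, and the wave \<open>exp (i \<kappa> \<phi>)\<close> supplies one more dimension: it is isotropic and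
  \<open>H \<kappa>\<close>-orthogonal to the functions above (\<open>trial_dim\<close>, \<open>trial_nonpos\<close>). By the law of inertia
  (\<open>inertia\<close>) this gives the first statement, and also the second if the trial space contains no
  eigenfunction. An eigenfunction in it has, on an edge with \<open>\<kappa> L(e) \<notin> \<pi>\<int>\<close>, the form
  \<open>c exp (i \<kappa> \<phi>)\<close> and carries the current \<open>\<kappa> |c|\<^sup>2\<close>; on a tree every current vanishes because every
  edge is a bridge (\<open>kernel_no_current\<close>), so \<open>c = 0\<close>. What remains vanishes at all vertices, and
  such an eigenfunction is \<open>0\<close> on a tree (\<open>kernel_vanishing_at_vertices\<close>). If \<open>\<kappa> L(e) = \<pi> r(e)\<close> for all
  \<open>e\<close>, then the diagonal coefficients are \<open>0\<close>, \<open>H \<kappa>\<close> couples only odd nodes with even ones, and it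
  cannot have more than \<open>N_D(\<kappa>)\<close> negative squares (\<open>orthonormal_commensurable\<close>): the third statement.
\<close>

section \<open>Dimensions and linear functionals\<close>

context vector_space
begin

text \<open>
  The ambient types are spaces of functions and thus not finite-dimensional. The bound
  \<open>U \<subseteq> span D\<close> with \<open>D\<close> finite takes the place of a finite-dimensional ambient space; it is needed in
  particular because \<^const>\<open>dim\<close> is \<open>0\<close> for a space without finite basis.
\<close>

lemma subspace_basis:
  assumes U: "subspace U" and UD: "U \<subseteq> span D" and D: "finite D"
  obtains C where "finite C" "C \<subseteq> U" "independent C" "span C = U" "card C = dim U"
proof -
  obtain C where C: "C \<subseteq> U" "independent C" "U \<subseteq> span C" "card C = dim U"
    using basis_exists by blast
  have "finite C"
    using independent_span_bound[OF D C(2)] C(1) UD by blast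
  moreover have "span C = U"
    using C(1,3) U span_minimal by blast
  ultimately show ?thesis using that C by blast
qed

lemma card_le_dim:
  assumes "B \<subseteq> U" "independent B" "U \<subseteq> span D" "finite D"
  shows "card B \<le> dim U"
proof -
  obtain C where C: "C \<subseteq> U" "independent C" "U \<subseteq> span C" "card C = dim U"
    using basis_exists by blast
  have "finite C"
    using independent_span_bound[OF assms(4) C(2)] C(1) assms(3) by blast
  then have "card B \<le> card C"
    using independent_span_bound[OF _ assms(2), of C] assms(1) C(3) by blast
  with C(4) show ?thesis by simp
qed

lemma dim_le_one_functional:
  fixes \<phi> :: "'b \<Rightarrow> 'a"
  assumes U: "subspace U" and UD: "U \<subseteq> span D" and D: "finite D"
    and add: "\<And>x y. \<phi> (x + y) = \<phi> x + \<phi> y" and scl: "\<And>c x. \<phi> (scale c x) = c * \<phi> x"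
  shows "dim U \<le> 1 + dim {u\<in>U. \<phi> u = 0}"
proof -
  let ?W = "{u\<in>U. \<phi> u = 0}"
  have z: "\<phi> 0 = 0" using scl[of 0 0] by simp
  have W: "subspace ?W"
    using U z by (auto simp: subspace_def add scl)
  have WD: "?W \<subseteq> span D" using UD by blast
  obtain C where C: "finite C" "span C = ?W" "card C = dim ?W"
    by (rule subspace_basis[OF W WD D])
  show ?thesis
  proof (cases "\<exists>u\<in>U. \<phi> u \<noteq> 0")
    case False
    then have "?W = U" by auto
    then show ?thesis by simp
  next
    case True
    then obtain u where u: "u \<in> U" "\<phi> u \<noteq> 0" by blast
    have "U \<subseteq> span (insert u C)"
    proof
      fix x assume x: "x \<in> U"
      let ?y = "x - scale (\<phi> x / \<phi> u) u"
      have "x = ?y + scale (\<phi> x / \<phi> u) u" by simp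
      then have "\<phi> x = \<phi> ?y + \<phi> x"
        using add[of ?y "scale (\<phi> x / \<phi> u) u"] scl[of "\<phi> x / \<phi> u" u] u by simp
      then have "?y \<in> ?W"
        using x u U by (auto intro!: subspace_diff subspace_scale)
      then have "?y \<in> span C" using C by simp
      then show "x \<in> span (insert u C)"
        using eq_span_insert_eq[of x] span_breakdown_eq by blast
    qed
    then have "dim U \<le> card (insert u C)"
      using C by (intro dim_le_card) auto
    also have "\<dots> \<le> 1 + dim ?W" using C card_insert_le_m1 by (simp add: card_insert_if)
    finally show ?thesis .
  qed
qed

text \<open>
  Each linear condition lowers the dimension by at most one. All dimension counts below, in
  particular those of the law of inertia, come from this inequality.
\<close>

lemma dim_le_functionals:
  fixes \<phi> :: "'i \<Rightarrow> 'b \<Rightarrow> 'a"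
  assumes B: "finite B" and D: "finite D"
    and add: "\<And>b x y. \<phi> b (x + y) = \<phi> b x + \<phi> b y" and scl: "\<And>b c x. \<phi> b (scale c x) = c * \<phi> b x"
    and U: "subspace U" and UD: "U \<subseteq> span D"
  shows "dim U \<le> card B + dim {u\<in>U. \<forall>b\<in>B. \<phi> b u = 0}"
  using B
proof (induction B)
  case empty
  then show ?case by simp
next
  case (insert a B)
  let ?W = "{u\<in>U. \<forall>b\<in>B. \<phi> b u = 0}"
  have z: "\<phi> b 0 = 0" for b using scl[of b 0 0] by simp
  have W: "subspace ?W"
    using U z by (auto simp: subspace_def add scl)
  have "dim ?W \<le> 1 + dim {u\<in>?W. \<phi> a u = 0}"
    by (rule dim_le_one_functional[OF W _ D]) (use UD add scl in auto)
  moreover have "{u\<in>?W. \<phi> a u = 0} = {u\<in>U. \<forall>b\<in>insert a B. \<phi> b u = 0}" by auto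
  ultimately show ?case using insert by simp
qed

lemma common_zero:
  fixes \<phi> :: "'i \<Rightarrow> 'b \<Rightarrow> 'a"
  assumes "finite B" "finite D"
    and "\<And>b x y. \<phi> b (x + y) = \<phi> b x + \<phi> b y" and "\<And>b c x. \<phi> b (scale c x) = c * \<phi> b x"
    and "subspace U" and "U \<subseteq> span D" and "card B < dim U"
  obtains u where "u \<in> U" "u \<noteq> 0" "\<And>b. b \<in> B \<Longrightarrow> \<phi> b u = 0"
proof -
  let ?W = "{u\<in>U. \<forall>b\<in>B. \<phi> b u = 0}"
  have "dim ?W \<noteq> 0"
    using dim_le_functionals[of B D \<phi> U] assms by simp
  then have "\<not> ?W \<subseteq> span {}"
    using dim_le_card[of ?W "{}"] by auto
  then show ?thesis using that by auto
qed

lemma independent_Un: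
  assumes B: "finite B" "independent B" and C: "finite C" "independent C"
    and trivial: "\<And>x. x \<in> span B \<Longrightarrow> x \<in> span C \<Longrightarrow> x = 0"
  shows "independent (B \<union> C)" "card (B \<union> C) = card B + card C"
proof -
  have "0 \<notin> B" using B(2) dependent_zero by blast
  then have disj: "B \<inter> C = {}"
    using trivial span_base by fastforce
  then show "card (B \<union> C) = card B + card C" using B C by (simp add: card_Un_disjoint)
  show "independent (B \<union> C)"
  proof (rule independent_if_scalars_zero)
    show "finite (B \<union> C)" using B C by simp
    fix f x assume s: "(\<Sum>x\<in>B \<union> C. scale (f x) x) = 0" and x: "x \<in> B \<union> C"
    let ?b = "\<Sum>x\<in>B. scale (f x) x" and ?c = "\<Sum>x\<in>C. scale (f x) x"
    have sum: "?b + ?c = 0" using s B C disj by (simp add: sum.union_disjoint)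
    then have eq: "?b = - ?c" by (simp add: eq_neg_iff_add_eq_0)
    have b: "?b \<in> span B" by (intro span_sum span_scale span_base)
    have c: "?c \<in> span C" by (intro span_sum span_scale span_base)
    have b0: "?b = 0" using trivial[OF b] eq c span_neg by metis
    then have c0: "?c = 0" using sum by simp
    show "f x = 0"
      using x independentD[OF B(2,1) subset_refl b0] independentD[OF C(2,1) subset_refl c0] by blast
  qed
qed

end

lemma (in vector_space_pair) dim_injective_image:
  assumes f: "Vector_Spaces.linear s1 s2 f" and U: "vs1.subspace U" "U \<subseteq> vs1.span D" "finite D"
    and inj: "\<And>u. u \<in> U \<Longrightarrow> f u = 0 \<Longrightarrow> u = 0"
  shows "vs2.dim (f ` U) = vs1.dim U"
proof -
  interpret f: Vector_Spaces.linear s1 s2 f by (rule f)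
  obtain C where C: "finite C" "C \<subseteq> U" "vs1.independent C" "vs1.span C = U" "card C = vs1.dim U"
    by (rule vs1.subspace_basis[OF U])
  have inj_on: "inj_on f U"
    using inj U(1) f.diff vs1.subspace_diff by (metis (no_types, lifting) inj_onI right_minus_eq)
  have "vs2.independent (f ` C)"
    by (rule f.independent_injective_image[OF C(3)]) (use inj_on C in simp)
  moreover have "f ` U = vs2.span (f ` C)" using f.span_image[of C] C(4) by simp
  ultimately have "vs2.dim (f ` U) = card (f ` C)"
    using vs2.dim_span_eq_card_independent by simp
  also have "\<dots> = card C" using inj_on C(2) by (intro card_image) (rule inj_on_subset)
  finally show ?thesis using C(5) by simp
qed

section \<open>Inertia of Hermitian forms\<close>

lemma linear_coefficient_zero:
  fixes z :: real assumes "\<And>t. 2 * t * z + t\<^sup>2 * q \<le> 0" shows "z = 0"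
proof (rule ccontr)
  assume z: "z \<noteq> 0"
  \<comment> \<open>small enough for the linear term to dominate the quadratic one\<close>
  define t where "t = z / (1 + \<bar>q\<bar>)"
  have *: "t * (1 + \<bar>q\<bar>) = z" by (simp add: t_def)
  have "t \<noteq> 0" using z * by auto
  have "2 * t * z + t\<^sup>2 * q = t\<^sup>2 * (2 * (1 + \<bar>q\<bar>) + q)"
    by (subst *[symmetric]) (simp add: algebra_simps power2_eq_square)
  moreover have "0 < t\<^sup>2 * (2 * (1 + \<bar>q\<bar>) + q)"
    using \<open>t \<noteq> 0\<close> by (intro mult_pos_pos) auto
  ultimately show False using assms[of t] by simp
qed

text \<open>
  Sesquilinearity and symmetry hold on the whole type, whereas the kernel, definiteness and all dimension
  counts refer to the finite-dimensional space \<open>span D\<close>.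
\<close>

locale hermitian_form = vector_space scale
  for scale :: "complex \<Rightarrow> 'b::ab_group_add \<Rightarrow> 'b" (infixr "\<odot>" 75) +
  fixes H :: "'b \<Rightarrow> 'b \<Rightarrow> complex" and D :: "'b set"
  assumes H_add: "H (x + y) z = H x z + H y z"
    and H_scale: "H (c \<odot> x) z = c * H x z"
    and H_sym: "H y x = cnj (H x y)"
    and finD: "finite D"
begin

definition kernel :: "'b set" where
  "kernel = {u \<in> span D. \<forall>v\<in>span D. H u v = 0}"

text \<open>
  With \<open>\<sigma> = 1\<close> and \<open>\<sigma> = -1\<close> this is a system normalised to \<open>+1\<close> and \<open>-1\<close>, respectively; the largest
  cardinality of such a system is the number of positive or negative squares of the form.
\<close>

definition orthonormal :: "real \<Rightarrow> 'b set \<Rightarrow> bool" where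
  "orthonormal \<sigma> B \<longleftrightarrow> finite B \<and> B \<subseteq> span D \<and>
     (\<forall>b\<in>B. \<forall>c\<in>B. H b c = (if b = c then complex_of_real \<sigma> else 0))"

lemma H_add_right: "H z (x + y) = H z x + H z y"
  using H_sym[of "x+y" z] H_sym[of x z] H_sym[of y z] H_add[of x y z]
  by (metis complex_cnj_add complex_cnj_cnj)

lemma H_scale_right: "H z (c \<odot> x) = cnj c * H z x"
  using H_sym[of "c \<odot> x" z] H_sym[of x z] H_scale[of c x z]
  by (metis complex_cnj_mult complex_cnj_cnj)

lemma H_0: "H 0 z = 0" "H z 0 = 0"
  using H_scale[of 0 0 z] H_scale_right[of z 0 0] by auto

lemma H_sum: "H (sum f A) z = (\<Sum>a\<in>A. H (f a) z)"
  by (induction A rule: infinite_finite_induct) (auto simp: H_0 H_add)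

lemma H_sum_right: "H z (sum f A) = (\<Sum>a\<in>A. H z (f a))"
  by (induction A rule: infinite_finite_induct) (auto simp: H_0 H_add_right)

lemma H_minus: "H (- x) z = - H x z" "H z (- x) = - H z x"
  using H_scale[of "-1" x z] H_scale_right[of z "-1" x] by auto

lemma H_diff: "H (x - y) z = H x z - H y z" "H z (x - y) = H z x - H z y"
  using H_add[of x "- y" z] H_add_right[of z x "- y"] by (auto simp: H_minus)

lemma H_self_real: "H x x = complex_of_real (Re (H x x))"
  using H_sym[of x x] by (metis Reals_cnj_iff complex_is_Real_iff of_real_Re)

lemma subspace_kernel: "subspace kernel"
  by (auto simp: subspace_def kernel_def H_0 H_add H_scale span_zero intro: span_add span_scale)

lemma kernel_subset: "kernel \<subseteq> span D"
  by (auto simp: kernel_def)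

lemma kernel_right: "u \<in> kernel \<Longrightarrow> v \<in> span D \<Longrightarrow> H v u = 0"
  using H_sym[of v u] by (simp add: kernel_def)

lemma form_add: "Re (H (x + y) (x + y)) = Re (H x x) + Re (H y y) + 2 * Re (H x y)"
  using H_sym[of y x] by (simp add: H_add H_add_right)

lemma H_expand:
  "H (\<Sum>b\<in>B. c b \<odot> b) (\<Sum>b\<in>B. c b \<odot> b) = (\<Sum>b\<in>B. \<Sum>d\<in>B. c b * (cnj (c d) * H b d))"
proof -
  have "H (\<Sum>b\<in>B. c b \<odot> b) (\<Sum>b\<in>B. c b \<odot> b) = (\<Sum>b\<in>B. c b * H b (\<Sum>b\<in>B. c b \<odot> b))"
    by (simp only: H_sum H_scale)
  also have "\<dots> = (\<Sum>b\<in>B. \<Sum>d\<in>B. c b * (cnj (c d) * H b d))"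
    by (simp only: H_sum_right H_scale_right sum_distrib_left)
  finally show ?thesis .
qed

lemma orthonormal_eval:
  assumes "orthonormal \<sigma> B"
  shows "H (\<Sum>b\<in>B. c b \<odot> b) (\<Sum>b\<in>B. c b \<odot> b) = of_real (\<sigma> * (\<Sum>b\<in>B. (cmod (c b))\<^sup>2))"
proof -
  have B: "finite B" "\<And>b d. b \<in> B \<Longrightarrow> d \<in> B \<Longrightarrow> H b d = (if b = d then complex_of_real \<sigma> else 0)"
    using assms by (auto simp: orthonormal_def)
  have "H (\<Sum>b\<in>B. c b \<odot> b) (\<Sum>b\<in>B. c b \<odot> b) = (\<Sum>b\<in>B. \<Sum>d\<in>B. c b * (cnj (c d) * H b d))"
    by (rule H_expand)
  also have "\<dots> = (\<Sum>b\<in>B. \<Sum>d\<in>B. if b = d then c b * cnj (c b) * of_real \<sigma> else 0)"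
    by (intro sum.cong refl) (auto simp: B)
  also have "\<dots> = (\<Sum>b\<in>B. c b * cnj (c b) * of_real \<sigma>)"
    using B(1) by simp
  also have "\<dots> = of_real (\<sigma> * (\<Sum>b\<in>B. (cmod (c b))\<^sup>2))"
    by (simp add: sum_distrib_left mult.commute complex_norm_square[symmetric] flip: of_real_mult of_real_power of_real_sum)
  finally show ?thesis .
qed

lemma orthonormal_coeff:
  assumes "orthonormal \<sigma> B" "d \<in> B"
  shows "H (\<Sum>b\<in>B. c b \<odot> b) d = c d * of_real \<sigma>"
proof -
  have B: "finite B" "\<And>b d. b \<in> B \<Longrightarrow> d \<in> B \<Longrightarrow> H b d = (if b = d then complex_of_real \<sigma> else 0)"
    using assms by (auto simp: orthonormal_def)
  have "H (\<Sum>b\<in>B. c b \<odot> b) d = (\<Sum>b\<in>B. if b = d then c d * of_real \<sigma> else 0)"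
    unfolding H_sum by (intro sum.cong refl) (auto simp: B assms(2) H_scale)
  also have "\<dots> = c d * of_real \<sigma>" using B(1) assms(2) by simp
  finally show ?thesis .
qed

lemma orthonormal_span:
  assumes "orthonormal \<sigma> B" "v \<in> span B"
  obtains c where "v = (\<Sum>b\<in>B. c b \<odot> b)"
  using assms span_finite[of B] by (auto simp: orthonormal_def)

lemma orthonormal_independent:
  assumes "orthonormal \<sigma> B" "\<sigma> \<noteq> 0"
  shows "independent B"
proof (rule independent_if_scalars_zero)
  show "finite B" using assms by (simp add: orthonormal_def)
  fix f b assume "(\<Sum>x\<in>B. f x \<odot> x) = 0" "b \<in> B"
  then show "f b = 0" using orthonormal_coeff[OF assms(1), of b f] assms(2) by (simp add: H_0)
qed

lemma orthonormal_definite: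
  assumes "orthonormal \<sigma> B" "v \<in> span B" "v \<noteq> 0" "\<sigma> \<noteq> 0"
  shows "0 < \<sigma> * Re (H v v)"
proof -
  obtain c where c: "v = (\<Sum>b\<in>B. c b \<odot> b)" using orthonormal_span[OF assms(1,2)] .
  have fin: "finite B" using assms(1) by (simp add: orthonormal_def)
  have "\<exists>b\<in>B. c b \<noteq> 0"
    using assms(3) c by (metis (no_types, lifting) scale_zero_left sum.neutral)
  then have "0 < (\<Sum>b\<in>B. (cmod (c b))\<^sup>2)"
    using fin by (meson sum_pos2 zero_le_power2 zero_less_norm_iff zero_less_power)
  then have "0 < \<sigma>\<^sup>2 * (\<Sum>b\<in>B. (cmod (c b))\<^sup>2)"
    using assms(4) by simp
  also have "\<dots> = \<sigma> * Re (H v v)"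
    unfolding c orthonormal_eval[OF assms(1)] Re_complex_of_real by (simp add: power2_eq_square)
  finally show ?thesis .
qed

lemma orthonormal_extend:
  assumes B: "orthonormal \<sigma> B" and v: "v \<in> span D" "\<And>b. b \<in> B \<Longrightarrow> H v b = 0"
    and pos: "0 < \<sigma> * Re (H v v)" and \<sigma>: "\<bar>\<sigma>\<bar> = 1"
  obtains w where "w = of_real (1 / sqrt (\<sigma> * Re (H v v))) \<odot> v"
    "orthonormal \<sigma> (insert w B)" "w \<notin> B"
proof -
  let ?r = "1 / sqrt (\<sigma> * Re (H v v))"
  let ?w = "of_real ?r \<odot> v"
  have "H ?w ?w = of_real (?r * ?r * Re (H v v))"
    by (subst H_self_real) (simp add: H_scale H_scale_right)
  also have "?r * ?r * Re (H v v) = \<sigma>"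
    using pos \<sigma> by (simp add: field_simps abs_if split: if_splits)
  finally have ww: "H ?w ?w = of_real \<sigma>" .
  have wb: "H ?w b = 0" "H b ?w = 0" if "b \<in> B" for b
    using v(2)[OF that] H_sym[of b v] by (auto simp: H_scale H_scale_right)
  have "?w \<notin> B" using ww wb \<sigma> by force
  moreover have "orthonormal \<sigma> (insert ?w B)"
    using B ww wb v(1) by (auto simp: orthonormal_def span_scale)
  ultimately show ?thesis using that by blast
qed

text \<open>
  This is the Gram-Schmidt process: as long as the system has fewer than \<open>dim U\<close> elements, some
  nonzero vector of \<open>U\<close> is orthogonal to it, and this vector can be normalised.
\<close>

lemma orthonormal_exists:
  assumes U: "subspace U" "U \<subseteq> span D" and \<sigma>: "\<bar>\<sigma>\<bar> = 1"
    and pos: "\<And>u. u \<in> U \<Longrightarrow> u \<noteq> 0 \<Longrightarrow> 0 < \<sigma> * Re (H u u)"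
  obtains B where "orthonormal \<sigma> B" "B \<subseteq> U" "card B = dim U"
proof -
  have \<sigma>0: "\<sigma> \<noteq> 0" using \<sigma> by auto
  have "\<exists>B. orthonormal \<sigma> B \<and> B \<subseteq> U \<and> card B = n" if "n \<le> dim U" for n
    using that
  proof (induction n)
    case 0
    show ?case by (rule exI[of _ "{}"]) (simp add: orthonormal_def)
  next
    case (Suc n)
    then obtain B where B: "orthonormal \<sigma> B" "B \<subseteq> U" "card B = n" by auto
    have fB: "finite B" using B by (simp add: orthonormal_def)
    obtain u where u: "u \<in> U" "u \<noteq> 0" "\<And>b. b \<in> B \<Longrightarrow> H u b = 0"
    proof (rule common_zero[OF fB finD, of "\<lambda>b u. H u b" U])
      show "card B < dim U" using B Suc.prems by simp
    qed (use U that in \<open>auto simp: H_add H_scale\<close>)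
    obtain w where w: "w = of_real (1 / sqrt (\<sigma> * Re (H u u))) \<odot> u"
      "orthonormal \<sigma> (insert w B)" "w \<notin> B"
      using orthonormal_extend[OF B(1) _ u(3) pos[OF u(1,2)] \<sigma>] u(1) U(2) by blast
    have "w \<in> U" using w(1) u(1) U(1) subspace_scale by blast
    then show ?case using w B fB by (intro exI[of _ "insert w B"]) auto
  qed
  then show ?thesis using that by blast
qed

lemma orthonormal_transfer:
  assumes "independent C" "C \<subseteq> span D" "\<bar>\<sigma>\<bar> = 1"
    and "\<And>v. v \<in> span C \<Longrightarrow> v \<noteq> 0 \<Longrightarrow> 0 < \<sigma> * Re (H v v)"
  obtains B where "orthonormal \<sigma> B" "card B = card C"
proof -
  have sub: "span C \<subseteq> span D" by (rule span_minimal[OF assms(2) subspace_span])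
  obtain B where "orthonormal \<sigma> B" "card B = dim (span C)"
    using orthonormal_exists[OF subspace_span sub assms(3,4)] by blast
  then show ?thesis using that dim_span_eq_card_independent[OF assms(1)] by simp
qed

lemma orthonormal_card:
  assumes "orthonormal \<sigma> B" "\<sigma> \<noteq> 0"
  shows "card B \<le> card D"
  using independent_span_bound[OF finD orthonormal_independent[OF assms]] assms(1)
  by (simp add: orthonormal_def)

definition maximal_orthonormal :: "real \<Rightarrow> 'b set \<Rightarrow> bool" where
  "maximal_orthonormal \<sigma> B \<longleftrightarrow> orthonormal \<sigma> B \<and> (\<forall>C. orthonormal \<sigma> C \<longrightarrow> card C \<le> card B)"

lemma maximal_orthonormal_exists:
  assumes "\<sigma> \<noteq> 0"
  obtains B where "maximal_orthonormal \<sigma> B"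
proof -
  let ?P = "\<lambda>n. \<exists>B. orthonormal \<sigma> B \<and> card B = n"
  have "?P 0" by (rule exI[of _ "{}"]) (simp add: orthonormal_def)
  moreover have "\<forall>n. ?P n \<longrightarrow> n \<le> card D" using orthonormal_card assms by blast
  ultimately obtain m where "?P m" "\<forall>n. ?P n \<longrightarrow> n \<le> m"
    using Nat.ex_has_greatest_nat[of ?P 0 "card D"] by blast
  then show ?thesis using that unfolding maximal_orthonormal_def by blast
qed

text \<open>
  Otherwise a vector of the wrong sign, once normalised, would enlarge the system.
\<close>

lemma semidefinite_on_complement:
  assumes "maximal_orthonormal \<sigma> B" "\<bar>\<sigma>\<bar> = 1" "v \<in> span D" "\<And>b. b \<in> B \<Longrightarrow> H v b = 0"
  shows "\<sigma> * Re (H v v) \<le> 0"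
proof (rule ccontr)
  assume "\<not> ?thesis"
  then obtain w where "orthonormal \<sigma> (insert w B)" "w \<notin> B"
    using orthonormal_extend[of \<sigma> B v] assms by (auto simp: maximal_orthonormal_def)
  moreover have "finite B" using assms by (simp add: maximal_orthonormal_def orthonormal_def)
  ultimately show False using assms(1) by (auto simp: maximal_orthonormal_def dest!: spec[of _ "insert w B"])
qed

text \<open>
  On the orthogonal complement of a maximal system the form is semidefinite, so by the argument of the
  Cauchy-Schwarz inequality an isotropic vector of the complement is orthogonal to the whole
  complement. It is orthogonal to the system by assumption, and the two together span the space.
\<close>

lemma isotropic_in_kernel:
  assumes B: "maximal_orthonormal \<sigma> B" and \<sigma>: "\<bar>\<sigma>\<bar> = 1" and v: "v \<in> span D" "\<And>b. b \<in> B \<Longrightarrow> H v b = 0"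
    and iso: "Re (H v v) = 0"
  shows "v \<in> kernel"
proof -
  have on: "orthonormal \<sigma> B" and fin: "finite B" and BD: "B \<subseteq> span D"
    using B by (auto simp: maximal_orthonormal_def orthonormal_def)
  have \<sigma>2: "of_real \<sigma> * of_real \<sigma> = (1::complex)"
    using \<sigma> by (auto simp: abs_if split: if_splits)
  have perp: "Re (H v y) = 0" if y: "y \<in> span D" "\<And>b. b \<in> B \<Longrightarrow> H y b = 0" for y
  proof -
    have "2 * t * (\<sigma> * Re (H v y)) + t\<^sup>2 * (\<sigma> * Re (H y y)) \<le> 0" for t
    proof -
      let ?z = "v + of_real t \<odot> y"
      have "\<sigma> * Re (H ?z ?z) \<le> 0"
        by (rule semidefinite_on_complement[OF B \<sigma>])
           (use v y in \<open>auto simp: H_add H_scale intro: span_add span_scale\<close>)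
      then show ?thesis
        by (simp add: form_add iso H_scale H_scale_right power2_eq_square algebra_simps)
    qed
    then have "\<sigma> * Re (H v y) = 0" by (rule linear_coefficient_zero)
    then show ?thesis using \<sigma> by auto
  qed
  have Re0: "Re (H v y) = 0" if y: "y \<in> span D" for y
  proof -
    \<comment> \<open>the orthogonal projection of \<open>y\<close> to \<open>span B\<close>; the factor \<open>\<sigma>\<close> compensates \<open>H b b = \<sigma>\<close>\<close>
    define p where "p = (\<Sum>b\<in>B. (of_real \<sigma> * H y b) \<odot> b)"
    have pD: "p \<in> span D"
      unfolding p_def using BD by (intro span_sum span_scale) auto
    have "H (y - p) b = 0" if "b \<in> B" for b
      using orthonormal_coeff[OF on that, of "\<lambda>b. of_real \<sigma> * H y b"] \<sigma>2
      by (simp add: H_diff p_def mult.assoc mult.commute)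
    then have "Re (H v (y - p)) = 0"
      using perp[of "y - p"] y pD span_diff by blast
    moreover have "H v p = 0"
      unfolding p_def H_sum_right by (intro sum.neutral) (auto simp: H_scale_right v)
    ultimately show ?thesis by (simp add: H_diff)
  qed
  \<comment> \<open>the imaginary part of \<open>H v y\<close> is the real part of \<open>H v (\<i> y)\<close>\<close>
  have "H v y = 0" if y: "y \<in> span D" for y
  proof -
    have "Re (H v (\<i> \<odot> y)) = 0" using Re0 y span_scale by blast
    then show ?thesis using Re0[OF y] by (simp add: H_scale_right complex_eq_iff)
  qed
  then show ?thesis using v(1) by (simp add: kernel_def)
qed

lemma dim_subset_span:
  assumes "S \<subseteq> T" "T \<subseteq> span D"
  shows "dim S \<le> dim T"
proof -
  obtain A where A: "A \<subseteq> S" "independent A" "S \<subseteq> span A" "card A = dim S"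
    using basis_exists by blast
  show ?thesis using card_le_dim[of A T D] A assms finD by auto
qed

text \<open>
  The part of \<open>U\<close> that is orthogonal to a maximal negative system \<open>B\<close> is at most \<open>card B\<close> dimensions
  smaller than \<open>U\<close>. On it the form is \<open>\<le> 0\<close> by assumption and \<open>\<ge> 0\<close> by maximality, hence it consists
  of isotropic vectors and lies in the kernel.
\<close>

lemma inertia:
  assumes B: "maximal_orthonormal (-1) B" and U: "subspace U" "U \<subseteq> span D"
    and neg: "\<And>u. u \<in> U \<Longrightarrow> Re (H u u) \<le> 0"
  shows "dim U \<le> card B + dim (U \<inter> kernel)"
proof -
  have fin: "finite B" using B by (auto simp: maximal_orthonormal_def orthonormal_def)
  let ?W = "{u\<in>U. \<forall>b\<in>B. H u b = 0}"
  have "?W \<subseteq> U \<inter> kernel"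
  proof
    fix u assume u: "u \<in> ?W"
    then have "u \<in> span D" using U by auto
    have "- 1 * Re (H u u) \<le> 0"
      by (rule semidefinite_on_complement[OF B]) (use u \<open>u \<in> span D\<close> in auto)
    then have "Re (H u u) = 0" using neg[of u] u by auto
    then show "u \<in> U \<inter> kernel"
      using isotropic_in_kernel[OF B _ \<open>u \<in> span D\<close>] u by auto
  qed
  then have "dim ?W \<le> dim (U \<inter> kernel)"
    using U by (intro dim_subset_span) auto
  moreover have "dim U \<le> card B + dim ?W"
    by (rule dim_le_functionals[OF fin finD _ _ U]) (auto simp: H_add H_scale)
  ultimately show ?thesis by simp
qed

text \<open>
  The inequality in Sylvester's law \<open>dim = n\<^sub>- + n\<^sub>+ + n\<^sub>0\<close> that bounds the kernel from below; a vector
  orthogonal to a maximal negative and to a maximal positive system is isotropic.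
\<close>

lemma dim_le_signature:
  assumes N: "maximal_orthonormal (-1) N" and P: "maximal_orthonormal 1 P"
  shows "dim (span D) \<le> card N + card P + dim kernel"
proof -
  have fin: "finite N" "finite P" using N P by (auto simp: maximal_orthonormal_def orthonormal_def)
  let ?W = "{u\<in>span D. \<forall>b\<in>N \<union> P. H u b = 0}"
  have "?W \<subseteq> kernel"
  proof
    fix u assume u: "u \<in> ?W"
    have "- 1 * Re (H u u) \<le> 0"
      by (rule semidefinite_on_complement[OF N]) (use u in auto)
    moreover have "1 * Re (H u u) \<le> 0"
      by (rule semidefinite_on_complement[OF P]) (use u in auto)
    ultimately have "Re (H u u) = 0" by simp
    then show "u \<in> kernel"
      using isotropic_in_kernel[OF N, of u] u by auto
  qed
  then have "dim ?W \<le> dim kernel" using kernel_subset by (rule dim_subset_span)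
  moreover have "dim (span D) \<le> card (N \<union> P) + dim ?W"
    by (rule dim_le_functionals[OF _ finD]) (use fin in \<open>auto simp: H_add H_scale\<close>)
  moreover have "card (N \<union> P) \<le> card N + card P" by (rule card_Un_le)
  ultimately show ?thesis by simp
qed

end

section \<open>Decreasing families of Hermitian forms\<close>

locale hermitian_flow = vector_space scale
  for scale :: "complex \<Rightarrow> 'b::ab_group_add \<Rightarrow> 'b" (infixr "\<odot>" 75) +
  fixes H :: "real \<Rightarrow> 'b \<Rightarrow> 'b \<Rightarrow> complex" and D :: "'b set" and T :: real
  assumes form: "hermitian_form scale (H t) D"
    and cont: "u \<in> span D \<Longrightarrow> v \<in> span D \<Longrightarrow> continuous_on {0..T} (\<lambda>t. H t u v)"
    and decreasing: "0 \<le> s \<Longrightarrow> s < t \<Longrightarrow> t \<le> T \<Longrightarrow> v \<in> span D \<Longrightarrow> v \<noteq> 0 \<Longrightarrow> Re (H t v v) < Re (H s v v)"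
    and nonneg: "v \<in> span D \<Longrightarrow> 0 \<le> Re (H 0 v v)"
begin

sublocale F: hermitian_form scale "H t" D for t :: real
  by (rule form)

text \<open>
  Definiteness on the span of an orthonormal system is an open condition: if every entry of the Gram
  matrix moves by at most \<open>\<epsilon>\<close>, the form moves by at most \<open>\<epsilon> (\<Sum>|c b|)\<^sup>2 \<le> \<epsilon> card B \<Sum>|c b|\<^sup>2\<close>. The
  choice \<open>\<epsilon> = 1 / (card B + 1)\<close> makes this smaller than the value \<open>\<Sum>|c b|\<^sup>2\<close> at the start.
\<close>

lemma definite_near:
  assumes on: "F.orthonormal s \<sigma> B" and \<sigma>: "\<bar>\<sigma>\<bar> = 1" and s: "s \<in> {0..T}"
  obtains \<delta> where "\<delta> > 0"
    "\<And>t v. t \<in> {0..T} \<Longrightarrow> \<bar>t - s\<bar> < \<delta> \<Longrightarrow> v \<in> span B \<Longrightarrow> v \<noteq> 0 \<Longrightarrow> 0 < \<sigma> * Re (H t v v)"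
proof -
  have fin: "finite B" and BD: "B \<subseteq> span D" using on by (auto simp: F.orthonormal_def)
  define \<epsilon> where "\<epsilon> = 1 / (real (card B) + 1)"
  have \<epsilon>: "\<epsilon> > 0" by (simp add: \<epsilon>_def add_nonneg_pos)
  have "\<forall>\<^sub>F t in at s within {0..T}. \<forall>p\<in>B \<times> B. cmod (H t (fst p) (snd p) - H s (fst p) (snd p)) < \<epsilon>"
  proof (intro eventually_ball_finite ballI)
    fix p assume "p \<in> B \<times> B"
    then have "continuous_on {0..T} (\<lambda>t. H t (fst p) (snd p))"
      using cont[of "fst p" "snd p"] BD by fastforce
    then have "((\<lambda>t. H t (fst p) (snd p)) \<longlongrightarrow> H s (fst p) (snd p)) (at s within {0..T})"
      using s by (simp add: continuous_on_def)
    then show "\<forall>\<^sub>F t in at s within {0..T}. cmod (H t (fst p) (snd p) - H s (fst p) (snd p)) < \<epsilon>"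
      using \<epsilon> by (auto simp: tendsto_iff dist_norm)
  qed (use fin in auto)
  then obtain \<delta> where \<delta>: "\<delta> > 0"
    "\<And>t b c. t \<in> {0..T} \<Longrightarrow> t \<noteq> s \<Longrightarrow> \<bar>t - s\<bar> < \<delta> \<Longrightarrow> b \<in> B \<Longrightarrow> c \<in> B \<Longrightarrow> cmod (H t b c - H s b c) < \<epsilon>"
    by (auto simp: eventually_at dist_real_def)
  have close: "cmod (H t b c - H s b c) \<le> \<epsilon>"
    if "t \<in> {0..T}" "\<bar>t - s\<bar> < \<delta>" "b \<in> B" "c \<in> B" for t b c
    using \<delta>(2)[OF that(1) _ that(2-4)] \<epsilon> by (cases "t = s") (auto intro: less_imp_le)
  show ?thesis
  proof (rule that[OF \<delta>(1)])
    fix t v assume t: "t \<in> {0..T}" "\<bar>t - s\<bar> < \<delta>" and v: "v \<in> span B" "v \<noteq> 0"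
    obtain c where c: "v = (\<Sum>b\<in>B. c b \<odot> b)" using F.orthonormal_span[OF on v(1)] .
    define S where "S = (\<Sum>b\<in>B. (cmod (c b))\<^sup>2)"
    have ev: "\<sigma> * Re (H s v v) = S"
      unfolding c F.orthonormal_eval[OF on] using \<sigma> by (auto simp: S_def abs_if split: if_splits)
    have S: "S > 0" using F.orthonormal_definite[OF on v] \<sigma> ev by force
    have expand: "H r v v = (\<Sum>b\<in>B. \<Sum>d\<in>B. c b * (cnj (c d) * H r b d))" for r
      unfolding c by (rule F.H_expand)
    have "cmod (H t v v - H s v v) = cmod (\<Sum>b\<in>B. \<Sum>d\<in>B. c b * (cnj (c d) * (H t b d - H s b d)))"
      unfolding expand by (simp add: sum_subtractf right_diff_distrib)
    also have "\<dots> \<le> (\<Sum>b\<in>B. \<Sum>d\<in>B. cmod (c b) * (cmod (c d) * \<epsilon>))"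
      by (intro order_trans[OF norm_sum] sum_mono)
         (auto simp: norm_mult intro!: mult_left_mono close t)
    also have "\<dots> = \<epsilon> * (\<Sum>b\<in>B. cmod (c b))\<^sup>2"
      by (simp add: power2_eq_square sum_product sum_distrib_left mult_ac)
    also have "\<dots> \<le> \<epsilon> * (S * card B)"
      using \<epsilon> sum_squared_le_sum_of_squares[of "\<lambda>b. cmod (c b)" B] by (simp add: S_def)
    also have "\<dots> < S" using S by (simp add: \<epsilon>_def field_simps)
    finally have "\<bar>Re (H t v v) - Re (H s v v)\<bar> < S"
      using abs_Re_le_cmod[of "H t v v - H s v v"] by simp
    then show "0 < \<sigma> * Re (H t v v)"
      using ev \<sigma> by (auto simp: abs_if split: if_splits)
  qed
qed

text \<open>
  Negative squares can only appear through the kernel. Let \<open>s\<close> be the infimum of the times at which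
  there are \<open>m = card B\<close> negative squares. At time \<open>s\<close> itself there are fewer, say \<open>p\<close>, since \<open>m\<close> negative
  squares would exist slightly earlier as well or, if \<open>s = 0\<close>, contradict \<open>H 0 \<ge> 0\<close>. The positive squares at time \<open>s\<close> survive
  for a short while, and since there are \<open>m\<close> negative ones arbitrarily soon after \<open>s\<close>, there were at
  most \<open>dim - m\<close> positive ones; thus the kernel at time \<open>s\<close> has dimension at least \<open>m - p\<close>. The \<open>p\<close>
  negative squares at time \<open>s\<close> are accounted for by induction.
\<close>

theorem flow_lower:
  assumes "F.orthonormal t (-1) B" "0 \<le> t" "t \<le> T"
  shows "\<exists>\<Lambda>. finite \<Lambda> \<and> \<Lambda> \<subseteq> {0..<t} \<and> card B \<le> (\<Sum>s\<in>\<Lambda>. dim (F.kernel s))"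
  using assms
proof (induction "card B" arbitrary: B t rule: less_induct)
  case less
  define m where "m = card B"
  show ?case
  proof (cases "m = 0")
    case True
    then show ?thesis by (intro exI[of _ "{}"]) (simp add: m_def)
  next
    case False
    define A where "A = {s\<in>{0..T}. \<exists>C. F.orthonormal s (-1) C \<and> card C = m}"
    have tA: "t \<in> A" using less.prems by (auto simp: A_def m_def)
    have bdd: "bdd_below A" by (rule bdd_belowI[of _ 0]) (auto simp: A_def)
    define s where "s = Inf A"
    have s0: "0 \<le> s" unfolding s_def using tA by (intro cInf_greatest) (auto simp: A_def)
    have st: "s \<le> t" unfolding s_def by (rule cInf_lower[OF tA bdd])
    have sT: "s \<in> {0..T}" using s0 st less.prems by simp
    obtain N where N: "F.maximal_orthonormal s (-1) N" using F.maximal_orthonormal_exists[of "-1" s] by auto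
    obtain P where P: "F.maximal_orthonormal s 1 P" using F.maximal_orthonormal_exists[of 1 s] by auto
    have Non: "F.orthonormal s (-1) N" and Pon: "F.orthonormal s 1 P"
      using N P by (auto simp: F.maximal_orthonormal_def)
    have fin: "finite N" "finite P" using Non Pon by (auto simp: F.orthonormal_def)
    \<comment> \<open>a system of \<open>m\<close> vectors at time \<open>s\<close> contradicts the choice of \<open>s\<close> as infimum\<close>
    have Nm: "card N < m"
    proof (rule ccontr)
      assume "\<not> card N < m"
      then obtain C where C: "C \<subseteq> N" "card C = m"
        using obtain_subset_with_card_n[of m N] by auto
      have Con: "F.orthonormal s (-1) C"
        using Non C(1) finite_subset[of C N] by (simp add: F.orthonormal_def subset_iff)
      have CD: "C \<subseteq> span D" using Con by (auto simp: F.orthonormal_def)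
      have indC: "independent C" by (rule F.orthonormal_independent[OF Con]) simp
      show False
      proof (cases "s = 0")
        case True
        from C(2) False obtain b where b: "b \<in> C" by fastforce
        then have "H s b b = -1" using Con by (simp add: F.orthonormal_def)
        then show False using nonneg[of b] b CD True by auto
      next
        case sn0: False
        obtain \<delta> where \<delta>: "\<delta> > 0" "\<And>t v. t \<in> {0..T} \<Longrightarrow> \<bar>t - s\<bar> < \<delta> \<Longrightarrow> v \<in> span C \<Longrightarrow> v \<noteq> 0 \<Longrightarrow> 0 < (-1) * Re (H t v v)"
          using definite_near[OF Con _ sT] by auto
        define r where "r = max (s - \<delta> / 2) 0"
        have r: "r \<in> {0..T}" "\<bar>r - s\<bar> < \<delta>" "r < s"
          using \<delta>(1) s0 sn0 sT by (auto simp: r_def max_def)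
        obtain C' where "F.orthonormal r (-1) C'" "card C' = card C"
          using F.orthonormal_transfer[OF indC CD, of "-1" r] \<delta>(2)[OF r(1,2)] by auto
        then have "r \<in> A" using r C by (auto simp: A_def)
        then have "s \<le> r" unfolding s_def by (rule cInf_lower[OF _ bdd])
        then show False using r by simp
      qed
    qed
    obtain \<delta> where \<delta>: "\<delta> > 0" "\<And>t v. t \<in> {0..T} \<Longrightarrow> \<bar>t - s\<bar> < \<delta> \<Longrightarrow> v \<in> span P \<Longrightarrow> v \<noteq> 0 \<Longrightarrow> 0 < 1 * Re (H t v v)"
      using definite_near[OF Pon _ sT] by auto
    have "Inf A < s + \<delta>" using \<delta>(1) by (simp add: s_def)
    then obtain a where a: "a \<in> A" "a < s + \<delta>"
      using cInf_lessD[of A "s + \<delta>"] tA by blast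
    have "s \<le> a" unfolding s_def by (rule cInf_lower[OF a(1) bdd])
    then have aT: "a \<in> {0..T}" "\<bar>a - s\<bar> < \<delta>" using a by (auto simp: A_def)
    obtain C where C: "F.orthonormal a (-1) C" "card C = m" using a(1) by (auto simp: A_def)
    have finC: "finite C" "C \<subseteq> span D" using C(1) by (auto simp: F.orthonormal_def)
    have PD: "P \<subseteq> span D" using Pon by (auto simp: F.orthonormal_def)
    have indC: "independent C" by (rule F.orthonormal_independent[OF C(1)]) simp
    have indP: "independent P" by (rule F.orthonormal_independent[OF Pon]) simp
    have triv: "x = 0" if "x \<in> span C" "x \<in> span P" for x
      using F.orthonormal_definite[OF C(1) that(1)] \<delta>(2)[OF aT that(2)] by force
    \<comment> \<open>at time \<open>a\<close> the form is negative on \<open>span C\<close> and still positive on \<open>span P\<close>\<close>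
    have "m + card P \<le> dim (span D)"
      using card_le_dim[of "C \<union> P" "span D" D] independent_Un[OF finC(1) indC fin(2) indP triv]
        finC PD C(2) F.finD by simp
    also have "\<dots> \<le> card N + card P + dim (F.kernel s)"
      by (rule F.dim_le_signature[OF N P])
    finally have m: "m \<le> card N + dim (F.kernel s)" by simp
    have "s \<noteq> t"
      using N Nm less.prems(1) by (auto simp: F.maximal_orthonormal_def m_def)
    then have st': "s < t" using st by simp
    obtain \<Lambda> where L: "finite \<Lambda>" "\<Lambda> \<subseteq> {0..<s}" "card N \<le> (\<Sum>s\<in>\<Lambda>. dim (F.kernel s))"
      using less.hyps[OF Nm[unfolded m_def] Non] s0 sT by auto
    have "s \<notin> \<Lambda>" using L(2) by auto
    then show ?thesis
      using L m st' s0 by (intro exI[of _ "insert s \<Lambda>"]) (auto simp: m_def)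
  qed
qed

text \<open>
  Conversely every kernel vector becomes a negative direction immediately afterwards and remains one,
  because the form is strictly decreasing: at the latest time \<open>s\<close> in \<open>\<Lambda>\<close> the form is \<open>\<le> 0\<close> on the sum of
  the kernel and the negative directions collected so far.
\<close>

theorem flow_upper:
  assumes "finite \<Lambda>" "\<Lambda> \<subseteq> {0..<t}" "t \<le> T"
  shows "\<exists>B. F.orthonormal t (-1) B \<and> card B = (\<Sum>s\<in>\<Lambda>. dim (F.kernel s))"
  using assms
proof (induction \<Lambda> arbitrary: t rule: finite_linorder_max_induct)
  case empty
  show ?case by (intro exI[of _ "{}"]) (simp add: F.orthonormal_def)
next
  case (insert s \<Lambda>)
  have s: "0 \<le> s" "s < t" "s \<le> T" using insert.prems by auto
  obtain B where B: "F.orthonormal s (-1) B" "card B = (\<Sum>s\<in>\<Lambda>. dim (F.kernel s))"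
    using insert.IH[of s] insert.hyps(2) insert.prems s by fastforce
  have finB: "finite B" "B \<subseteq> span D" using B(1) by (auto simp: F.orthonormal_def)
  have indB: "independent B" by (rule F.orthonormal_independent[OF B(1)]) simp
  obtain C where C: "finite C" "C \<subseteq> F.kernel s" "independent C" "span C = F.kernel s" "card C = dim (F.kernel s)"
    using subspace_basis[OF F.subspace_kernel F.kernel_subset F.finD] by blast
  have CD: "C \<subseteq> span D" using C(2) F.kernel_subset by blast
  have triv: "x = 0" if "x \<in> span B" "x \<in> span C" for x
  proof (rule ccontr)
    assume "x \<noteq> 0"
    then have "0 < -1 * Re (H s x x)" using F.orthonormal_definite[OF B(1) that(1)] by simp
    moreover have "H s x x = 0"
      using that(2) C(4) F.kernel_subset by (force simp: F.kernel_def)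
    ultimately show False by simp
  qed
  have neg: "0 < -1 * Re (H t v v)" if v: "v \<in> span (B \<union> C)" "v \<noteq> 0" for v
  proof -
    obtain x k where xk: "v = x + k" "x \<in> span B" "k \<in> span C" using v(1) by (auto simp: span_Un)
    have xD: "x \<in> span D" using xk(2) finB(2) span_minimal subspace_span by blast
    have kD: "k \<in> span D" using xk(3) CD span_minimal subspace_span by blast
    have "H s x k = 0" "H s k k = 0"
      using F.kernel_right[of k s] xD kD xk(3) C(4) by auto
    then have "Re (H s v v) = Re (H s x x)" by (simp add: xk F.form_add)
    also have "\<dots> \<le> 0"
      using F.orthonormal_definite[OF B(1) xk(2)] by (cases "x = 0") (auto simp: F.H_0)
    finally have "Re (H s v v) \<le> 0" .
    moreover have "Re (H t v v) < Re (H s v v)"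
      by (rule decreasing) (use s insert.prems v xk xD kD span_add in auto)
    ultimately show ?thesis by simp
  qed
  obtain B' where B': "F.orthonormal t (-1) B'" "card B' = card (B \<union> C)"
    using F.orthonormal_transfer[of "B \<union> C" "-1" t] independent_Un(1)[OF finB(1) indB C(1,3) triv] finB CD neg
    by auto
  have "s \<notin> \<Lambda>" using insert.hyps by auto
  then show ?case
    using B' independent_Un(2)[OF finB(1) indB C(1,3) triv] B(2) C(5) insert.hyps(1) by (intro exI[of _ B']) auto
qed

end

section \<open>Potentials on forests\<close>

text \<open>
  Paths ignore the orientation of the edges and use only edges from \<open>F\<close>; the vertices are listed
  including both ends and are distinct.
\<close>

inductive simple_path :: "('v, 'e) pre_digraph \<Rightarrow> 'e set \<Rightarrow> 'v list \<Rightarrow> 'e list \<Rightarrow> 'v \<Rightarrow> bool"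
  for G F where
  path_Nil: "simple_path G F [v] [] v"
| path_Cons: "simple_path G F (u # vs) es v \<Longrightarrow> w \<notin> set (u # vs) \<Longrightarrow> e \<in> F \<Longrightarrow> joins G e w u \<Longrightarrow>
    simple_path G F (w # u # vs) (e # es) v"

lemma simple_path_properties:
  assumes "simple_path G F vs es v"
  shows "vs \<noteq> [] \<and> length vs = Suc (length es) \<and> distinct vs \<and> distinct es \<and> set es \<subseteq> F \<and> last vs = v \<and>
    (\<forall>i<length es. joins G (es ! i) (vs ! i) (vs ! Suc i))"
  using assms
proof induction
  case (path_Nil v)
  then show ?case by simp
next
  case (path_Cons u vs es v w e)
  have "e \<notin> set es"
  proof
    assume "e \<in> set es"
    then obtain i where i: "i < length es" "es ! i = e" by (auto simp: in_set_conv_nth)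
    then have j: "joins G e ((u # vs) ! i) ((u # vs) ! Suc i)" using path_Cons.IH by auto
    have len: "i < length (u # vs)" "Suc i < length (u # vs)" using i path_Cons.IH by auto
    have "(u # vs) ! i \<in> set (u # vs)" "(u # vs) ! Suc i \<in> set (u # vs)"
      by (rule nth_mem, fact len)+
    then show False
      using j path_Cons.hyps by (auto simp: joins_def)
  qed
  then show ?case
    using path_Cons by (auto simp: less_Suc_eq_0_disj)
qed

lemma simple_path_suffix:
  assumes "simple_path G F vs es v" "w \<in> set vs"
  obtains vs' es' where "simple_path G F (w # vs') es' v"
  using assms
proof (induction arbitrary: thesis)
  case (path_Nil v)
  then show ?case using simple_path.path_Nil by fastforce
next
  case (path_Cons u vs es v x e)
  show ?case
  proof (cases "w = x")
    case True
    then show ?thesis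
      using path_Cons.prems(1) simple_path.path_Cons[OF path_Cons.hyps] by blast
  next
    case False
    then show ?thesis using path_Cons by auto
  qed
qed

lemma simple_path_cycle:
  assumes p: "simple_path G F (u # vs) es v" and e: "e \<notin> F" "joins G e v u"
  shows "undirected_cycle G (u # vs) (es @ [e])"
proof -
  note P = simple_path_properties[OF p]
  have "joins G ((es @ [e]) ! i) ((u # vs) ! i) ((u # vs) ! (Suc i mod length (u # vs)))"
    if "i < length (es @ [e])" for i
  proof (cases "i < length es")
    case True
    then show ?thesis using P by (simp add: nth_append)
  next
    case False
    then have "i = length es" using that by simp
    then show ?thesis
      using P e(2) last_conv_nth[of "u # vs"] by (simp add: nth_append)
  qed
  then show ?thesis using P e(1) by (auto simp: undirected_cycle_def)
qed

text \<open>
  Edges are added one at a time. Without a cycle the new edge joins different components, and the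
  potential can be shifted by a constant on the component of its head.
\<close>

lemma forest_potential:
  assumes F: "finite F" "F \<subseteq> arcs G" and acyclic: "\<not> (\<exists>vs es. undirected_cycle G vs es)"
  shows "\<exists>\<phi> :: 'v \<Rightarrow> real. \<forall>e\<in>F. \<phi> (head G e) - \<phi> (tail G e) = l e"
  using F
proof (induction F)
  case empty
  then show ?case by simp
next
  case (insert e F)
  then obtain \<phi> :: "'v \<Rightarrow> real" where \<phi>: "\<forall>e\<in>F. \<phi> (head G e) - \<phi> (tail G e) = l e" by auto
  \<comment> \<open>the component of the head of \<open>e\<close> in the forest \<open>F\<close>\<close>
  define R where "R = {w. \<exists>vs es. simple_path G F (w # vs) es (head G e)}"
  have closed: "w' \<in> R" if w: "w \<in> R" and f: "f \<in> F" "joins G f w' w" for w w' f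
  proof -
    obtain vs es where p: "simple_path G F (w # vs) es (head G e)" using w by (auto simp: R_def)
    show ?thesis
    proof (cases "w' \<in> set (w # vs)")
      case True
      obtain vs' es' where "simple_path G F (w' # vs') es' (head G e)"
        by (rule simple_path_suffix[OF p True])
      then show ?thesis by (auto simp: R_def)
    next
      case False
      then show ?thesis using simple_path.path_Cons[OF p False f] by (auto simp: R_def)
    qed
  qed
  have iff: "head G f \<in> R \<longleftrightarrow> tail G f \<in> R" if "f \<in> F" for f
    using closed[of "head G f" f "tail G f"] closed[of "tail G f" f "head G f"] that insert.prems
    by (auto simp: joins_def)
  have head: "head G e \<in> R" by (auto simp: R_def intro: simple_path.path_Nil)
  have tail: "tail G e \<notin> R"
  proof
    assume "tail G e \<in> R"
    then obtain vs es where p: "simple_path G F (tail G e # vs) es (head G e)" by (auto simp: R_def)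
    have "undirected_cycle G (tail G e # vs) (es @ [e])"
      by (rule simple_path_cycle[OF p]) (use insert in \<open>auto simp: joins_def\<close>)
    then show False using acyclic by blast
  qed
  define c where "c = l e - (\<phi> (head G e) - \<phi> (tail G e))"
  show ?case
  proof (intro exI ballI)
    fix f assume "f \<in> insert e F"
    then show "(if head G f \<in> R then \<phi> (head G f) + c else \<phi> (head G f)) -
        (if tail G f \<in> R then \<phi> (tail G f) + c else \<phi> (tail G f)) = l f"
      using \<phi> iff head tail by (auto simp: c_def)
  qed
qed

lemma (in metric_graph) connected_incident:
  assumes con: "Digraph_Component.connected G" and v: "v \<in> verts G"
  shows "\<exists>e\<in>arcs G. v = tail G e \<or> v = head G e"
proof -
  obtain e where e: "e \<in> arcs G" using arcs_nonempty by blast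
  let ?u = "tail G e"
  have "v \<rightarrow>\<^sup>*\<^bsub>with_proj (mk_symmetric G)\<^esub> ?u"
    using con v e tail_in_verts by (auto simp: Digraph_Component.connected_def strongly_connected_def)
  then have "(v, ?u) \<in> rtrancl_on (verts G) (parcs (mk_symmetric G))"
    by (simp add: reachable_def)
  then show ?thesis
  proof (cases rule: converse_rtrancl_on_cases)
    case base
    then show ?thesis using e by auto
  next
    case (step y)
    then show ?thesis by (auto simp: parcs_mk_symmetric)
  qed
qed

section \<open>Trigonometric solutions on an interval\<close>

text \<open>
  The solutions of \<open>f'' = - \<kappa>\<^sup>2 f\<close> with initial data \<open>(0, 1)\<close> and, for \<open>cos_freq\<close>, \<open>(1, 0)\<close>. Dividing
  the sine by \<open>\<kappa>\<close> includes the case \<open>\<kappa> = 0\<close> of affine functions, so that the eigenvalue \<open>0\<close> requires no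
  separate treatment.
\<close>

definition sin_freq :: "real \<Rightarrow> real \<Rightarrow> real" where
  "sin_freq \<kappa> x = (if \<kappa> = 0 then x else sin (\<kappa> * x) / \<kappa>)"

definition cos_freq :: "real \<Rightarrow> real \<Rightarrow> real" where
  "cos_freq \<kappa> x = cos (\<kappa> * x)"

lemma sin_freq_0 [simp]: "sin_freq \<kappa> 0 = 0" and cos_freq_0 [simp]: "cos_freq \<kappa> 0 = 1"
  by (auto simp: sin_freq_def cos_freq_def)

lemma sin_freq_pos: "0 \<le> \<kappa> \<Longrightarrow> 0 < x \<Longrightarrow> \<kappa> * x < pi \<Longrightarrow> 0 < sin_freq \<kappa> x"
  by (auto simp: sin_freq_def sin_gt_zero)

lemma cos_freq_sin_freq_sq: "(cos_freq \<kappa> x)\<^sup>2 + \<kappa>\<^sup>2 * (sin_freq \<kappa> x)\<^sup>2 = 1"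
  by (auto simp: cos_freq_def sin_freq_def power_divide)

lemma sin_freq_add: "sin_freq \<kappa> (x + y) = sin_freq \<kappa> x * cos_freq \<kappa> y + cos_freq \<kappa> x * sin_freq \<kappa> y"
  by (auto simp: cos_freq_def sin_freq_def distrib_left sin_add add_divide_distrib)

lemma cos_freq_add: "cos_freq \<kappa> (x + y) = cos_freq \<kappa> x * cos_freq \<kappa> y - \<kappa>\<^sup>2 * (sin_freq \<kappa> x * sin_freq \<kappa> y)"
  by (auto simp: cos_freq_def sin_freq_def distrib_left cos_add power2_eq_square)

lemma sin_freq_has_deriv: "(sin_freq \<kappa> has_real_derivative cos_freq \<kappa> x) (at x within S)"
  unfolding sin_freq_def[abs_def] cos_freq_def by (cases "\<kappa> = 0") (auto intro!: derivative_eq_intros)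

lemma cos_freq_has_deriv: "(cos_freq \<kappa> has_real_derivative - \<kappa>\<^sup>2 * sin_freq \<kappa> x) (at x within S)"
  unfolding sin_freq_def cos_freq_def[abs_def]
  by (cases "\<kappa> = 0") (auto intro!: derivative_eq_intros simp: power2_eq_square)

text \<open>
  The solution with value \<open>A\<close> and derivative \<open>B\<close> at \<open>0\<close>, and below its derivative.
\<close>

definition trig :: "real \<Rightarrow> complex \<Rightarrow> complex \<Rightarrow> real \<Rightarrow> complex" where
  "trig \<kappa> A B x = A * of_real (cos_freq \<kappa> x) + B * of_real (sin_freq \<kappa> x)"

definition trig' :: "real \<Rightarrow> complex \<Rightarrow> complex \<Rightarrow> real \<Rightarrow> complex" where
  "trig' \<kappa> A B x = B * of_real (cos_freq \<kappa> x) - of_real (\<kappa>\<^sup>2) * (A * of_real (sin_freq \<kappa> x))"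

lemma of_real_vderiv:
  "(f has_real_derivative d) F \<Longrightarrow> ((\<lambda>x. complex_of_real (f x)) has_vector_derivative of_real d) F"
  by (rule has_vector_derivative_of_real)
     (simp add: has_real_derivative_iff_has_vector_derivative)

lemma trig_vderiv: "(trig \<kappa> A B has_vector_derivative trig' \<kappa> A B x) (at x within S)"
proof -
  have "((\<lambda>x. A * of_real (cos_freq \<kappa> x) + B * of_real (sin_freq \<kappa> x)) has_vector_derivative
      A * of_real (- \<kappa>\<^sup>2 * sin_freq \<kappa> x) + B * of_real (cos_freq \<kappa> x)) (at x within S)"
    by (intro has_vector_derivative_add has_vector_derivative_mult_right of_real_vderiv
        cos_freq_has_deriv sin_freq_has_deriv)
  then show ?thesis by (simp add: trig_def[abs_def] trig'_def algebra_simps)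
qed

lemma trig'_vderiv: "(trig' \<kappa> A B has_vector_derivative - (of_real (\<kappa>\<^sup>2) * trig \<kappa> A B x)) (at x within S)"
proof -
  have "((\<lambda>x. B * of_real (cos_freq \<kappa> x) - of_real (\<kappa>\<^sup>2) * (A * of_real (sin_freq \<kappa> x))) has_vector_derivative
      B * of_real (- \<kappa>\<^sup>2 * sin_freq \<kappa> x) - of_real (\<kappa>\<^sup>2) * (A * of_real (cos_freq \<kappa> x))) (at x within S)"
    by (intro has_vector_derivative_diff has_vector_derivative_mult_right of_real_vderiv
        cos_freq_has_deriv sin_freq_has_deriv)
  also have "B * of_real (- \<kappa>\<^sup>2 * sin_freq \<kappa> x) - of_real (\<kappa>\<^sup>2) * (A * of_real (cos_freq \<kappa> x)) =
      - (of_real (\<kappa>\<^sup>2) * trig \<kappa> A B x)"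
    by (simp add: trig_def algebra_simps)
  finally show ?thesis unfolding trig'_def[abs_def] .
qed

lemma trig_at_0 [simp]: "trig \<kappa> A B 0 = A" "trig' \<kappa> A B 0 = B"
  by (auto simp: trig_def trig'_def)

lemma trig_add:
  "trig \<kappa> A B (x + y) = trig \<kappa> A B x * of_real (cos_freq \<kappa> y) + trig' \<kappa> A B x * of_real (sin_freq \<kappa> y)"
  "trig' \<kappa> A B (x + y) = trig' \<kappa> A B x * of_real (cos_freq \<kappa> y) - of_real (\<kappa>\<^sup>2) * (trig \<kappa> A B x * of_real (sin_freq \<kappa> y))"
  by (simp_all add: trig_def trig'_def sin_freq_add cos_freq_add algebra_simps)

text \<open>
  The derivatives at the ends of an interval of length \<open>l\<close> in terms of the two end values: this is the
  Dirichlet-to-Neumann map of the interval, whose coefficients define the Hermitian form below.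
\<close>

lemma trig_derivatives:
  assumes "sin_freq \<kappa> l \<noteq> 0"
  shows "trig' \<kappa> A B x = of_real (1 / sin_freq \<kappa> l) * trig \<kappa> A B (x + l) - of_real (cos_freq \<kappa> l / sin_freq \<kappa> l) * trig \<kappa> A B x"
    and "trig' \<kappa> A B (x + l) = of_real (cos_freq \<kappa> l / sin_freq \<kappa> l) * trig \<kappa> A B (x + l) - of_real (1 / sin_freq \<kappa> l) * trig \<kappa> A B x"
proof -
  let ?S = "complex_of_real (sin_freq \<kappa> l)" and ?C = "complex_of_real (cos_freq \<kappa> l)"
  have S: "?S \<noteq> 0" using assms by simp
  show "trig' \<kappa> A B x = of_real (1 / sin_freq \<kappa> l) * trig \<kappa> A B (x + l) - of_real (cos_freq \<kappa> l / sin_freq \<kappa> l) * trig \<kappa> A B x"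
    unfolding trig_add using S by (simp add: field_simps)
  have sq: "?C * ?C + of_real (\<kappa>\<^sup>2) * (?S * ?S) = 1"
    using arg_cong[OF cos_freq_sin_freq_sq[of \<kappa> l], of complex_of_real] by (simp add: power2_eq_square)
  have "?S * trig' \<kappa> A B (x + l) = ?C * trig \<kappa> A B (x + l) - trig \<kappa> A B x * (?C * ?C + of_real (\<kappa>\<^sup>2) * (?S * ?S))"
    unfolding trig_add by (simp add: algebra_simps)
  then show "trig' \<kappa> A B (x + l) = of_real (cos_freq \<kappa> l / sin_freq \<kappa> l) * trig \<kappa> A B (x + l) - of_real (1 / sin_freq \<kappa> l) * trig \<kappa> A B x"
    unfolding sq using S by (simp add: field_simps)
qed

text \<open>
  The current \<open>Im (f' cnj f)\<close> of a solution is conserved along an edge.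
\<close>

lemma trig_current: "Im (trig' \<kappa> A B x * cnj (trig \<kappa> A B x)) = Im (B * cnj A)"
proof -
  let ?C = "cos_freq \<kappa> x" and ?S = "sin_freq \<kappa> x"
  have "Im (trig' \<kappa> A B x * cnj (trig \<kappa> A B x)) = Im (B * cnj A) * (?C\<^sup>2 + \<kappa>\<^sup>2 * ?S\<^sup>2)"
    by (simp add: trig_def trig'_def algebra_simps power2_eq_square)
  then show ?thesis by (simp add: cos_freq_sin_freq_sq)
qed

section \<open>Sobolev derivatives and classical derivatives\<close>

text \<open>
  Pointwise \<open>|g| \<le> 1 + |g|\<^sup>2\<close>, and the interval is bounded.
\<close>

lemma L2_interval_integrable:
  assumes "g \<in> L2_interval l"
  shows "set_integrable lborel {0..l} g"
proof -
  have m: "set_borel_measurable lborel {0..l} g" and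
    i: "set_integrable lborel {0..l} (\<lambda>x. (cmod (g x))\<^sup>2)"
    using assms by (auto simp: L2_interval_def)
  have one: "set_integrable lborel {0..l} (\<lambda>x. 1 :: real)"
    by (rule borel_integrable_atLeastAtMost') simp
  have "set_integrable lborel {0..l} (\<lambda>x. 1 + (cmod (g x))\<^sup>2)"
    by (rule set_integral_add(1)[OF one i])
  then show ?thesis
    unfolding set_integrable_def
  proof (rule Bochner_Integration.integrable_bound)
    show "(\<lambda>x. indicat_real {0..l} x *\<^sub>R g x) \<in> borel_measurable lborel"
      using m by (simp add: set_borel_measurable_def)
    have "r \<le> 1 + r\<^sup>2" for r :: real
      using sum_squares_bound[of 1 r] by (simp add: power2_eq_square) (smt (verit) zero_le_square)
    then show "AE x in lborel. norm (indicat_real {0..l} x *\<^sub>R g x) \<le> norm (indicat_real {0..l} x *\<^sub>R (1 + (cmod (g x))\<^sup>2))"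
      by (auto intro!: AE_I2 simp: indicator_def)
  qed
qed

lemma sobolev_deriv_integral:
  assumes "sobolev_deriv l f g"
  shows "g integrable_on {0..l}" "\<And>x. x \<in> {0..l} \<Longrightarrow> f x = f 0 + integral {0..x} g"
proof -
  have i: "set_integrable lborel {0..l} g"
    using assms L2_interval_integrable by (auto simp: sobolev_deriv_def)
  show "g integrable_on {0..l}" by (rule set_borel_integral_eq_integral(1)[OF i])
  fix x assume x: "x \<in> {0..l}"
  have "set_integrable lborel {0..x} g"
    by (rule set_integrable_subset[OF i]) (use x in auto)
  then have "(LBINT t:{0..x}. g t) = integral {0..x} g" by (rule set_borel_integral_eq_integral(2))
  moreover have "f x = f 0 + (LBINT t:{0..x}. g t)"
    using assms x unfolding sobolev_deriv_def by blast
  ultimately show "f x = f 0 + integral {0..x} g" by argo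
qed

lemma sobolev_deriv_continuous:
  assumes "sobolev_deriv l f g"
  shows "continuous_on {0..l} f"
proof -
  have "continuous_on {0..l} (\<lambda>x. f 0 + integral {0..x} g)"
    by (intro continuous_intros indefinite_integral_continuous_1 sobolev_deriv_integral(1)[OF assms])
  then show ?thesis
    by (rule continuous_on_eq) (rule sobolev_deriv_integral(2)[OF assms, symmetric])
qed

lemma sobolev_deriv_vderiv:
  assumes "sobolev_deriv l f g" "continuous_on {0..l} g" "x \<in> {0..l}"
  shows "(f has_vector_derivative g x) (at x within {0..l})"
proof -
  have "((\<lambda>x. f 0 + integral {0..x} g) has_vector_derivative 0 + g x) (at x within {0..l})"
    by (intro has_vector_derivative_add has_vector_derivative_const integral_has_vector_derivative assms)
  then have "((\<lambda>x. f 0 + integral {0..x} g) has_vector_derivative g x) (at x within {0..l})" by simp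
  then show ?thesis
    by (rule has_vector_derivative_transform[where f = "\<lambda>x. f 0 + integral {0..x} g",
          OF assms(3) sobolev_deriv_integral(2)[OF assms(1)], rotated])
qed

lemma vderiv_sobolev:
  assumes d: "\<And>x. x \<in> {0..l} \<Longrightarrow> (f has_vector_derivative g x) (at x within {0..l})"
    and c: "continuous_on {0..l} g"
  shows "sobolev_deriv l f g"
  unfolding sobolev_deriv_def
proof (intro conjI ballI)
  have "set_borel_measurable lborel {0..l} g"
    unfolding set_borel_measurable_def using c
    by (auto intro!: borel_measurable_continuous_on_indicator)
  moreover have "set_integrable lborel {0..l} (\<lambda>x. (cmod (g x))\<^sup>2)"
    by (intro borel_integrable_atLeastAtMost' continuous_intros c)
  ultimately show "g \<in> L2_interval l" by (simp add: L2_interval_def)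
  fix x assume x: "x \<in> {0..l}"
  have "set_integrable lborel {0..x} g"
    by (rule borel_integrable_atLeastAtMost') (use c x in \<open>auto intro: continuous_on_subset\<close>)
  then have "(LBINT t:{0..x}. g t) = integral {0..x} g" by (rule set_borel_integral_eq_integral(2))
  moreover have "(g has_integral f x - f 0) {0..x}"
    by (rule fundamental_theorem_of_calculus)
       (use x in \<open>auto intro!: has_vector_derivative_within_subset[OF d]\<close>)
  ultimately show "f x = f 0 + (LBINT t:{0..x}. g t)" by (simp add: integral_unique)
qed

text \<open>
  Here the regularity is bootstrapped: \<open>f\<close> is continuous as an indefinite integral, then so is the
  second derivative, and all Sobolev derivatives are classical ones.
\<close>

lemma eigen_ode:
  assumes "sobolev_deriv l f g" "sobolev_deriv l g (\<lambda>x. - (\<mu> * f x))" "x \<in> {0..l}"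
  shows "(f has_vector_derivative g x) (at x within {0..l})"
    "(g has_vector_derivative - (\<mu> * f x)) (at x within {0..l})"
  by (intro sobolev_deriv_vderiv assms sobolev_deriv_continuous[OF assms(2)]
      continuous_intros sobolev_deriv_continuous[OF assms(1)])+

text \<open>
  The expressions \<open>f C - g S\<close> and \<open>\<kappa>\<^sup>2 f S + g C\<close>, with \<open>C\<close> and \<open>S\<close> the two basic solutions, have
  derivative \<open>0\<close>; solving for \<open>f\<close> uses \<open>C\<^sup>2 + \<kappa>\<^sup>2 S\<^sup>2 = 1\<close>.
\<close>

lemma eigen_ode_trig:
  assumes f: "\<And>x. x \<in> {0..l} \<Longrightarrow> (f has_vector_derivative g x) (at x within {0..l})"
    and g: "\<And>x. x \<in> {0..l} \<Longrightarrow> (g has_vector_derivative - (of_real (\<kappa>\<^sup>2) * f x)) (at x within {0..l})"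
    and x: "x \<in> {0..l}"
  shows "f x = trig \<kappa> (f 0) (g 0) x"
proof -
  let ?C = "\<lambda>x. complex_of_real (cos_freq \<kappa> x)" and ?S = "\<lambda>x. complex_of_real (sin_freq \<kappa> x)"
  have dC: "(?C has_vector_derivative of_real (- \<kappa>\<^sup>2 * sin_freq \<kappa> x)) (at x within {0..l})" for x
    by (intro of_real_vderiv cos_freq_has_deriv)
  have dS: "(?S has_vector_derivative of_real (cos_freq \<kappa> x)) (at x within {0..l})" for x
    by (intro of_real_vderiv sin_freq_has_deriv)
  obtain c where c: "\<And>x. x \<in> {0..l} \<Longrightarrow> f x * ?C x - g x * ?S x = c"
  proof (rule has_vector_derivative_zero_constant[of "{0..l}" "\<lambda>x. f x * ?C x - g x * ?S x"])
    fix x assume x: "x \<in> {0..l}"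
    have "((\<lambda>x. f x * ?C x - g x * ?S x) has_vector_derivative
       (f x * of_real (- \<kappa>\<^sup>2 * sin_freq \<kappa> x) + g x * ?C x) -
       (g x * of_real (cos_freq \<kappa> x) + - (of_real (\<kappa>\<^sup>2) * f x) * ?S x)) (at x within {0..l})"
      by (intro has_vector_derivative_diff has_vector_derivative_mult f g dC dS x)
    then show "((\<lambda>x. f x * ?C x - g x * ?S x) has_vector_derivative 0) (at x within {0..l})"
      by (simp add: algebra_simps)
  qed (use that in auto)
  then have 1: "f x * ?C x - g x * ?S x = f 0"
    using c[OF x] c[of 0] x by auto
  obtain c where c: "\<And>x. x \<in> {0..l} \<Longrightarrow> of_real (\<kappa>\<^sup>2) * (f x * ?S x) + g x * ?C x = c"
  proof (rule has_vector_derivative_zero_constant[of "{0..l}" "\<lambda>x. of_real (\<kappa>\<^sup>2) * (f x * ?S x) + g x * ?C x"])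
    fix x assume x: "x \<in> {0..l}"
    have "((\<lambda>x. of_real (\<kappa>\<^sup>2) * (f x * ?S x) + g x * ?C x) has_vector_derivative
       of_real (\<kappa>\<^sup>2) * (f x * of_real (cos_freq \<kappa> x) + g x * ?S x) +
       (g x * of_real (- \<kappa>\<^sup>2 * sin_freq \<kappa> x) + - (of_real (\<kappa>\<^sup>2) * f x) * ?C x)) (at x within {0..l})"
      by (intro has_vector_derivative_add has_vector_derivative_mult has_vector_derivative_mult_right f g dC dS x)
    then show "((\<lambda>x. of_real (\<kappa>\<^sup>2) * (f x * ?S x) + g x * ?C x) has_vector_derivative 0) (at x within {0..l})"
      by (simp add: algebra_simps)
  qed (use that in auto)
  then have 2: "of_real (\<kappa>\<^sup>2) * (f x * ?S x) + g x * ?C x = g 0"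
    using c[OF x] c[of 0] x by auto
  have "trig \<kappa> (f 0) (g 0) x = f x * ((?C x)\<^sup>2 + of_real (\<kappa>\<^sup>2) * (?S x)\<^sup>2)"
    unfolding trig_def 1[symmetric] 2[symmetric] by (simp add: algebra_simps power2_eq_square)
  also have "(?C x)\<^sup>2 + of_real (\<kappa>\<^sup>2) * (?S x)\<^sup>2 = of_real ((cos_freq \<kappa> x)\<^sup>2 + \<kappa>\<^sup>2 * (sin_freq \<kappa> x)\<^sup>2)"
    by simp
  finally show ?thesis by (simp only: cos_freq_sin_freq_sq of_real_1 mult_1_right)
qed

text \<open>
  The derivative of \<open>Re (f' cnj f)\<close> is \<open>|f'|\<^sup>2 - \<mu> |f|\<^sup>2\<close>, which is nonnegative and vanishes only where
  \<open>f\<close> does. Summed over the edges, this excludes negative eigenvalues.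
\<close>

lemma negative_energy:
  assumes f: "\<And>x. x \<in> {0..l} \<Longrightarrow> (f has_vector_derivative g x) (at x within {0..l})"
    and g: "\<And>x. x \<in> {0..l} \<Longrightarrow> (g has_vector_derivative - (of_real \<mu> * f x)) (at x within {0..l})"
    and \<mu>: "\<mu> < 0" and l: "0 < l"
  shows "Re (g 0 * cnj (f 0)) \<le> Re (g l * cnj (f l))"
    "Re (g 0 * cnj (f 0)) = Re (g l * cnj (f l)) \<Longrightarrow> x \<in> {0..l} \<Longrightarrow> f x = 0"
proof -
  define E where "E x = Re (g x * cnj (f x))" for x
  define E' where "E' x = - \<mu> * (cmod (f x))\<^sup>2 + (cmod (g x))\<^sup>2" for x
  have "(E has_vector_derivative E' x) (at x within {0..l})" if x: "x \<in> {0..l}" for x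
  proof -
    have "((\<lambda>x. g x * cnj (f x)) has_vector_derivative g x * cnj (g x) + - (of_real \<mu> * f x) * cnj (f x))
        (at x within {0..l})"
      by (intro has_vector_derivative_mult g has_vector_derivative_cnj f x)
    from bounded_linear.has_vector_derivative[OF bounded_linear_Re this]
    have "(E has_vector_derivative Re (g x * cnj (g x) + - (of_real \<mu> * f x) * cnj (f x))) (at x within {0..l})"
      by (simp add: E_def[abs_def])
    moreover have "Re (g x * cnj (g x) + - (of_real \<mu> * f x) * cnj (f x)) = E' x"
    proof -
      have "g x * cnj (g x) + - (of_real \<mu> * f x) * cnj (f x) =
          of_real ((cmod (g x))\<^sup>2) - of_real \<mu> * of_real ((cmod (f x))\<^sup>2)"
        unfolding complex_norm_square by (simp add: mult.assoc)
      also have "\<dots> = of_real (E' x)" by (simp add: E'_def)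
      finally show ?thesis by simp
    qed
    ultimately show ?thesis by simp
  qed
  then have I: "(E' has_integral E l - E 0) {0..l}"
    using l by (intro fundamental_theorem_of_calculus) auto
  have pos: "0 \<le> E' x" for x
    unfolding E'_def using \<mu> by (intro add_nonneg_nonneg mult_nonneg_nonneg) auto
  show "Re (g 0 * cnj (f 0)) \<le> Re (g l * cnj (f l))"
    using has_integral_nonneg[OF I] pos by (simp add: E_def)
  assume "Re (g 0 * cnj (f 0)) = Re (g l * cnj (f l))" and x: "x \<in> {0..l}"
  then have I0: "(E' has_integral 0) (cbox 0 l)" using I by (simp add: E_def)
  have cont: "continuous_on {0..l} f" "continuous_on {0..l} g"
    by (rule continuous_on_vector_derivative, fact f) (rule continuous_on_vector_derivative, fact g)
  have "continuous_on (cbox 0 l) E'"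
    unfolding E'_def[abs_def] using cont by (auto intro!: continuous_intros)
  then have "E' x = 0"
    using has_integral_0_cbox_imp_0[OF _ _ I0] pos x l by auto
  moreover have "0 \<le> - \<mu> * (cmod (f x))\<^sup>2" using \<mu> by (simp add: mult_nonpos_nonneg)
  moreover have "0 \<le> (cmod (g x))\<^sup>2" by simp
  ultimately have "- \<mu> * (cmod (f x))\<^sup>2 = 0" unfolding E'_def by linarith
  then show "f x = 0" using \<mu> by simp
qed

lemma vector_derivative_edge:
  assumes "(f has_vector_derivative d) (at x within {0..l})" "x \<in> {0..l}" "0 < (l::real)"
  shows "vector_derivative f (at x within {0..l}) = d"
  using vector_derivative_within_cbox[of 0 l x f d] assms by simp

section \<open>Eigenspaces as spaces of trigonometric functions\<close>

lemma sum_fun_apply: "(sum f A) x = (\<Sum>a\<in>A. f a x)"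
  by (induction A rule: infinite_finite_induct) auto

lemma sum_fun_apply2: "(sum f A) x y = (\<Sum>a\<in>A. f a x y)"
  by (induction A rule: infinite_finite_induct) auto

lemma dim_trivial: "V \<subseteq> {0} \<Longrightarrow> edge_fun.dim V = 0"
  using edge_fun.dim_le_card[of V "{}"] by simp

context metric_graph
begin

text \<open>
  Boundary terms of the edges, collected at the vertices; this is how the Kirchhoff condition enters
  all sums over edges.
\<close>

lemma sum_by_vertices:
  fixes p q :: "'e \<Rightarrow> complex"
  shows "(\<Sum>e\<in>arcs G. p e * c (head G e) - q e * c (tail G e)) =
     (\<Sum>v\<in>verts G. ((\<Sum>e\<in>in_arcs G v. p e) - (\<Sum>e\<in>out_arcs G v. q e)) * c v)"
proof -
  have "(\<Sum>e\<in>arcs G. p e * c (head G e)) = (\<Sum>v\<in>verts G. \<Sum>e\<in>{e\<in>arcs G. head G e = v}. p e * c (head G e))"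
    by (rule sum.group[symmetric]) auto
  also have "\<dots> = (\<Sum>v\<in>verts G. (\<Sum>e\<in>in_arcs G v. p e) * c v)"
    by (intro sum.cong) (auto simp: in_arcs_def sum_distrib_right)
  finally have 1: "(\<Sum>e\<in>arcs G. p e * c (head G e)) = (\<Sum>v\<in>verts G. (\<Sum>e\<in>in_arcs G v. p e) * c v)" .
  have "(\<Sum>e\<in>arcs G. q e * c (tail G e)) = (\<Sum>v\<in>verts G. \<Sum>e\<in>{e\<in>arcs G. tail G e = v}. q e * c (tail G e))"
    by (rule sum.group[symmetric]) auto
  also have "\<dots> = (\<Sum>v\<in>verts G. (\<Sum>e\<in>out_arcs G v. q e) * c v)"
    by (intro sum.cong) (auto simp: out_arcs_def sum_distrib_right)
  finally show ?thesis using 1 by (simp add: sum_subtractf left_diff_distrib)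
qed

text \<open>
  The differential equation \<open>- f'' = \<mu> f\<close> on every edge as a first-order system with \<open>g = f'\<close>.
\<close>

definition edge_eigen :: "real \<Rightarrow> 'e edge_fun \<Rightarrow> 'e edge_fun \<Rightarrow> bool" where
  "edge_eigen \<mu> f g \<longleftrightarrow> (\<forall>e\<in>arcs G. \<forall>x\<in>{0..L e}.
     (f e has_vector_derivative g e x) (at x within {0..L e}) \<and>
     (g e has_vector_derivative - (of_real \<mu> * f e x)) (at x within {0..L e}))"

lemma neg_second_deriv_iff:
  assumes "f \<in> graph_functions G L"
  shows "neg_second_deriv G L f (scale_fun (of_real \<mu>) f) \<longleftrightarrow> (\<exists>g. edge_eigen \<mu> f g)"
proof
  assume "neg_second_deriv G L f (scale_fun (of_real \<mu>) f)"
  then have "\<forall>e\<in>arcs G. \<exists>g. sobolev_deriv (L e) (f e) g \<and> sobolev_deriv (L e) g (\<lambda>x. - (of_real \<mu> * f e x))"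
    by (simp add: neg_second_deriv_def scale_fun_def)
  then obtain g where g: "\<And>e. e \<in> arcs G \<Longrightarrow> sobolev_deriv (L e) (f e) (g e) \<and>
      sobolev_deriv (L e) (g e) (\<lambda>x. - (of_real \<mu> * f e x))"
    by metis
  show "\<exists>g. edge_eigen \<mu> f g"
    unfolding edge_eigen_def using g eigen_ode by blast
next
  assume "\<exists>g. edge_eigen \<mu> f g"
  then obtain g where g: "edge_eigen \<mu> f g" by blast
  show "neg_second_deriv G L f (scale_fun (of_real \<mu>) f)"
    unfolding neg_second_deriv_def scale_fun_def
  proof (intro conjI ballI exI)
    show "(\<lambda>e x. of_real \<mu> * f e x) \<in> graph_functions G L"
      using assms by (auto simp: graph_functions_def)
    fix e assume e: "e \<in> arcs G"
    have f': "\<And>x. x \<in> {0..L e} \<Longrightarrow> (f e has_vector_derivative g e x) (at x within {0..L e})"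
      and g': "\<And>x. x \<in> {0..L e} \<Longrightarrow> (g e has_vector_derivative - (of_real \<mu> * f e x)) (at x within {0..L e})"
      using g e by (auto simp: edge_eigen_def)
    have cont: "continuous_on {0..L e} (f e)" "continuous_on {0..L e} (g e)"
      by (rule continuous_on_vector_derivative, fact f') (rule continuous_on_vector_derivative, fact g')
    show "sobolev_deriv (L e) (f e) (g e)" by (rule vderiv_sobolev[OF f' cont(2)])
    show "sobolev_deriv (L e) (g e) (\<lambda>x. - (of_real \<mu> * f e x))"
      by (rule vderiv_sobolev; (fact g' | intro continuous_intros cont))
  qed
qed

lemma edge_eigen_Sobolev:
  assumes "f \<in> graph_functions G L" "edge_eigen \<mu> f g"
  shows "f \<in> H2_tilde G L" "e \<in> arcs G \<Longrightarrow> f e \<in> H1_interval (L e)"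
proof -
  have "\<exists>g. sobolev_deriv (L e) (f e) g \<and> sobolev_deriv (L e) g (\<lambda>x. - (of_real \<mu> * f e x))" if "e \<in> arcs G" for e
    using neg_second_deriv_iff[OF assms(1), of \<mu>] assms(2) that
    by (auto simp: neg_second_deriv_def scale_fun_def)
  then show "f \<in> H2_tilde G L" "e \<in> arcs G \<Longrightarrow> f e \<in> H1_interval (L e)"
    using assms(1) unfolding H2_tilde_def H2_interval_def H1_interval_def mem_Collect_eq by blast+
qed

lemma edge_eigen_normal_deriv:
  assumes "edge_eigen \<mu> f g"
  shows "normal_deriv G L f v = (\<Sum>e\<in>in_arcs G v. g e (L e)) - (\<Sum>e\<in>out_arcs G v. g e 0)"
  unfolding normal_deriv_def
  by (intro arg_cong2[where f = "(-)"] sum.cong refl vector_derivative_edge)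
     (use assms length_pos in \<open>auto simp: edge_eigen_def less_imp_le\<close>)

lemma standard_eigenspace_iff:
  "f \<in> eigenspace (standard_laplacian G L) \<mu> \<longleftrightarrow> f \<in> graph_functions G L \<and>
    (\<exists>g u. edge_eigen \<mu> f g \<and> (\<forall>e\<in>arcs G. f e 0 = u (tail G e) \<and> f e (L e) = u (head G e)) \<and>
      (\<forall>v\<in>verts G. (\<Sum>e\<in>in_arcs G v. g e (L e)) - (\<Sum>e\<in>out_arcs G v. g e 0) = 0))"
  (is "?l \<longleftrightarrow> ?r")
proof
  assume l: ?l
  then have f: "f \<in> graph_functions G L" by (auto simp: eigenspace_def standard_laplacian_def H1_graph_def)
  obtain g where g: "edge_eigen \<mu> f g"
    using l neg_second_deriv_iff[OF f] by (auto simp: eigenspace_def standard_laplacian_def)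
  show ?r
    using l f g edge_eigen_normal_deriv[OF g]
    by (auto simp: eigenspace_def standard_laplacian_def H1_graph_def)
next
  assume r: ?r
  then obtain g u where f: "f \<in> graph_functions G L" and g: "edge_eigen \<mu> f g"
    and u: "\<forall>e\<in>arcs G. f e 0 = u (tail G e) \<and> f e (L e) = u (head G e)"
    and K: "\<forall>v\<in>verts G. (\<Sum>e\<in>in_arcs G v. g e (L e)) - (\<Sum>e\<in>out_arcs G v. g e 0) = 0"
    by blast
  have "neg_second_deriv G L f (scale_fun (of_real \<mu>) f)"
    using neg_second_deriv_iff[OF f] g by blast
  moreover have "f \<in> H1_graph G L" "f \<in> H2_tilde G L"
    using edge_eigen_Sobolev[OF f g] f u by (auto simp: H1_graph_def)
  ultimately show ?l
    using K edge_eigen_normal_deriv[OF g] by (simp add: eigenspace_def standard_laplacian_def)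
qed

lemma dirichlet_eigenspace_iff:
  "f \<in> eigenspace (dirichlet_laplacian G L) \<mu> \<longleftrightarrow> f \<in> graph_functions G L \<and>
    (\<exists>g. edge_eigen \<mu> f g) \<and> (\<forall>e\<in>arcs G. f e 0 = 0 \<and> f e (L e) = 0)"
  (is "?l \<longleftrightarrow> ?r")
proof
  assume l: ?l
  then have f: "f \<in> graph_functions G L" by (auto simp: eigenspace_def dirichlet_laplacian_def H1_graph_def)
  then show ?r
    using l neg_second_deriv_iff[OF f] by (auto simp: eigenspace_def dirichlet_laplacian_def)
next
  assume r: ?r
  then obtain g where f: "f \<in> graph_functions G L" and g: "edge_eigen \<mu> f g"
    and u: "\<forall>e\<in>arcs G. f e 0 = 0 \<and> f e (L e) = 0"
    by blast
  have "neg_second_deriv G L f (scale_fun (of_real \<mu>) f)"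
    using neg_second_deriv_iff[OF f] g by blast
  moreover have "f \<in> H1_graph G L" "f \<in> H2_tilde G L"
    using edge_eigen_Sobolev[OF f g] f u by (auto simp: H1_graph_def intro!: exI[of _ "\<lambda>_. 0"])
  ultimately show ?l
    using u by (simp add: eigenspace_def dirichlet_laplacian_def)
qed

lemma edge_eigen_trig:
  assumes "edge_eigen (\<kappa>\<^sup>2) f g" "e \<in> arcs G" "x \<in> {0..L e}"
  shows "f e x = trig \<kappa> (f e 0) (g e 0) x" "g e x = trig' \<kappa> (f e 0) (g e 0) x"
proof -
  have f: "\<And>x. x \<in> {0..L e} \<Longrightarrow> (f e has_vector_derivative g e x) (at x within {0..L e})"
    and g: "\<And>x. x \<in> {0..L e} \<Longrightarrow> (g e has_vector_derivative - (of_real (\<kappa>\<^sup>2) * f e x)) (at x within {0..L e})"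
    using assms by (auto simp: edge_eigen_def)
  have T: "f e y = trig \<kappa> (f e 0) (g e 0) y" if "y \<in> {0..L e}" for y
    by (rule eigen_ode_trig[OF _ _ that]; fact f g)
  show "f e x = trig \<kappa> (f e 0) (g e 0) x" by (rule T[OF assms(3)])
  have "(f e has_vector_derivative trig' \<kappa> (f e 0) (g e 0) x) (at x within {0..L e})"
    by (rule has_vector_derivative_transform[OF assms(3) T trig_vderiv])
  then show "g e x = trig' \<kappa> (f e 0) (g e 0) x"
    using f[OF assms(3)] vector_derivative_edge assms length_pos by metis
qed

lemma trig_edge_eigen:
  assumes "\<And>e x. e \<in> arcs G \<Longrightarrow> x \<in> {0..L e} \<Longrightarrow> f e x = trig \<kappa> (A e) (B e) x"
  shows "edge_eigen (\<kappa>\<^sup>2) f (\<lambda>e. trig' \<kappa> (A e) (B e))"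
  unfolding edge_eigen_def
proof (intro ballI conjI)
  fix e x assume e: "e \<in> arcs G" "x \<in> {0..L e}"
  show "(f e has_vector_derivative trig' \<kappa> (A e) (B e) x) (at x within {0..L e})"
    by (rule has_vector_derivative_transform[OF e(2) assms[OF e(1)] trig_vderiv])
  show "(trig' \<kappa> (A e) (B e) has_vector_derivative - (of_real (\<kappa>\<^sup>2) * f e x)) (at x within {0..L e})"
    using trig'_vderiv assms[OF e] by simp
qed

lemma standard_eigenspace_trig:
  "f \<in> eigenspace (standard_laplacian G L) (\<kappa>\<^sup>2) \<longleftrightarrow> f \<in> graph_functions G L \<and>
    (\<exists>B u. (\<forall>e\<in>arcs G. (\<forall>x\<in>{0..L e}. f e x = trig \<kappa> (u (tail G e)) (B e) x) \<and> f e (L e) = u (head G e)) \<and>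
      (\<forall>v\<in>verts G. (\<Sum>e\<in>in_arcs G v. trig' \<kappa> (u (tail G e)) (B e) (L e)) - (\<Sum>e\<in>out_arcs G v. B e) = 0))"
  (is "?l \<longleftrightarrow> ?r")
proof
  assume ?l
  then obtain g u where f: "f \<in> graph_functions G L" and g: "edge_eigen (\<kappa>\<^sup>2) f g"
    and u: "\<forall>e\<in>arcs G. f e 0 = u (tail G e) \<and> f e (L e) = u (head G e)"
    and K: "\<forall>v\<in>verts G. (\<Sum>e\<in>in_arcs G v. g e (L e)) - (\<Sum>e\<in>out_arcs G v. g e 0) = 0"
    unfolding standard_eigenspace_iff by blast
  show ?r
  proof (intro conjI f exI[of _ "\<lambda>e. g e 0"] exI[of _ u] ballI)
    fix e x assume "e \<in> arcs G" "x \<in> {0..L e}"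
    then show "f e x = trig \<kappa> (u (tail G e)) (g e 0) x"
      using edge_eigen_trig(1)[OF g] u by force
  next
    fix e assume "e \<in> arcs G" then show "f e (L e) = u (head G e)" using u by blast
  next
    fix v assume v: "v \<in> verts G"
    have "(\<Sum>e\<in>in_arcs G v. trig' \<kappa> (u (tail G e)) (g e 0) (L e)) = (\<Sum>e\<in>in_arcs G v. g e (L e))"
    proof (rule sum.cong[OF refl])
      fix e assume "e \<in> in_arcs G v"
      then have e: "e \<in> arcs G" by (simp add: in_arcs_def)
      then have "L e \<in> {0..L e}" using length_pos by (simp add: less_imp_le)
      from edge_eigen_trig(2)[OF g e this]
      show "trig' \<kappa> (u (tail G e)) (g e 0) (L e) = g e (L e)" using u e by metis
    qed
    then show "(\<Sum>e\<in>in_arcs G v. trig' \<kappa> (u (tail G e)) (g e 0) (L e)) - (\<Sum>e\<in>out_arcs G v. g e 0) = 0"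
      using K v by simp
  qed
next
  assume ?r
  then obtain B u where f: "f \<in> graph_functions G L"
    and t: "\<And>e x. e \<in> arcs G \<Longrightarrow> x \<in> {0..L e} \<Longrightarrow> f e x = trig \<kappa> (u (tail G e)) (B e) x"
    and h: "\<And>e. e \<in> arcs G \<Longrightarrow> f e (L e) = u (head G e)"
    and K: "\<And>v. v \<in> verts G \<Longrightarrow> (\<Sum>e\<in>in_arcs G v. trig' \<kappa> (u (tail G e)) (B e) (L e)) - (\<Sum>e\<in>out_arcs G v. B e) = 0"
    by blast
  have "f e 0 = u (tail G e)" if "e \<in> arcs G" for e
    using t[OF that, of 0] length_pos[OF that] by simp
  then show ?l
    unfolding standard_eigenspace_iff
    using f trig_edge_eigen[OF t] h K
    by (intro conjI exI[of _ "\<lambda>e. trig' \<kappa> (u (tail G e)) (B e)"] exI[of _ u]) auto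
qed

text \<open>
  For both operators the energies at the ends of the edges add up to \<open>0\<close>: by the boundary condition
  for Dirichlet functions, and by continuity and the Kirchhoff conditions for the standard Laplacian.
\<close>

lemma negative_eigenspaces:
  assumes \<mu>: "\<mu> < 0"
  shows "eigenspace (standard_laplacian G L) \<mu> \<subseteq> {0}" "eigenspace (dirichlet_laplacian G L) \<mu> \<subseteq> {0}"
proof -
  have zero: "f = 0" if f: "f \<in> graph_functions G L" and g: "edge_eigen \<mu> f g"
    and sum: "(\<Sum>e\<in>arcs G. Re (g e (L e) * cnj (f e (L e))) - Re (g e 0 * cnj (f e 0))) = 0" for f g
  proof -
    have E: "Re (g e 0 * cnj (f e 0)) \<le> Re (g e (L e) * cnj (f e (L e)))"
      "Re (g e 0 * cnj (f e 0)) = Re (g e (L e) * cnj (f e (L e))) \<Longrightarrow> x \<in> {0..L e} \<Longrightarrow> f e x = 0"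
      if e: "e \<in> arcs G" for e x
    proof -
      have "\<And>x. x \<in> {0..L e} \<Longrightarrow> (f e has_vector_derivative g e x) (at x within {0..L e})"
        and "\<And>x. x \<in> {0..L e} \<Longrightarrow> (g e has_vector_derivative - (of_real \<mu> * f e x)) (at x within {0..L e})"
        using g e by (auto simp: edge_eigen_def)
      note N = negative_energy[OF this \<mu> length_pos[OF e]]
      show "Re (g e 0 * cnj (f e 0)) \<le> Re (g e (L e) * cnj (f e (L e)))" by (rule N(1))
      show "Re (g e 0 * cnj (f e 0)) = Re (g e (L e) * cnj (f e (L e))) \<Longrightarrow> x \<in> {0..L e} \<Longrightarrow> f e x = 0"
        by (rule N(2))
    qed
    have "\<forall>e\<in>arcs G. Re (g e (L e) * cnj (f e (L e))) - Re (g e 0 * cnj (f e 0)) = 0"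
      using sum E(1) by (subst (asm) sum_nonneg_eq_0_iff) auto
    then have "f e x = 0" for e x
      using E(2)[of e x] f by (cases "e \<in> arcs G \<and> x \<in> {0..L e}") (auto simp: graph_functions_def)
    then show ?thesis by (simp add: fun_eq_iff)
  qed
  show "eigenspace (dirichlet_laplacian G L) \<mu> \<subseteq> {0}"
    using zero unfolding dirichlet_eigenspace_iff subset_iff by auto
  show "eigenspace (standard_laplacian G L) \<mu> \<subseteq> {0}"
  proof
    fix f assume "f \<in> eigenspace (standard_laplacian G L) \<mu>"
    then obtain g u where f: "f \<in> graph_functions G L" and g: "edge_eigen \<mu> f g"
      and u: "\<forall>e\<in>arcs G. f e 0 = u (tail G e) \<and> f e (L e) = u (head G e)"
      and K: "\<forall>v\<in>verts G. (\<Sum>e\<in>in_arcs G v. g e (L e)) - (\<Sum>e\<in>out_arcs G v. g e 0) = 0"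
      unfolding standard_eigenspace_iff by blast
    have "(\<Sum>e\<in>arcs G. Re (g e (L e) * cnj (f e (L e))) - Re (g e 0 * cnj (f e 0))) =
        Re (\<Sum>e\<in>arcs G. g e (L e) * cnj (u (head G e)) - g e 0 * cnj (u (tail G e)))"
      using u by (simp add: Re_sum)
    also have "(\<Sum>e\<in>arcs G. g e (L e) * cnj (u (head G e)) - g e 0 * cnj (u (tail G e))) = 0"
      unfolding sum_by_vertices[where c = "\<lambda>v. cnj (u v)"] using K by (intro sum.neutral) simp
    finally show "f \<in> {0}" using zero[OF f g] by simp
  qed
qed

lemma negative_mult:
  "\<mu> < 0 \<Longrightarrow> eigenvalue_mult (standard_laplacian G L) \<mu> = 0"
  "\<mu> < 0 \<Longrightarrow> eigenvalue_mult (dirichlet_laplacian G L) \<mu> = 0"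
  by (simp_all add: eigenvalue_mult_def dim_trivial negative_eigenspaces)

text \<open>
  The sines on single edges, extended by \<open>0\<close>, are a basis of the eigenspace. For \<open>\<kappa> = 0\<close> both sides
  are \<open>0\<close>, as \<open>sin_freq 0 (L e) = L e\<close>.
\<close>

lemma dirichlet_mult:
  assumes \<kappa>: "0 \<le> \<kappa>"
  shows "eigenvalue_mult (dirichlet_laplacian G L) (\<kappa>\<^sup>2) = card {e\<in>arcs G. sin_freq \<kappa> (L e) = 0}"
proof -
  define E where "E = {e\<in>arcs G. sin_freq \<kappa> (L e) = 0}"
  define s :: "'e \<Rightarrow> 'e edge_fun" where
    "s e0 = (\<lambda>e x. if e = e0 \<and> x \<in> {0..L e} then of_real (sin_freq \<kappa> x) else 0)" for e0
  let ?V = "eigenspace (dirichlet_laplacian G L) (\<kappa>\<^sup>2)"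
  have finE: "finite E" by (simp add: E_def)
  have ex: "\<exists>x\<in>{0..L e}. sin_freq \<kappa> x \<noteq> 0" if "e \<in> arcs G" for e
  proof (cases "\<kappa> = 0")
    case True
    then show ?thesis using length_pos[OF that] by (auto simp: sin_freq_def intro!: bexI[of _ "L e"])
  next
    case False
    let ?x = "min (L e) (pi / (2 * \<kappa>))"
    have "0 < ?x" using \<kappa> False length_pos[OF that] by simp
    moreover have "\<kappa> * ?x \<le> \<kappa> * (pi / (2 * \<kappa>))" using \<kappa> by (intro mult_left_mono) auto
    moreover have "\<kappa> * (pi / (2 * \<kappa>)) = pi / 2" using False by simp
    ultimately have "\<kappa> * ?x < pi" using pi_gt_zero by linarith
    with \<open>0 < ?x\<close> have "0 < sin_freq \<kappa> ?x" using \<kappa> by (intro sin_freq_pos)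
    then show ?thesis using \<open>0 < ?x\<close> by (intro bexI[of _ ?x]) auto
  qed
  have inj: "inj_on s E"
  proof (rule inj_onI)
    fix a b assume ab: "a \<in> E" "b \<in> E" "s a = s b"
    obtain x where "x \<in> {0..L a}" "sin_freq \<kappa> x \<noteq> 0" using ex[of a] ab by (auto simp: E_def)
    then show "a = b" using fun_cong[OF fun_cong[OF ab(3), of a], of x] by (auto simp: s_def split: if_splits)
  qed
  have "edge_fun.independent (s ` E)"
  proof (rule edge_fun.independent_if_scalars_zero)
    show "finite (s ` E)" using finE by simp
    fix c b assume z: "(\<Sum>x\<in>s ` E. scale_fun (c x) x) = 0" and "b \<in> s ` E"
    then obtain a where a: "a \<in> E" "b = s a" by blast
    obtain x where x: "x \<in> {0..L a}" "sin_freq \<kappa> x \<noteq> 0" using ex[of a] a by (auto simp: E_def)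
    have "0 = (\<Sum>e\<in>E. scale_fun (c (s e)) (s e)) a x"
      using z by (simp add: sum.reindex[OF inj])
    also have "\<dots> = (\<Sum>e\<in>E. if e = a then c (s a) * of_real (sin_freq \<kappa> x) else 0)"
      unfolding sum_fun_apply2 scale_fun_def by (intro sum.cong refl) (use x in \<open>auto simp: s_def\<close>)
    also have "\<dots> = c (s a) * of_real (sin_freq \<kappa> x)" using a finE by simp
    finally show "c b = 0" using x a by simp
  qed
  moreover have "s ` E \<subseteq> ?V"
  proof
    fix f assume "f \<in> s ` E"
    then obtain a where a: "a \<in> arcs G" "sin_freq \<kappa> (L a) = 0" "f = s a" by (auto simp: E_def)
    have "f e x = trig \<kappa> 0 (if e = a then 1 else 0) x" if "e \<in> arcs G" "x \<in> {0..L e}" for e x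
      using that by (simp add: a s_def trig_def)
    from trig_edge_eigen[of f \<kappa> "\<lambda>_. 0" "\<lambda>e. if e = a then 1 else 0", OF this]
    show "f \<in> ?V"
      unfolding dirichlet_eigenspace_iff using a by (auto simp: graph_functions_def s_def)
  qed
  moreover have "?V \<subseteq> edge_fun.span (s ` E)"
  proof
    fix f assume "f \<in> ?V"
    then obtain g where f: "f \<in> graph_functions G L" and g: "edge_eigen (\<kappa>\<^sup>2) f g"
      and d: "\<And>e. e \<in> arcs G \<Longrightarrow> f e 0 = 0 \<and> f e (L e) = 0"
      unfolding dirichlet_eigenspace_iff by blast
    have t: "f e x = g e 0 * of_real (sin_freq \<kappa> x)" if "e \<in> arcs G" "x \<in> {0..L e}" for e x
      using edge_eigen_trig(1)[OF g that] d[OF that(1)] by (simp add: trig_def)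
    have z: "g e 0 = 0" if "e \<in> arcs G" "e \<notin> E" for e
      using t[OF that(1), of "L e"] d[OF that(1)] length_pos[OF that(1)] that by (auto simp: E_def)
    have "f e x = (\<Sum>a\<in>E. scale_fun (g a 0) (s a)) e x" for e x
    proof -
      have "(\<Sum>a\<in>E. scale_fun (g a 0) (s a)) e x =
          (\<Sum>a\<in>E. if a = e then (if x \<in> {0..L e} then g e 0 * of_real (sin_freq \<kappa> x) else 0) else 0)"
        unfolding sum_fun_apply2 scale_fun_def by (intro sum.cong refl) (auto simp: s_def)
      also have "\<dots> = (if e \<in> E \<and> x \<in> {0..L e} then g e 0 * of_real (sin_freq \<kappa> x) else 0)"
        using finE by simp
      also have "\<dots> = f e x"
      proof (cases "e \<in> arcs G \<and> x \<in> {0..L e}")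
        case True
        then show ?thesis using t[of e x] z[of e] by auto
      next
        case False
        then have "f e x = 0" using f by (auto simp: graph_functions_def)
        then show ?thesis using False by (auto simp: E_def)
      qed
      finally show ?thesis by simp
    qed
    then have "f = (\<Sum>a\<in>E. scale_fun (g a 0) (s a))" by blast
    moreover have "(\<Sum>a\<in>E. scale_fun (g a 0) (s a)) \<in> edge_fun.span (s ` E)"
      by (intro edge_fun.span_sum edge_fun.span_scale edge_fun.span_base imageI)
    ultimately show "f \<in> edge_fun.span (s ` E)" by simp
  qed
  ultimately have "card (s ` E) = edge_fun.dim ?V"
    by (intro edge_fun.basis_card_eq_dim)
  then have "card E = edge_fun.dim ?V" by (simp add: card_image[OF inj])
  then show ?thesis by (simp add: eigenvalue_mult_def E_def)
qed

end

section \<open>Monotone coefficients\<close>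

lemma less_tan:
  fixes x :: real assumes "0 < x" "x < pi / 2" shows "x < tan x"
proof -
  have "sin 0 - 0 * cos 0 < sin x - x * cos x"
  proof (rule DERIV_pos_imp_increasing_open[OF assms(1)])
    fix y assume y: "0 < y" "y < x"
    have "((\<lambda>z. sin z - z * cos z) has_real_derivative y * sin y) (at y)"
      by (auto intro!: derivative_eq_intros)
    moreover have "0 < y * sin y" using y assms by (intro mult_pos_pos sin_gt_zero) auto
    ultimately show "\<exists>d. ((\<lambda>z. sin z - z * cos z) has_real_derivative d) (at y) \<and> 0 < d" by blast
  qed (intro continuous_intros)
  then show ?thesis using assms cos_gt_zero[of x] by (simp add: tan_def field_simps)
qed

lemma div_tan_strict_antimono:
  fixes x y :: real assumes "0 < x" "x < y" "y < pi / 2" shows "y / tan y < x / tan x"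
proof -
  have "y * cos y / sin y < x * cos x / sin x"
  proof (rule DERIV_neg_imp_decreasing[OF assms(2)])
    fix z assume z: "x \<le> z" "z \<le> y"
    then have z': "0 < z" "z < pi / 2" using assms by auto
    have s: "0 < sin z" using z' by (intro sin_gt_zero) auto
    have "cos z < cos 0" using z' by (intro cos_monotone_0_pi) auto
    then have "cos z * sin z < 1 * sin z" using s by (intro mult_strict_right_mono) auto
    also have "\<dots> \<le> z" using sin_x_le_x z' by simp
    finally have *: "cos z * sin z < z" .
    have "((\<lambda>z. z * cos z / sin z) has_real_derivative
        ((cos z + z * - sin z) * sin z - z * cos z * cos z) / (sin z * sin z)) (at z)"
      using s by (auto intro!: derivative_eq_intros)
    moreover have "(cos z + z * - sin z) * sin z - z * cos z * cos z = cos z * sin z - z * ((sin z)\<^sup>2 + (cos z)\<^sup>2)"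
      by algebra
    then have "((cos z + z * - sin z) * sin z - z * cos z * cos z) / (sin z * sin z) < 0"
      using * s by (simp add: divide_neg_pos)
    ultimately show "\<exists>d. ((\<lambda>z. z * cos z / sin z) has_real_derivative d) (at z) \<and> d < 0" by blast
  qed
  then show ?thesis by (simp add: tan_def)
qed

text \<open>
  In this form the monotonicity of the coefficients in \<open>\<kappa>\<close> is visible: \<open>tan\<close> increases and \<open>x / tan x\<close>
  decreases on \<open>(0, \<pi>/2)\<close>.
\<close>

lemma half_angle:
  assumes "0 < \<kappa>" "0 < l" "\<kappa> * l < pi"
  shows "(1 - cos_freq \<kappa> l) / sin_freq \<kappa> l = \<kappa> * tan (\<kappa> * l / 2)"
    and "(1 + cos_freq \<kappa> l) / sin_freq \<kappa> l = \<kappa> / tan (\<kappa> * l / 2)"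
proof -
  let ?x = "\<kappa> * l / 2"
  have x: "0 < ?x" "?x < pi / 2" using assms by auto
  have s: "sin ?x > 0" "cos ?x > 0" using x by (auto intro!: sin_gt_zero cos_gt_zero)
  have "cos_freq \<kappa> l = cos (2 * ?x)" "sin_freq \<kappa> l = sin (2 * ?x) / \<kappa>"
    using assms by (auto simp: cos_freq_def sin_freq_def)
  note cs = this(1)[unfolded cos_double_sin] this(1)[unfolded cos_double_cos] this(2)[unfolded sin_double]
  show "(1 - cos_freq \<kappa> l) / sin_freq \<kappa> l = \<kappa> * tan ?x"
    unfolding cs(1,3) using s assms by (simp add: tan_def field_simps power2_eq_square)
  show "(1 + cos_freq \<kappa> l) / sin_freq \<kappa> l = \<kappa> / tan ?x"
    unfolding cs(2,3) using s assms by (simp add: tan_def field_simps power2_eq_square)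
qed

text \<open>
  The case \<open>s = 0\<close> is separate: there the two coefficients are \<open>0\<close> and \<open>2 / l\<close>, and \<open>x < tan x\<close> is used.
\<close>

lemma coefficients_strict_mono:
  assumes "0 \<le> s" "s < t" "0 < l" "t * l < pi"
  shows "(1 - cos_freq s l) / sin_freq s l < (1 - cos_freq t l) / sin_freq t l"
    and "(1 + cos_freq t l) / sin_freq t l < (1 + cos_freq s l) / sin_freq s l"
proof -
  have sl: "s * l < t * l" using assms by simp
  have t: "0 < t * l / 2" "t * l / 2 < pi / 2" using assms by auto
  note T = half_angle[of t l]
  have tp: "0 < tan (t * l / 2)" using t by (intro tan_gt_zero) auto
  have "(1 - cos_freq s l) / sin_freq s l < (1 - cos_freq t l) / sin_freq t l \<and>
     (1 + cos_freq t l) / sin_freq t l < (1 + cos_freq s l) / sin_freq s l"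
  proof (cases "s = 0")
    case True
    have "t / tan (t * l / 2) < 2 / l"
      using less_tan[OF t] tp assms by (simp add: field_simps)
    then show ?thesis using True T tp assms by (simp add: cos_freq_def sin_freq_def)
  next
    case False
    then have s: "0 < s" "0 < s * l / 2" "s * l / 2 < t * l / 2" using assms by auto
    note S = half_angle[of s l]
    have "tan (s * l / 2) < tan (t * l / 2)" using s t by (intro tan_monotone) auto
    moreover have "0 < tan (s * l / 2)" using s t by (intro tan_gt_zero) auto
    ultimately have "s * tan (s * l / 2) < t * tan (t * l / 2)"
      using assms s by (intro mult_strict_mono) auto
    moreover have "l / 2 * (t / tan (t * l / 2)) < l / 2 * (s / tan (s * l / 2))"
      using div_tan_strict_antimono[OF s(2,3) t(2)] by (simp add: mult.commute)
    then have "t / tan (t * l / 2) < s / tan (s * l / 2)"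
      using assms by (simp only: mult_less_cancel_left_pos half_gt_zero)
    ultimately show ?thesis using S T s assms sl by simp
  qed
  then show "(1 - cos_freq s l) / sin_freq s l < (1 - cos_freq t l) / sin_freq t l"
    and "(1 + cos_freq t l) / sin_freq t l < (1 + cos_freq s l) / sin_freq s l" by auto
qed

text \<open>
  At \<open>\<kappa> = 0\<close> the difference quotient of \<open>sin (\<kappa> l)\<close> tends to \<open>l\<close>.
\<close>

lemma continuous_sin_freq: "continuous_on S (\<lambda>\<kappa>. sin_freq \<kappa> l)"
proof -
  have "isCont (\<lambda>\<kappa>. sin_freq \<kappa> l) k" for k
  proof (cases "k = 0")
    case True
    have "((\<lambda>\<kappa>. sin (\<kappa> * l)) has_real_derivative l) (at 0)"
      by (auto intro!: derivative_eq_intros)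
    then have "((\<lambda>\<kappa>. sin (\<kappa> * l) / \<kappa>) \<longlongrightarrow> l) (at 0)"
      by (simp add: has_field_derivative_iff)
    then have "((\<lambda>\<kappa>. sin_freq \<kappa> l) \<longlongrightarrow> l) (at 0)"
      by (rule Lim_transform_eventually) (auto simp: eventually_at sin_freq_def intro!: exI[of _ 1])
    then show ?thesis using True by (simp add: isCont_def sin_freq_def)
  next
    case False
    have "isCont (\<lambda>\<kappa>. sin (\<kappa> * l) / \<kappa>) k" using False by (intro continuous_intros) auto
    moreover have "\<forall>\<^sub>F \<kappa> in nhds k. \<kappa> \<noteq> 0" using False by (rule t1_space_nhds)
    then have "\<forall>\<^sub>F \<kappa> in nhds k. sin (\<kappa> * l) / \<kappa> = sin_freq \<kappa> l"
      by eventually_elim (simp add: sin_freq_def)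
    ultimately show ?thesis using isCont_cong[of "\<lambda>\<kappa>. sin (\<kappa> * l) / \<kappa>" "\<lambda>\<kappa>. sin_freq \<kappa> l" k] by blast
  qed
  then show ?thesis by (simp add: continuous_at_imp_continuous_on)
qed

section \<open>The Hermitian form of a subdivided graph\<close>

definition fun_scale :: "complex \<Rightarrow> ('i \<Rightarrow> complex) \<Rightarrow> 'i \<Rightarrow> complex" where
  "fun_scale c u = (\<lambda>i. c * u i)"

interpretation fun_space: vector_space fun_scale
  by unfold_locales (auto simp: fun_scale_def fun_eq_iff algebra_simps)

definition delta :: "'i \<Rightarrow> 'i \<Rightarrow> complex" where
  "delta i = (\<lambda>k. if k = i then 1 else 0)"

lemma span_delta:
  assumes "finite N"
  shows "fun_space.span (delta ` N) = {u. \<forall>i. i \<notin> N \<longrightarrow> u i = 0}"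
proof
  have "fun_space.subspace {u. \<forall>i. i \<notin> N \<longrightarrow> u i = 0}"
    by (auto simp: fun_space.subspace_def fun_scale_def)
  then show "fun_space.span (delta ` N) \<subseteq> {u. \<forall>i. i \<notin> N \<longrightarrow> u i = 0}"
    by (intro fun_space.span_minimal) (auto simp: delta_def)
  show "{u. \<forall>i. i \<notin> N \<longrightarrow> u i = 0} \<subseteq> fun_space.span (delta ` N)"
  proof
    fix u :: "'a \<Rightarrow> complex" assume u: "u \<in> {u. \<forall>i. i \<notin> N \<longrightarrow> u i = 0}"
    have "u k = (\<Sum>i\<in>N. fun_scale (u i) (delta i)) k" for k
    proof -
      have "(\<Sum>i\<in>N. fun_scale (u i) (delta i)) k = (\<Sum>i\<in>N. if i = k then u k else 0)"
        unfolding sum_fun_apply fun_scale_def by (intro sum.cong) (auto simp: delta_def)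
      then show ?thesis using u assms by simp
    qed
    then have "u = (\<Sum>i\<in>N. fun_scale (u i) (delta i))" by blast
    moreover have "(\<Sum>i\<in>N. fun_scale (u i) (delta i)) \<in> fun_space.span (delta ` N)"
      by (intro fun_space.span_sum fun_space.span_scale fun_space.span_base imageI)
    ultimately show "u \<in> fun_space.span (delta ` N)" by simp
  qed
qed

lemma independent_delta: "finite N \<Longrightarrow> fun_space.independent (delta ` N)"
  and card_delta: "card (delta ` N) = card N"
proof -
  have inj: "inj_on delta N"
    by (auto simp: inj_on_def delta_def fun_eq_iff split: if_splits)
  then show "card (delta ` N) = card N" by (simp add: card_image)
  assume N: "finite N"
  show "fun_space.independent (delta ` N)"
  proof (rule fun_space.independent_if_scalars_zero)
    show "finite (delta ` N)" using N by simp
    fix c b assume z: "(\<Sum>x\<in>delta ` N. fun_scale (c x) x) = 0" and "b \<in> delta ` N"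
    then obtain i where i: "i \<in> N" "b = delta i" by blast
    have "0 = (\<Sum>k\<in>N. fun_scale (c (delta k)) (delta k)) i"
      using z by (simp add: sum.reindex[OF inj])
    also have "\<dots> = (\<Sum>k\<in>N. if k = i then c (delta i) else 0)"
      unfolding sum_fun_apply fun_scale_def by (intro sum.cong refl) (auto simp: delta_def)
    also have "\<dots> = c (delta i)" using i N by simp
    finally show "c b = 0" using i by simp
  qed
qed

text \<open>
  The form \<open>\<integral>(f' cnj g' - \<kappa>\<^sup>2 f cnj g)\<close> over an interval for solutions \<open>f\<close> and \<open>g\<close> with end values \<open>p, q\<close>
  and \<open>r, s\<close>, if \<open>a\<close> and \<open>b\<close> are the coefficients of \<open>trig_derivatives\<close>.
\<close>

definition cell :: "real \<Rightarrow> real \<Rightarrow> complex \<Rightarrow> complex \<Rightarrow> complex \<Rightarrow> complex \<Rightarrow> complex" where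
  "cell a b p q r s = of_real a * (p * cnj r + q * cnj s) - of_real b * (p * cnj s + q * cnj r)"

text \<open>
  In the sum and the difference of the end values the form is diagonal. Up to sign and the factor \<open>1/2\<close>
  its coefficients are \<open>a + b\<close> and \<open>b - a\<close>, those of \<open>coefficients_strict_mono\<close>.
\<close>

lemma cell_diag:
  "Re (cell a b p q p q) = ((a + b) * (cmod (p - q))\<^sup>2 - (b - a) * (cmod (p + q))\<^sup>2) / 2"
  unfolding cmod_power2 by (simp add: cell_def algebra_simps power2_eq_square add_divide_distrib diff_divide_distrib)

text \<open>
  The edge \<open>e\<close> is divided into \<open>n e\<close> cells of equal length, short enough that \<open>sin_freq \<kappa>\<close> is positive at
  the cell length for all frequencies \<open>\<kappa> \<le> T\<close>. An isolated vertex would be a node not seen by the form;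
  \<open>incident\<close> excludes it.
\<close>

locale subdivision = metric_graph G L
  for G :: "('v, 'e) pre_digraph" and L :: "'e \<Rightarrow> real" +
  fixes n :: "'e \<Rightarrow> nat" and T :: real
  assumes n_pos: "e \<in> arcs G \<Longrightarrow> 0 < n e"
    and short: "e \<in> arcs G \<Longrightarrow> T * (L e / n e) < pi"
    and incident: "v \<in> verts G \<Longrightarrow> \<exists>e\<in>arcs G. v = tail G e \<or> v = head G e"
begin

definition step :: "'e \<Rightarrow> real" where "step e = L e / n e"

text \<open>
  Interior nodes are the pairs \<open>(e, j)\<close> with \<open>0 < j < n e\<close>; the first and the last node of an edge are
  vertices. Hence functions on the nodes are automatically continuous at the vertices.
\<close>

definition node :: "'e \<Rightarrow> nat \<Rightarrow> 'v + 'e \<times> nat" where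
  "node e j = (if j = 0 then Inl (tail G e) else if j = n e then Inl (head G e) else Inr (e, j))"

definition nodes :: "('v + 'e \<times> nat) set" where
  "nodes = Inl ` verts G \<union> Inr ` (SIGMA e:arcs G. {0<..<n e})"

abbreviation D :: "(('v + 'e \<times> nat) \<Rightarrow> complex) set" where "D \<equiv> delta ` nodes"

definition diag_coeff :: "real \<Rightarrow> 'e \<Rightarrow> real" where "diag_coeff \<kappa> e = cos_freq \<kappa> (step e) / sin_freq \<kappa> (step e)"
definition coupling :: "real \<Rightarrow> 'e \<Rightarrow> real" where "coupling \<kappa> e = 1 / sin_freq \<kappa> (step e)"

definition H :: "real \<Rightarrow> (('v + 'e \<times> nat) \<Rightarrow> complex) \<Rightarrow> (('v + 'e \<times> nat) \<Rightarrow> complex) \<Rightarrow> complex" where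
  "H \<kappa> u v = (\<Sum>e\<in>arcs G. \<Sum>j<n e. cell (diag_coeff \<kappa> e) (coupling \<kappa> e)
     (u (node e j)) (u (node e (Suc j))) (v (node e j)) (v (node e (Suc j))))"

lemma finite_nodes: "finite nodes"
  by (auto simp: nodes_def)

lemma node_in_nodes: "e \<in> arcs G \<Longrightarrow> j \<le> n e \<Longrightarrow> node e j \<in> nodes"
  by (auto simp: nodes_def node_def image_iff)

lemma nodes_cases:
  assumes "i \<in> nodes"
  obtains e j where "e \<in> arcs G" "j \<le> n e" "i = node e j"
  using assms
proof (cases i)
  case (Inl v)
  then have "v \<in> verts G" using assms by (auto simp: nodes_def)
  then obtain e where e: "e \<in> arcs G" "v = tail G e \<or> v = head G e" using incident by blast
  then show ?thesis
    using that[of e 0] that[of e "n e"] n_pos[OF e(1)] Inl by (auto simp: node_def)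
next
  case (Inr p)
  then show ?thesis using assms that[of "fst p" "snd p"] by (auto simp: nodes_def node_def)
qed

lemma step_pos: "e \<in> arcs G \<Longrightarrow> 0 < step e"
  using length_pos n_pos by (simp add: step_def)

lemma sin_freq_step_pos:
  assumes "e \<in> arcs G" "0 \<le> \<kappa>" "\<kappa> \<le> T" shows "0 < sin_freq \<kappa> (step e)"
proof (rule sin_freq_pos)
  have "\<kappa> * step e \<le> T * step e" using assms step_pos by (intro mult_right_mono) (auto simp: less_imp_le)
  then show "\<kappa> * step e < pi" using short[OF assms(1)] by (simp add: step_def)
qed (use assms step_pos in auto)

lemma span_D: "fun_space.span D = {u. \<forall>i. i \<notin> nodes \<longrightarrow> u i = 0}"
  by (rule span_delta[OF finite_nodes])

lemma form_H: "hermitian_form fun_scale (H \<kappa>) D"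
proof
  fix x y z :: "('v + 'e \<times> nat) \<Rightarrow> complex" and c
  show "H \<kappa> (x + y) z = H \<kappa> x z + H \<kappa> y z"
    unfolding H_def sum.distrib[symmetric] by (intro sum.cong refl) (simp add: cell_def algebra_simps)
  show "H \<kappa> (fun_scale c x) z = c * H \<kappa> x z"
    unfolding H_def sum_distrib_left by (intro sum.cong refl) (simp add: cell_def fun_scale_def algebra_simps)
  show "H \<kappa> y x = cnj (H \<kappa> x y)"
    unfolding H_def cnj_sum by (intro sum.cong refl) (simp add: cell_def algebra_simps)
  show "finite D" using finite_nodes by simp
qed

lemma H_diag: "Re (H \<kappa> u u) = (\<Sum>e\<in>arcs G. \<Sum>j<n e.
    ((1 + cos_freq \<kappa> (step e)) / sin_freq \<kappa> (step e) * (cmod (u (node e j) - u (node e (Suc j))))\<^sup>2 -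
     (1 - cos_freq \<kappa> (step e)) / sin_freq \<kappa> (step e) * (cmod (u (node e j) + u (node e (Suc j))))\<^sup>2) / 2)"
  unfolding H_def Re_sum cell_diag
  by (intro sum.cong refl) (simp add: diag_coeff_def coupling_def add_divide_distrib diff_divide_distrib add.commute)

text \<open>
  On each cell the form is strictly decreasing unless both end values vanish, and every node belongs to
  a cell. At frequency \<open>0\<close> the coefficient of \<open>|p + q|\<^sup>2\<close> is \<open>0\<close>, so the form is nonnegative.
\<close>

sublocale flow: hermitian_flow fun_scale H D T
proof (intro hermitian_flow.intro hermitian_flow_axioms.intro)
  show "vector_space fun_scale" by (rule fun_space.vector_space_axioms)
  show "hermitian_form fun_scale (H t) D" for t by (rule form_H)
  show "continuous_on {0..T} (\<lambda>t. H t u v)" for u v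
    unfolding H_def cell_def diag_coeff_def coupling_def cos_freq_def
    by (intro continuous_intros continuous_sin_freq ballI) (use sin_freq_step_pos in \<open>force\<close>)+
  show "0 \<le> Re (H 0 v v)" for v
    unfolding H_diag using step_pos by (intro sum_nonneg) (auto simp: cos_freq_def sin_freq_def less_imp_le)
  fix s t v assume st: "0 \<le> s" "s < t" "t \<le> T" and v: "v \<in> fun_space.span D" "v \<noteq> 0"
  let ?A = "\<lambda>\<kappa> e. (1 + cos_freq \<kappa> (step e)) / sin_freq \<kappa> (step e)"
  let ?B = "\<lambda>\<kappa> e. (1 - cos_freq \<kappa> (step e)) / sin_freq \<kappa> (step e)"
  have ts: "t * step e < pi" if "e \<in> arcs G" for e
  proof -
    have "t * step e \<le> T * step e" using st step_pos[OF that] by (intro mult_right_mono) auto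
    then show ?thesis using short[OF that] by (simp add: step_def)
  qed
  have A: "?A t e < ?A s e" and B: "?B s e < ?B t e" if "e \<in> arcs G" for e
    using coefficients_strict_mono[OF st(1,2) step_pos[OF that] ts[OF that]] by auto
  let ?q = "\<lambda>\<kappa> e p r. (?A \<kappa> e * (cmod (p - r))\<^sup>2 - ?B \<kappa> e * (cmod (p + r))\<^sup>2) / 2"
  have le: "?q t e p r \<le> ?q s e p r" if "e \<in> arcs G" for e p r
    by (intro divide_right_mono diff_mono mult_right_mono less_imp_le[OF A[OF that]] less_imp_le[OF B[OF that]]) auto
  have less: "?q t e p r < ?q s e p r" if "e \<in> arcs G" "p \<noteq> 0 \<or> r \<noteq> 0" for e p r
  proof (cases "p = r")
    case True
    then have "0 < (cmod (p + r))\<^sup>2" using that(2) by simp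
    then have "?B s e * (cmod (p + r))\<^sup>2 < ?B t e * (cmod (p + r))\<^sup>2"
      by (rule mult_strict_right_mono[OF B[OF that(1)]])
    moreover have z: "(cmod (p - r))\<^sup>2 = 0" using True by simp
    ultimately show ?thesis unfolding z mult_zero_right by argo
  next
    case False
    then have "0 < (cmod (p - r))\<^sup>2" by simp
    then have "?A t e * (cmod (p - r))\<^sup>2 < ?A s e * (cmod (p - r))\<^sup>2"
      by (rule mult_strict_right_mono[OF A[OF that(1)]])
    moreover have "?B s e * (cmod (p + r))\<^sup>2 \<le> ?B t e * (cmod (p + r))\<^sup>2"
      by (intro mult_right_mono less_imp_le[OF B[OF that(1)]]) auto
    ultimately show ?thesis by argo
  qed
  obtain i where i: "v i \<noteq> 0" using v(2) by (auto simp: fun_eq_iff)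
  then have "i \<in> nodes" using v(1) by (auto simp: span_D)
  then obtain e j where ej: "e \<in> arcs G" "j \<le> n e" "i = node e j" by (rule nodes_cases)
  have "\<exists>j<n e. v (node e j) \<noteq> 0 \<or> v (node e (Suc j)) \<noteq> 0"
  proof (cases "j = n e")
    case True
    then show ?thesis using ej i n_pos[OF ej(1)] by (intro exI[of _ "n e - 1"]) simp
  next
    case False
    then show ?thesis using ej i by (intro exI[of _ j]) simp
  qed
  then obtain k where k: "k < n e" "v (node e k) \<noteq> 0 \<or> v (node e (Suc k)) \<noteq> 0" by blast
  show "Re (H t v v) < Re (H s v v)"
    unfolding H_diag
  proof (rule sum_strict_mono_ex1)
    show "\<exists>e\<in>arcs G. (\<Sum>j<n e. ?q t e (v (node e j)) (v (node e (Suc j)))) <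
        (\<Sum>j<n e. ?q s e (v (node e j)) (v (node e (Suc j))))"
    proof (intro bexI[of _ e] sum_strict_mono_ex1 bexI[of _ k])
      show "?q t e (v (node e k)) (v (node e (Suc k))) < ?q s e (v (node e k)) (v (node e (Suc k)))"
        by (rule less[OF ej(1) k(2)])
      show "\<forall>j\<in>{..<n e}. ?q t e (v (node e j)) (v (node e (Suc j))) \<le> ?q s e (v (node e j)) (v (node e (Suc j)))"
        by (intro ballI le ej)
    qed (use ej k in auto)
    show "\<forall>e\<in>arcs G. (\<Sum>j<n e. ?q t e (v (node e j)) (v (node e (Suc j)))) \<le>
        (\<Sum>j<n e. ?q s e (v (node e j)) (v (node e (Suc j))))"
      by (intro ballI sum_mono le)
  qed simp
qed

end

section \<open>Kernels are eigenspaces\<close>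

interpretation fun_to_edge: vector_space_pair fun_scale scale_fun ..

context subdivision
begin

lemma coefficients_trig:
  assumes "e \<in> arcs G" "0 \<le> \<kappa>" "\<kappa> \<le> T"
  shows "of_real (coupling \<kappa> e) * trig \<kappa> A B (x + step e) - of_real (diag_coeff \<kappa> e) * trig \<kappa> A B x = trig' \<kappa> A B x"
    and "of_real (diag_coeff \<kappa> e) * trig \<kappa> A B (x + step e) - of_real (coupling \<kappa> e) * trig \<kappa> A B x = trig' \<kappa> A B (x + step e)"
  using trig_derivatives[of \<kappa> "step e"] sin_freq_step_pos[OF assms] by (auto simp: diag_coeff_def coupling_def)

text \<open>
  Green's formula on an edge: if \<open>u\<close> interpolates a solution, the contributions of the interior nodes
  telescope and only the derivatives at the two ends remain.
\<close>

lemma edge_sum_trig: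
  assumes e: "e \<in> arcs G" "0 \<le> \<kappa>" "\<kappa> \<le> T"
    and u: "\<And>j. j \<le> m \<Longrightarrow> u (node e j) = trig \<kappa> A B (j * step e)"
  shows "(\<Sum>j<m. cell (diag_coeff \<kappa> e) (coupling \<kappa> e) (u (node e j)) (u (node e (Suc j))) (v (node e j)) (v (node e (Suc j)))) =
    trig' \<kappa> A B (m * step e) * cnj (v (node e m)) - B * cnj (v (node e 0))"
proof -
  let ?f = "\<lambda>j. trig' \<kappa> A B (real j * step e) * cnj (v (node e j))"
  have "(\<Sum>j<m. cell (diag_coeff \<kappa> e) (coupling \<kappa> e) (u (node e j)) (u (node e (Suc j))) (v (node e j)) (v (node e (Suc j)))) =
      (\<Sum>j<m. ?f (Suc j) - ?f j)"
  proof (rule sum.cong[OF refl])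
    fix j assume "j \<in> {..<m}"
    then have j: "j \<le> m" "Suc j \<le> m" by auto
    have x: "real (Suc j) * step e = real j * step e + step e" by (simp add: algebra_simps)
    show "cell (diag_coeff \<kappa> e) (coupling \<kappa> e) (u (node e j)) (u (node e (Suc j))) (v (node e j)) (v (node e (Suc j))) = ?f (Suc j) - ?f j"
    proof -
      let ?p = "trig \<kappa> A B (real j * step e)" and ?q = "trig \<kappa> A B (real (Suc j) * step e)"
      have d: "trig' \<kappa> A B (real j * step e) = of_real (coupling \<kappa> e) * ?q - of_real (diag_coeff \<kappa> e) * ?p"
        "trig' \<kappa> A B (real (Suc j) * step e) = of_real (diag_coeff \<kappa> e) * ?q - of_real (coupling \<kappa> e) * ?p"
        using coefficients_trig[OF e, of A B "real j * step e"] unfolding x by simp_all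
      show ?thesis
        unfolding u[OF j(1)] u[OF j(2)] d cell_def by (simp only: algebra_simps)
    qed
  qed
  also have "\<dots> = ?f m - ?f 0" by (rule sum_lessThan_telescope)
  finally show ?thesis by simp
qed

lemma n_step: "e \<in> arcs G \<Longrightarrow> real (n e) * step e = L e"
  using n_pos[of e] by (simp add: step_def)

lemma node_0 [simp]: "node e 0 = Inl (tail G e)"
  by (simp add: node_def)

lemma node_n [simp]: "e \<in> arcs G \<Longrightarrow> node e (n e) = Inl (head G e)"
  using n_pos[of e] by (simp add: node_def)

lemma H_trig_edges:
  assumes \<kappa>: "0 \<le> \<kappa>" "\<kappa> \<le> T"
    and u: "\<And>e j. e \<in> arcs G \<Longrightarrow> j \<le> n e \<Longrightarrow> u (node e j) = trig \<kappa> (A e) (B e) (j * step e)"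
  shows "H \<kappa> u v = (\<Sum>e\<in>arcs G. trig' \<kappa> (A e) (B e) (L e) * cnj (v (Inl (head G e))) - B e * cnj (v (Inl (tail G e))))"
  unfolding H_def
  by (intro sum.cong refl) (subst edge_sum_trig[OF _ \<kappa> u], auto simp: n_step)

lemma H_trig_vertices:
  assumes \<kappa>: "0 \<le> \<kappa>" "\<kappa> \<le> T"
    and u: "\<And>e j. e \<in> arcs G \<Longrightarrow> j \<le> n e \<Longrightarrow> u (node e j) = trig \<kappa> (A e) (B e) (j * step e)"
  shows "H \<kappa> u v = (\<Sum>w\<in>verts G. ((\<Sum>e\<in>in_arcs G w. trig' \<kappa> (A e) (B e) (L e)) - (\<Sum>e\<in>out_arcs G w. B e)) * cnj (v (Inl w)))"
proof -
  have "H \<kappa> u v = (\<Sum>e\<in>arcs G. trig' \<kappa> (A e) (B e) (L e) * cnj (v (Inl (head G e))) - B e * cnj (v (Inl (tail G e))))"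
    by (rule H_trig_edges[OF \<kappa>]) (rule u)
  also have "\<dots> = (\<Sum>w\<in>verts G. ((\<Sum>e\<in>in_arcs G w. trig' \<kappa> (A e) (B e) (L e)) - (\<Sum>e\<in>out_arcs G w. B e)) * cnj (v (Inl w)))"
    by (rule sum_by_vertices)
  finally show ?thesis .
qed

lemma delta_in_span: "i \<in> nodes \<Longrightarrow> delta i \<in> fun_space.span D"
  by (auto intro: fun_space.span_base)

text \<open>
  For \<open>u\<close> in the kernel, testing with the indicator of an interior node gives the discrete equation
  \<open>u\<^sub>j\<^sub>-\<^sub>1 + u\<^sub>j\<^sub>+\<^sub>1 = 2 cos (\<kappa> h) u\<^sub>j\<close>, up to a factor.
\<close>

lemma H_interior_node:
  assumes e: "e \<in> arcs G" and j: "0 < j" "j < n e"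
  shows "H \<kappa> u (delta (Inr (e, j))) =
    2 * of_real (diag_coeff \<kappa> e) * u (node e j) - of_real (coupling \<kappa> e) * (u (node e (j - 1)) + u (node e (Suc j)))"
proof -
  let ?d = "delta (Inr (e, j)) :: 'v + 'e \<times> nat \<Rightarrow> complex"
  have d: "?d (node e' i) = (if e' = e \<and> i = j then 1 else 0)" for e' i
    using j by (auto simp: delta_def node_def)
  have ne: "j - 1 \<noteq> j" "Suc (j - 1) = j" using j by auto
  let ?c = "\<lambda>e' i. cell (diag_coeff \<kappa> e') (coupling \<kappa> e') (u (node e' i)) (u (node e' (Suc i))) (?d (node e' i)) (?d (node e' (Suc i)))"
  have "H \<kappa> u ?d = (\<Sum>e'\<in>arcs G. if e' = e then (\<Sum>i<n e. ?c e i) else 0)"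
    unfolding H_def by (intro sum.cong refl) (auto simp: d cell_def)
  also have "\<dots> = (\<Sum>i<n e. ?c e i)" using e by simp
  also have "\<dots> = (\<Sum>i\<in>{j - 1, j}. ?c e i)"
    by (rule sum.mono_neutral_right) (use j in \<open>auto simp: d cell_def\<close>)
  also have "\<dots> = ?c e (j - 1) + ?c e j" using j by (subst sum.insert) auto
  also have "\<dots> = 2 * of_real (diag_coeff \<kappa> e) * u (node e j) - of_real (coupling \<kappa> e) * (u (node e (j - 1)) + u (node e (Suc j)))"
    unfolding d using ne by (simp add: cell_def algebra_simps)
  finally show ?thesis .
qed

text \<open>
  The derivative at the tail of \<open>e\<close> of the solution with the values of \<open>u\<close> at the first two nodes.
\<close>

definition slope :: "real \<Rightarrow> (('v + 'e \<times> nat) \<Rightarrow> complex) \<Rightarrow> 'e \<Rightarrow> complex" where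
  "slope \<kappa> u e = of_real (coupling \<kappa> e) * u (node e 1) - of_real (diag_coeff \<kappa> e) * u (node e 0)"

text \<open>
  Both sides satisfy the same three-term recursion and agree at the first two nodes.
\<close>

lemma kernel_trig:
  assumes \<kappa>: "0 \<le> \<kappa>" "\<kappa> \<le> T" and u: "u \<in> flow.F.kernel \<kappa>" and e: "e \<in> arcs G"
  shows "j \<le> n e \<Longrightarrow> u (node e j) = trig \<kappa> (u (Inl (tail G e))) (slope \<kappa> u e) (j * step e)"
proof (induction j rule: less_induct)
  case (less j)
  let ?f = "trig \<kappa> (u (Inl (tail G e))) (slope \<kappa> u e)"
  let ?b = "complex_of_real (coupling \<kappa> e)" and ?a = "complex_of_real (diag_coeff \<kappa> e)"
  have b: "?b \<noteq> 0" using sin_freq_step_pos[OF e \<kappa>] by (simp add: coupling_def)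
  consider "j = 0" | "j = 1" | i where "j = Suc (Suc i)" by (metis One_nat_def not0_implies_Suc)
  then show ?case
  proof cases
    case 1
    then show ?thesis by simp
  next
    case 2
    have "?b * ?f (0 + step e) = slope \<kappa> u e + ?a * ?f 0"
      using coefficients_trig(1)[OF e \<kappa>, of "u (Inl (tail G e))" "slope \<kappa> u e" 0] by (simp add: algebra_simps)
    also have "\<dots> = ?b * u (node e 1)" by (simp add: slope_def)
    finally have "?f (step e) = u (node e 1)" using b by simp
    then show ?thesis using 2 by simp
  next
    case (3 i)
    let ?k = "Suc i"
    have k: "0 < ?k" "?k < n e" using less.prems 3 by auto
    have "Inr (e, ?k) \<in> nodes" using e k by (auto simp: nodes_def)
    then have "H \<kappa> u (delta (Inr (e, ?k))) = 0"
      using u delta_in_span by (simp add: flow.F.kernel_def)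
    then have r: "?b * (u (node e i) + u (node e j)) = 2 * ?a * u (node e ?k)"
      unfolding H_interior_node[OF e k] using 3 by simp
    have xk: "real ?k * step e = real i * step e + step e" "real j * step e = real ?k * step e + step e"
      using 3 by (auto simp: algebra_simps)
    have "?b * ?f (real j * step e) - ?a * ?f (real ?k * step e) = ?a * ?f (real ?k * step e) - ?b * ?f (real i * step e)"
      using coefficients_trig(1)[OF e \<kappa>, of "u (Inl (tail G e))" "slope \<kappa> u e" "real ?k * step e"]
        coefficients_trig(2)[OF e \<kappa>, of "u (Inl (tail G e))" "slope \<kappa> u e" "real i * step e"]
      unfolding xk(2) by (simp only: xk(1))
    then have r': "?b * (?f (real i * step e) + ?f (real j * step e)) = 2 * ?a * ?f (real ?k * step e)"
      by (simp add: algebra_simps)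
    have "u (node e i) = ?f (real i * step e)" "u (node e ?k) = ?f (real ?k * step e)"
      using less.IH[of i] less.IH[of ?k] 3 less.prems by auto
    then have "?b * (u (node e i) + u (node e j)) = ?b * (u (node e i) + ?f (real j * step e))"
      using r r' by simp
    then show ?thesis using b by simp
  qed
qed

text \<open>
  The trigonometric function on the metric graph that interpolates a kernel element.
\<close>

definition realise :: "real \<Rightarrow> (('v + 'e \<times> nat) \<Rightarrow> complex) \<Rightarrow> 'e edge_fun" where
  "realise \<kappa> u = (\<lambda>e x. if e \<in> arcs G \<and> x \<in> {0..L e} then trig \<kappa> (u (Inl (tail G e))) (slope \<kappa> u e) x else 0)"

lemma linear_realise: "Vector_Spaces.linear fun_scale scale_fun (realise \<kappa>)"
proof (rule Vector_Spaces.linear_iff[THEN iffD2], intro conjI allI)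
  show "vector_space fun_scale" "vector_space scale_fun" by unfold_locales
  show "realise \<kappa> (u + v) = realise \<kappa> u + realise \<kappa> v" for u v
    by (auto simp: fun_eq_iff realise_def slope_def trig_def algebra_simps)
  show "realise \<kappa> (fun_scale c u) = scale_fun c (realise \<kappa> u)" for c u
    by (auto simp: fun_eq_iff realise_def slope_def trig_def fun_scale_def scale_fun_def algebra_simps)
qed

lemma realise_node:
  assumes \<kappa>: "0 \<le> \<kappa>" "\<kappa> \<le> T" and u: "u \<in> flow.F.kernel \<kappa>" and e: "e \<in> arcs G" and j: "j \<le> n e"
  shows "u (node e j) = realise \<kappa> u e (j * step e)"
proof -
  have "real j * step e \<le> real (n e) * step e" using j step_pos[OF e] by (intro mult_right_mono) auto
  then have "real j * step e \<in> {0..L e}" using n_step[OF e] step_pos[OF e] by simp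
  then show ?thesis using kernel_trig[OF \<kappa> u e j] e by (simp add: realise_def)
qed

text \<open>
  For a kernel element, testing \<open>H \<kappa>\<close> with the indicator of a vertex is the Kirchhoff condition there.
  Conversely the node values of an eigenfunction are in the kernel by Green's formula.
\<close>

lemma realise_kernel:
  assumes \<kappa>: "0 \<le> \<kappa>" "\<kappa> \<le> T"
  shows "realise \<kappa> ` flow.F.kernel \<kappa> = eigenspace (standard_laplacian G L) (\<kappa>\<^sup>2)"
proof
  show "realise \<kappa> ` flow.F.kernel \<kappa> \<subseteq> eigenspace (standard_laplacian G L) (\<kappa>\<^sup>2)"
  proof
    fix f assume "f \<in> realise \<kappa> ` flow.F.kernel \<kappa>"
    then obtain u where u: "u \<in> flow.F.kernel \<kappa>" "f = realise \<kappa> u" by blast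
    have end_value: "f e (L e) = u (Inl (head G e))" if "e \<in> arcs G" for e
      using realise_node[OF \<kappa> u(1) that, of "n e"] that u(2) by (simp add: n_step)
    have K: "(\<Sum>e\<in>in_arcs G w. trig' \<kappa> (u (Inl (tail G e))) (slope \<kappa> u e) (L e)) - (\<Sum>e\<in>out_arcs G w. slope \<kappa> u e) = 0"
      (is "?N w = 0") if w: "w \<in> verts G" for w
    proof -
      have "Inl w \<in> nodes" using w by (auto simp: nodes_def)
      then have "0 = H \<kappa> u (delta (Inl w))"
        using u(1) delta_in_span by (simp add: flow.F.kernel_def)
      also have "\<dots> = (\<Sum>w'\<in>verts G. ?N w' * cnj (delta (Inl w :: 'v + 'e \<times> nat) (Inl w')))"
        by (rule H_trig_vertices[OF \<kappa> kernel_trig[OF \<kappa> u(1)]])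
      also have "\<dots> = (\<Sum>w'\<in>verts G. if w' = w then ?N w else 0)"
        by (intro sum.cong refl) (auto simp: delta_def)
      also have "\<dots> = ?N w" using w by simp
      finally show ?thesis by simp
    qed
    show "f \<in> eigenspace (standard_laplacian G L) (\<kappa>\<^sup>2)"
      unfolding standard_eigenspace_trig
      using K end_value u(2)
      by (intro conjI exI[of _ "slope \<kappa> u"] exI[of _ "\<lambda>w. u (Inl w)"])
         (auto simp: realise_def graph_functions_def)
  qed
  show "eigenspace (standard_laplacian G L) (\<kappa>\<^sup>2) \<subseteq> realise \<kappa> ` flow.F.kernel \<kappa>"
  proof
    fix f assume "f \<in> eigenspace (standard_laplacian G L) (\<kappa>\<^sup>2)"
    then obtain B c where f: "f \<in> graph_functions G L"
      and t: "\<And>e x. e \<in> arcs G \<Longrightarrow> x \<in> {0..L e} \<Longrightarrow> f e x = trig \<kappa> (c (tail G e)) (B e) x"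
      and h: "\<And>e. e \<in> arcs G \<Longrightarrow> f e (L e) = c (head G e)"
      and K: "\<And>v. v \<in> verts G \<Longrightarrow> (\<Sum>e\<in>in_arcs G v. trig' \<kappa> (c (tail G e)) (B e) (L e)) - (\<Sum>e\<in>out_arcs G v. B e) = 0"
      unfolding standard_eigenspace_trig by blast
    define u :: "'v + 'e \<times> nat \<Rightarrow> complex" where
      "u i = (case i of Inl v \<Rightarrow> if v \<in> verts G then c v else 0
         | Inr (e, j) \<Rightarrow> if e \<in> arcs G \<and> 0 < j \<and> j < n e then f e (j * step e) else 0)" for i
    have uD: "u \<in> fun_space.span D"
      unfolding span_D by (auto simp: u_def nodes_def split: sum.split)
    have u: "u (node e j) = trig \<kappa> (c (tail G e)) (B e) (j * step e)" if e: "e \<in> arcs G" and j: "j \<le> n e" for e j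
    proof -
      have "real j * step e \<le> real (n e) * step e" using j step_pos[OF e] by (intro mult_right_mono) auto
      then have x: "real j * step e \<in> {0..L e}" using n_step[OF e] step_pos[OF e] by simp
      have Lx: "L e \<in> {0..L e}" using length_pos[OF e] by simp
      consider "j = 0" | "j = n e" "j \<noteq> 0" | "0 < j" "j < n e" using j by linarith
      then show ?thesis
      proof cases
        case 1
        then show ?thesis using e by (simp add: u_def)
      next
        case 2
        then show ?thesis using e t[OF e Lx] h[OF e] by (simp add: u_def n_step)
      next
        case 3
        then show ?thesis using e t[OF e x] by (simp add: u_def node_def)
      qed
    qed
    have "H \<kappa> u v = 0" for v
    proof -
      have "H \<kappa> u v = (\<Sum>w\<in>verts G. ((\<Sum>e\<in>in_arcs G w. trig' \<kappa> (c (tail G e)) (B e) (L e)) -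
          (\<Sum>e\<in>out_arcs G w. B e)) * cnj (v (Inl w)))"
        by (rule H_trig_vertices[OF \<kappa>]) (rule u)
      also have "\<dots> = 0" using K by (intro sum.neutral) simp
      finally show ?thesis .
    qed
    then have ker: "u \<in> flow.F.kernel \<kappa>" using uD by (simp add: flow.F.kernel_def)
    have tl: "u (Inl (tail G e)) = c (tail G e)" if "e \<in> arcs G" for e using that by (simp add: u_def)
    have sl: "slope \<kappa> u e = B e" if e: "e \<in> arcs G" for e
      using coefficients_trig(1)[OF e \<kappa>, of "c (tail G e)" "B e" 0] u[OF e, of 1] tl[OF e] n_pos[OF e]
      by (simp add: slope_def)
    have "realise \<kappa> u e x = f e x" for e x
      using f t[of e x] tl[of e] sl[of e] by (auto simp: realise_def graph_functions_def)
    then show "f \<in> realise \<kappa> ` flow.F.kernel \<kappa>" using ker by (intro image_eqI[of _ _ u]) (auto simp: fun_eq_iff)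
  qed
qed

theorem standard_mult:
  assumes \<kappa>: "0 \<le> \<kappa>" "\<kappa> \<le> T"
  shows "eigenvalue_mult (standard_laplacian G L) (\<kappa>\<^sup>2) = fun_space.dim (flow.F.kernel \<kappa>)"
  unfolding eigenvalue_mult_def realise_kernel[OF \<kappa>, symmetric]
proof (rule fun_to_edge.dim_injective_image[OF linear_realise flow.F.subspace_kernel flow.F.kernel_subset])
  show "finite D" using finite_nodes by simp
  fix u assume u: "u \<in> flow.F.kernel \<kappa>" "realise \<kappa> u = 0"
  have "u i = 0" for i
  proof (cases "i \<in> nodes")
    case True
    then obtain e j where "e \<in> arcs G" "j \<le> n e" "i = node e j" by (rule nodes_cases)
    then show ?thesis using realise_node[OF \<kappa> u(1)] u(2) by simp
  next
    case False
    then show ?thesis using u(1) flow.F.kernel_subset span_D by blast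
  qed
  then show "u = 0" by (simp add: fun_eq_iff)
qed

end

section \<open>Eigenfunctions on forests\<close>

locale forest_subdivision = subdivision G L n T
  for G :: "('v, 'e) pre_digraph" and L :: "'e \<Rightarrow> real" and n :: "'e \<Rightarrow> nat" and T :: real +
  assumes acyclic: "\<not> (\<exists>vs es. undirected_cycle G vs es)"
begin

lemma potential:
  obtains \<phi> :: "'v \<Rightarrow> real" where "\<forall>e\<in>arcs G. \<phi> (head G e) = \<phi> (tail G e) + l e"
  using forest_potential[OF finite_arcs subset_refl acyclic, of l] by (force simp: algebra_simps)

text \<open>
  A potential of the function that is \<open>1\<close> on \<open>e1\<close> and \<open>0\<close> on all other edges separates the two sides
  of \<open>e1\<close>.
\<close>

lemma bridge:
  assumes "e1 \<in> arcs G"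
  obtains X where "head G e1 \<in> X" "tail G e1 \<notin> X" "\<forall>e\<in>arcs G - {e1}. head G e \<in> X \<longleftrightarrow> tail G e \<in> X"
proof -
  obtain \<phi> :: "'v \<Rightarrow> real" where \<phi>: "\<forall>e\<in>arcs G. \<phi> (head G e) = \<phi> (tail G e) + (if e = e1 then 1 else 0)"
    by (rule potential[of "\<lambda>e. if e = e1 then 1 else 0"])
  show ?thesis
    by (rule that[of "{v. \<phi> v = \<phi> (head G e1)}"]) (use \<phi> assms in auto)
qed

lemma kernel_vertex_test:
  assumes \<kappa>: "0 \<le> \<kappa>" "\<kappa> \<le> T" and u: "u \<in> flow.F.kernel \<kappa>"
  shows "(\<Sum>e\<in>arcs G. trig' \<kappa> (u (Inl (tail G e))) (slope \<kappa> u e) (L e) * cnj (c (head G e)) -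
      slope \<kappa> u e * cnj (c (tail G e))) = 0"
proof -
  define v :: "'v + 'e \<times> nat \<Rightarrow> complex" where
    "v i = (case i of Inl w \<Rightarrow> if w \<in> verts G then c w else 0 | Inr _ \<Rightarrow> 0)" for i
  have "v \<in> fun_space.span D"
    unfolding span_D by (auto simp: v_def nodes_def split: sum.split)
  then have "0 = H \<kappa> u v" using u by (simp add: flow.F.kernel_def)
  also have "\<dots> = (\<Sum>e\<in>arcs G. trig' \<kappa> (u (Inl (tail G e))) (slope \<kappa> u e) (L e) * cnj (v (Inl (head G e))) -
      slope \<kappa> u e * cnj (v (Inl (tail G e))))"
    by (rule H_trig_edges[OF \<kappa> kernel_trig[OF \<kappa> u]])
  also have "\<dots> = (\<Sum>e\<in>arcs G. trig' \<kappa> (u (Inl (tail G e))) (slope \<kappa> u e) (L e) * cnj (c (head G e)) -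
      slope \<kappa> u e * cnj (c (tail G e)))"
    by (intro sum.cong refl) (simp add: v_def)
  finally show ?thesis by simp
qed

lemma kernel_at_head:
  assumes \<kappa>: "0 \<le> \<kappa>" "\<kappa> \<le> T" and u: "u \<in> flow.F.kernel \<kappa>" and e: "e \<in> arcs G"
  shows "u (Inl (head G e)) = trig \<kappa> (u (Inl (tail G e))) (slope \<kappa> u e) (L e)"
  using kernel_trig[OF \<kappa> u e, of "n e"] e by (simp add: n_step)

text \<open>
  The test function equals \<open>u\<close> on one side of the bridge \<open>e1\<close> and \<open>0\<close> on the other. The current is
  conserved along the edges away from \<open>e1\<close>, so in the imaginary part only the contribution of \<open>e1\<close>
  is left.
\<close>

lemma kernel_no_current:
  assumes \<kappa>: "0 \<le> \<kappa>" "\<kappa> \<le> T" and u: "u \<in> flow.F.kernel \<kappa>" and e1: "e1 \<in> arcs G"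
  shows "Im (slope \<kappa> u e1 * cnj (u (Inl (tail G e1)))) = 0"
proof -
  obtain X where X: "head G e1 \<in> X" "tail G e1 \<notin> X"
    "\<forall>e\<in>arcs G - {e1}. head G e \<in> X \<longleftrightarrow> tail G e \<in> X"
    by (rule bridge[OF e1])
  define c where "c w = (if w \<in> X then u (Inl w) else 0)" for w
  let ?t = "\<lambda>e. trig' \<kappa> (u (Inl (tail G e))) (slope \<kappa> u e) (L e)"
  have cur: "Im (?t e * cnj (u (Inl (head G e)))) = Im (slope \<kappa> u e * cnj (u (Inl (tail G e))))" if "e \<in> arcs G" for e
    unfolding kernel_at_head[OF \<kappa> u that] by (rule trig_current)
  have "0 = (\<Sum>e\<in>arcs G. Im (?t e * cnj (c (head G e)) - slope \<kappa> u e * cnj (c (tail G e))))"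
    using kernel_vertex_test[OF \<kappa> u, of c] by (metis Im_sum zero_complex.sel(2))
  also have "\<dots> = (\<Sum>e\<in>arcs G. if e = e1 then Im (slope \<kappa> u e1 * cnj (u (Inl (tail G e1)))) else 0)"
  proof (rule sum.cong[OF refl])
    fix e assume e: "e \<in> arcs G"
    show "Im (?t e * cnj (c (head G e)) - slope \<kappa> u e * cnj (c (tail G e))) =
        (if e = e1 then Im (slope \<kappa> u e1 * cnj (u (Inl (tail G e1)))) else 0)"
      using cur[OF e] X e by (cases "e = e1") (auto simp: c_def)
  qed
  also have "\<dots> = Im (slope \<kappa> u e1 * cnj (u (Inl (tail G e1))))" using e1 by simp
  finally show ?thesis by simp
qed

lemma zero_if_zero_at_nodes:
  assumes u: "u \<in> fun_space.span D" and "\<And>e j. e \<in> arcs G \<Longrightarrow> j \<le> n e \<Longrightarrow> u (node e j) = 0"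
  shows "u = 0"
proof
  fix i
  show "u i = 0 i"
  proof (cases "i \<in> nodes")
    case True
    then obtain e j where "e \<in> arcs G" "j \<le> n e" "i = node e j" by (rule nodes_cases)
    then show ?thesis using assms by simp
  next
    case False
    then show ?thesis using u by (simp add: span_D)
  qed
qed

text \<open>
  Such an eigenfunction is a multiple of \<open>sin (\<kappa> x)\<close> on every edge, nonzero only where \<open>\<kappa> L(e) \<in> \<pi>\<int>\<close>. There
  its derivatives at the two ends differ by the factor \<open>cos (\<kappa> L(e)) = exp (i \<kappa> L(e))\<close>, so that the
  wave \<open>exp (i \<kappa> \<phi>)\<close>, whose values differ by the same factor, gives no contribution as a test
  function on this edge. Cutting off the wave at the bridge \<open>e1\<close> leaves the slope on \<open>e1\<close> alone.
\<close>

lemma kernel_vanishing_at_vertices: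
  assumes \<kappa>: "0 < \<kappa>" "\<kappa> \<le> T" and u: "u \<in> flow.F.kernel \<kappa>" and zero: "\<And>v. v \<in> verts G \<Longrightarrow> u (Inl v) = 0"
  shows "u = 0"
proof -
  have \<kappa>': "0 \<le> \<kappa>" using \<kappa> by simp
  obtain \<phi> :: "'v \<Rightarrow> real" where \<phi>: "\<forall>e\<in>arcs G. \<phi> (head G e) = \<phi> (tail G e) + L e"
    by (rule potential[of L])
  have S: "slope \<kappa> u e * of_real (sin (\<kappa> * L e)) = 0" if "e \<in> arcs G" for e
    using kernel_at_head[OF \<kappa>' \<kappa>(2) u that] zero that \<kappa> by (auto simp: trig_def sin_freq_def)
  have slope: "slope \<kappa> u e1 = 0" if e1: "e1 \<in> arcs G" for e1
  proof (rule ccontr)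
    assume nz: "slope \<kappa> u e1 \<noteq> 0"
    obtain X where X: "head G e1 \<in> X" "tail G e1 \<notin> X"
      "\<forall>e\<in>arcs G - {e1}. head G e \<in> X \<longleftrightarrow> tail G e \<in> X"
      by (rule bridge[OF e1])
    \<comment> \<open>the wave, cut off at the bridge \<open>e1\<close>\<close>
    define c where "c w = (if w \<in> X then cis (\<kappa> * \<phi> w) else 0)" for w
    let ?z = "slope \<kappa> u e1 * of_real (cos (\<kappa> * L e1)) * cnj (cis (\<kappa> * \<phi> (head G e1)))"
    have "0 = (\<Sum>e\<in>arcs G. trig' \<kappa> (u (Inl (tail G e))) (slope \<kappa> u e) (L e) * cnj (c (head G e)) -
      slope \<kappa> u e * cnj (c (tail G e)))"
      using kernel_vertex_test[OF \<kappa>' \<kappa>(2) u, of c] by simp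
    also have "\<dots> = (\<Sum>e\<in>arcs G. if e = e1 then ?z else 0)"
    proof (rule sum.cong[OF refl])
      fix e assume e: "e \<in> arcs G"
      have t: "trig' \<kappa> (u (Inl (tail G e))) (slope \<kappa> u e) (L e) = slope \<kappa> u e * of_real (cos (\<kappa> * L e))"
        using zero e by (simp add: trig'_def cos_freq_def)
      show "trig' \<kappa> (u (Inl (tail G e))) (slope \<kappa> u e) (L e) * cnj (c (head G e)) -
          slope \<kappa> u e * cnj (c (tail G e)) = (if e = e1 then ?z else 0)"
      proof (cases "e = e1")
        case True
        then show ?thesis using X t by (simp add: c_def)
      next
        case False
        have "slope \<kappa> u e * (of_real (cos (\<kappa> * L e)) * cnj (cis (\<kappa> * \<phi> (head G e))) - cnj (cis (\<kappa> * \<phi> (tail G e)))) = 0"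
        proof (cases "slope \<kappa> u e = 0")
          case nz: False
          then have "sin (\<kappa> * L e) = 0" using S[OF e] by simp
          then have "cis (\<kappa> * L e) = of_real (cos (\<kappa> * L e))" and "(cos (\<kappa> * L e))\<^sup>2 = 1"
            using sin_cos_squared_add[of "\<kappa> * L e"] by (auto simp: complex_eq_iff)
          moreover have "cis (\<kappa> * \<phi> (head G e)) = cis (\<kappa> * \<phi> (tail G e)) * cis (\<kappa> * L e)"
            using \<phi> e by (simp add: cis_mult distrib_left)
          ultimately have hd: "cis (\<kappa> * \<phi> (head G e)) = cis (\<kappa> * \<phi> (tail G e)) * of_real (cos (\<kappa> * L e))"
            by simp
          have "of_real (cos (\<kappa> * L e)) * cnj (cis (\<kappa> * \<phi> (head G e))) = cnj (cis (\<kappa> * \<phi> (tail G e))) * of_real ((cos (\<kappa> * L e))\<^sup>2)"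
            unfolding hd by (simp add: power2_eq_square)
          then show ?thesis using \<open>(cos (\<kappa> * L e))\<^sup>2 = 1\<close> by simp
        qed simp
        then show ?thesis using False X(3) e t by (auto simp: c_def algebra_simps)
      qed
    qed
    also have "\<dots> = ?z" using e1 by simp
    finally have "cos (\<kappa> * L e1) = 0" using nz by simp
    moreover have "sin (\<kappa> * L e1) = 0" using S[OF e1] nz by simp
    ultimately show False using sin_cos_squared_add[of "\<kappa> * L e1"] by simp
  qed
  show ?thesis
  proof (rule zero_if_zero_at_nodes)
    show "u \<in> fun_space.span D" using u flow.F.kernel_subset by blast
    fix e j assume e: "e \<in> arcs G" "j \<le> n e"
    show "u (node e j) = 0"
      using kernel_trig[OF \<kappa>' \<kappa>(2) u e] slope[OF e(1)] zero e(1) by (simp add: trig_def)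
  qed
qed

end

section \<open>Trial functions\<close>

text \<open>
  The number of half waves of frequency \<open>\<kappa>\<close> that fit into the edge, which is also the number of
  Dirichlet eigenvalues of the edge in \<open>[0, \<kappa>\<^sup>2]\<close>.
\<close>

definition (in metric_graph) half_waves :: "real \<Rightarrow> 'e \<Rightarrow> nat" where
  "half_waves \<kappa> e = nat \<lfloor>\<kappa> * L e / pi\<rfloor>"

locale trial_space = metric_graph G L
  for G :: "('v, 'e) pre_digraph" and L :: "'e \<Rightarrow> real" +
  fixes \<kappa> :: real
  assumes \<kappa>_pos: "0 < \<kappa>"
    and incident': "v \<in> verts G \<Longrightarrow> \<exists>e\<in>arcs G. v = tail G e \<or> v = head G e"
    and acyclic': "\<not> (\<exists>vs es. undirected_cycle G vs es)"
begin

abbreviation r :: "'e \<Rightarrow> nat" where "r e \<equiv> half_waves \<kappa> e"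

text \<open>
  Quarter waves would have length \<open>\<pi> / (2 \<kappa>)\<close>. With \<open>2 r\<close> cells the cells are at least as long, so that
  the diagonal coefficient \<open>\<kappa> cot (\<kappa> h)\<close> is \<open>\<le> 0\<close>, but shorter than \<open>\<pi> / \<kappa>\<close>. An edge with \<open>r = 0\<close> is short
  enough to be left undivided.
\<close>

definition parts :: "'e \<Rightarrow> nat" where
  "parts e = (if r e = 0 then 1 else 2 * r e)"

lemma r_bounds:
  assumes "e \<in> arcs G" shows "r e * pi \<le> \<kappa> * L e" "\<kappa> * L e < (r e + 1) * pi"
proof -
  have "0 \<le> \<kappa> * L e / pi" using \<kappa>_pos length_pos[OF assms] by simp
  then have "real (r e) = of_int \<lfloor>\<kappa> * L e / pi\<rfloor>" by (simp add: half_waves_def)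
  then have "real (r e) \<le> \<kappa> * L e / pi" "\<kappa> * L e / pi < real (r e) + 1" by linarith+
  then show "r e * pi \<le> \<kappa> * L e" "\<kappa> * L e < (r e + 1) * pi"
    by (simp_all add: field_simps)
qed

sublocale forest_subdivision G L parts \<kappa>
proof unfold_locales
  show "0 < parts e" for e by (simp add: parts_def)
  show "\<kappa> * (L e / parts e) < pi" if e: "e \<in> arcs G" for e
  proof (cases "r e = 0")
    case True
    then show ?thesis using r_bounds[OF e] by (simp add: parts_def)
  next
    case False
    have "\<kappa> * L e < (real (r e) + 1) * pi" using r_bounds(2)[OF e] by (simp add: add.commute)
    also have "\<dots> \<le> (2 * real (r e)) * pi" using False by (intro mult_right_mono) auto
    finally show ?thesis using False by (simp add: parts_def field_simps)
  qed
qed (use \<kappa>_pos incident' acyclic' in auto)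

definition odd_nodes :: "('v + 'e \<times> nat) set" where
  "odd_nodes = (\<lambda>(e, i). Inr (e, 2 * i + 1)) ` (SIGMA e:arcs G. {..<r e})"

lemma card_odd_nodes: "card odd_nodes = (\<Sum>e\<in>arcs G. r e)"
proof -
  have "inj_on (\<lambda>(e, i). Inr (e, 2 * i + 1) :: 'v + 'e \<times> nat) (SIGMA e:arcs G. {..<r e})"
    by (auto simp: inj_on_def)
  then show ?thesis unfolding odd_nodes_def by (simp add: card_image)
qed

lemma finite_odd_nodes: "finite odd_nodes"
  by (auto simp: odd_nodes_def)

lemma odd_nodes_subset: "odd_nodes \<subseteq> nodes"
  by (auto simp: odd_nodes_def nodes_def parts_def)

lemma node_odd_iff:
  assumes "e \<in> arcs G" "j \<le> parts e" "r e \<noteq> 0"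
  shows "node e j \<in> odd_nodes \<longleftrightarrow> odd j"
proof
  assume "odd j"
  then obtain i where i: "j = 2 * i + 1" by (rule oddE)
  moreover have "2 * i + 1 \<noteq> 2 * r e" by presburger
  ultimately have "i < r e" "node e j = Inr (e, 2 * i + 1)"
    using assms by (auto simp: parts_def node_def)
  then show "node e j \<in> odd_nodes" using assms(1) by (auto simp: odd_nodes_def)
next
  assume "node e j \<in> odd_nodes"
  then show "odd j" by (auto simp: odd_nodes_def node_def split: if_splits)
qed

lemma vertex_not_odd [simp]: "Inl v \<notin> odd_nodes"
  by (auto simp: odd_nodes_def)

lemma node_not_odd: "e \<in> arcs G \<Longrightarrow> r e = 0 \<Longrightarrow> j \<le> parts e \<Longrightarrow> node e j \<notin> odd_nodes"
  by (auto simp: odd_nodes_def node_def parts_def)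

lemma diag_coeff_sign:
  assumes e: "e \<in> arcs G" and r: "r e \<noteq> 0"
  shows "diag_coeff \<kappa> e \<le> 0"
    and "\<kappa> * L e \<noteq> r e * pi \<Longrightarrow> diag_coeff \<kappa> e < 0"
    and "\<kappa> * L e = r e * pi \<Longrightarrow> diag_coeff \<kappa> e = 0"
proof -
  have st: "\<kappa> * step e = \<kappa> * L e / (2 * real (r e))" using r by (simp add: step_def parts_def)
  have lo: "pi / 2 \<le> \<kappa> * step e" using r_bounds(1)[OF e] r unfolding st by (simp add: field_simps)
  have hi: "\<kappa> * step e < pi" using short[OF e] by (simp add: step_def)
  have S: "0 < sin_freq \<kappa> (step e)" using sin_freq_step_pos[OF e] \<kappa>_pos by simp
  have "cos (\<kappa> * step e) \<le> cos (pi / 2)" using lo hi by (intro cos_monotone_0_pi_le) auto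
  then show "diag_coeff \<kappa> e \<le> 0" using S by (simp add: diag_coeff_def cos_freq_def divide_le_0_iff)
  show "diag_coeff \<kappa> e < 0" if ne: "\<kappa> * L e \<noteq> r e * pi"
  proof -
    have "\<kappa> * step e \<noteq> pi / 2" using ne r unfolding st by (simp add: field_simps)
    then have "cos (\<kappa> * step e) < cos (pi / 2)" using lo hi by (intro cos_monotone_0_pi) auto
    then show ?thesis using S by (simp add: diag_coeff_def cos_freq_def divide_less_0_iff)
  qed
  show "diag_coeff \<kappa> e = 0" if eq: "\<kappa> * L e = r e * pi"
    using eq r unfolding diag_coeff_def cos_freq_def st by simp
qed

definition odd_functions :: "('v + 'e \<times> nat \<Rightarrow> complex) set" where
  "odd_functions = {u. \<forall>i. i \<notin> odd_nodes \<longrightarrow> u i = 0}"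

lemma odd_functionsD: "u \<in> odd_functions \<Longrightarrow> i \<notin> odd_nodes \<Longrightarrow> u i = 0"
  by (simp add: odd_functions_def)

text \<open>
  Of two neighbouring nodes at most one is odd, hence the mixed terms disappear.
\<close>

lemma odd_form:
  assumes u: "u \<in> odd_functions"
  shows "Re (H \<kappa> u u) = (\<Sum>e\<in>arcs G. \<Sum>j<parts e. diag_coeff \<kappa> e * ((cmod (u (node e j)))\<^sup>2 + (cmod (u (node e (Suc j))))\<^sup>2))"
  unfolding H_def Re_sum
proof (intro sum.cong refl)
  fix e j assume ej: "e \<in> arcs G" "j \<in> {..<parts e}"
  have "u (node e j) = 0 \<or> u (node e (Suc j)) = 0"
  proof (cases "r e = 0")
    case True
    then show ?thesis using node_not_odd[OF ej(1) True, of j] ej odd_functionsD[OF u] by auto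
  next
    case False
    then show ?thesis using node_odd_iff[OF ej(1) _ False] ej odd_functionsD[OF u] by (metis Suc_leI even_Suc lessThan_iff less_imp_le)
  qed
  then show "Re (cell (diag_coeff \<kappa> e) (coupling \<kappa> e) (u (node e j)) (u (node e (Suc j))) (u (node e j)) (u (node e (Suc j)))) =
      diag_coeff \<kappa> e * ((cmod (u (node e j)))\<^sup>2 + (cmod (u (node e (Suc j))))\<^sup>2)"
    by (auto simp: cell_diag field_simps)
qed

lemma odd_term_nonpos:
  assumes u: "u \<in> odd_functions" and e: "e \<in> arcs G" "j < parts e"
  shows "diag_coeff \<kappa> e * ((cmod (u (node e j)))\<^sup>2 + (cmod (u (node e (Suc j))))\<^sup>2) \<le> 0"
proof (cases "r e = 0")
  case True
  have "node e j \<notin> odd_nodes" "node e (Suc j) \<notin> odd_nodes"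
    using node_not_odd[OF e(1) True] e by auto
  then show ?thesis using odd_functionsD[OF u] by simp
next
  case False
  then show ?thesis using diag_coeff_sign(1)[OF e(1) False] by (intro mult_nonpos_nonneg) auto
qed

lemma odd_form_nonpos:
  assumes u: "u \<in> odd_functions"
  shows "Re (H \<kappa> u u) \<le> 0"
  unfolding odd_form[OF u] by (intro sum_nonpos odd_term_nonpos[OF u]) auto

lemma odd_form_zero:
  assumes u: "u \<in> odd_functions" and zero: "Re (H \<kappa> u u) = 0"
    and e: "e \<in> arcs G" "\<kappa> * L e \<noteq> r e * pi" and j: "j \<le> parts e"
  shows "u (node e j) = 0"
proof (cases "r e = 0")
  case True
  then show ?thesis using node_not_odd[OF e(1) True j] odd_functionsD[OF u] by blast
next
  case False
  let ?t = "\<lambda>e j. diag_coeff \<kappa> e * ((cmod (u (node e j)))\<^sup>2 + (cmod (u (node e (Suc j))))\<^sup>2)"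
  have "(\<Sum>e\<in>arcs G. \<Sum>j<parts e. - ?t e j) = 0"
    using zero unfolding odd_form[OF u] by (simp add: sum_negf)
  then have "\<forall>e\<in>arcs G. (\<Sum>j<parts e. - ?t e j) = 0"
    by (subst (asm) sum_nonneg_eq_0_iff) (use odd_term_nonpos[OF u] in \<open>force intro!: sum_nonneg\<close>)+
  then have "(\<Sum>j<parts e. - ?t e j) = 0" using e(1) by blast
  then have t0: "\<forall>j\<in>{..<parts e}. - ?t e j = 0"
    by (subst (asm) sum_nonneg_eq_0_iff) (use odd_term_nonpos[OF u e(1)] in force)+
  have diag_coeff: "diag_coeff \<kappa> e \<noteq> 0" using diag_coeff_sign(2)[OF e(1) False e(2)] by simp
  have z: "u (node e j) = 0 \<and> u (node e (Suc j)) = 0" if "j < parts e" for j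
    using t0 that diag_coeff by (simp add: add_nonneg_eq_0_iff)
  show ?thesis
  proof (cases "j = parts e")
    case True
    then show ?thesis using odd_functionsD[OF u] e by simp
  next
    case False
    then show ?thesis using z[of j] j by simp
  qed
qed

text \<open>
  The potential \<open>\<phi>\<close> of the wave \<open>exp (i \<kappa> \<phi>)\<close>; on the vertices of a tree it is unique up to
  a constant.
\<close>

definition height :: "'v \<Rightarrow> real" where
  "height = (SOME \<phi>. \<forall>e\<in>arcs G. \<phi> (head G e) = \<phi> (tail G e) + L e)"

lemma height:
  assumes "e \<in> arcs G"
  shows "height (head G e) = height (tail G e) + L e"
proof -
  obtain \<phi> :: "'v \<Rightarrow> real" where "\<forall>e\<in>arcs G. \<phi> (head G e) = \<phi> (tail G e) + L e"
    by (rule potential[of L])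
  then have "\<forall>e\<in>arcs G. height (head G e) = height (tail G e) + L e"
    unfolding height_def by (rule someI[where P = "\<lambda>\<phi>. \<forall>e\<in>arcs G. \<phi> (head G e) = \<phi> (tail G e) + L e"])
  then show ?thesis using assms by blast
qed

definition wave :: "'v + 'e \<times> nat \<Rightarrow> complex" where
  "wave i = (if i \<notin> nodes then 0 else case i of Inl v \<Rightarrow> cis (\<kappa> * height v)
     | Inr (e, j) \<Rightarrow> cis (\<kappa> * (height (tail G e) + j * step e)))"

lemma wave_vertex: "v \<in> verts G \<Longrightarrow> wave (Inl v) = cis (\<kappa> * height v)"
  by (auto simp: wave_def nodes_def)

lemma wave_span: "wave \<in> fun_space.span D"
  by (auto simp: span_D wave_def)

lemma trig_wave:
  "trig \<kappa> (cis a) (\<i> * of_real \<kappa> * cis a) x = cis (a + \<kappa> * x)"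
  "trig' \<kappa> (cis a) (\<i> * of_real \<kappa> * cis a) x = \<i> * of_real \<kappa> * cis (a + \<kappa> * x)"
  using \<kappa>_pos
  by (simp_all add: trig_def trig'_def cos_freq_def sin_freq_def complex_eq_iff cos_add sin_add power2_eq_square algebra_simps)

lemma wave_node:
  assumes "e \<in> arcs G" "j \<le> parts e"
  shows "wave (node e j) = trig \<kappa> (cis (\<kappa> * height (tail G e))) (\<i> * of_real \<kappa> * cis (\<kappa> * height (tail G e))) (j * step e)"
proof -
  have "node e j \<in> nodes" by (rule node_in_nodes[OF assms])
  then have "wave (node e j) = cis (\<kappa> * (height (tail G e) + j * step e))"
    using height[OF assms(1)] n_step[OF assms(1)] by (auto simp: wave_def node_def)
  then show ?thesis by (simp add: trig_wave distrib_left)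
qed

lemma H_wave:
  "H \<kappa> wave v = (\<Sum>e\<in>arcs G. \<i> * of_real \<kappa> * (wave (Inl (head G e)) * cnj (v (Inl (head G e))) -
      wave (Inl (tail G e)) * cnj (v (Inl (tail G e)))))"
proof -
  let ?A = "\<lambda>e. cis (\<kappa> * height (tail G e))"
  have "H \<kappa> wave v = (\<Sum>e\<in>arcs G. trig' \<kappa> (?A e) (\<i> * of_real \<kappa> * ?A e) (L e) * cnj (v (Inl (head G e))) -
      \<i> * of_real \<kappa> * ?A e * cnj (v (Inl (tail G e))))"
    by (rule H_trig_edges) (use \<kappa>_pos wave_node in auto)
  also have "\<dots> = (\<Sum>e\<in>arcs G. \<i> * of_real \<kappa> * (wave (Inl (head G e)) * cnj (v (Inl (head G e))) -
      wave (Inl (tail G e)) * cnj (v (Inl (tail G e)))))"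
  proof (rule sum.cong[OF refl])
    fix e assume e: "e \<in> arcs G"
    have w: "wave (Inl (head G e)) = cis (\<kappa> * height (tail G e) + \<kappa> * L e)" "wave (Inl (tail G e)) = ?A e"
      using e by (simp_all add: wave_vertex height distrib_left)
    show "trig' \<kappa> (?A e) (\<i> * of_real \<kappa> * ?A e) (L e) * cnj (v (Inl (head G e))) - \<i> * of_real \<kappa> * ?A e * cnj (v (Inl (tail G e))) =
        \<i> * of_real \<kappa> * (wave (Inl (head G e)) * cnj (v (Inl (head G e))) - wave (Inl (tail G e)) * cnj (v (Inl (tail G e))))"
      unfolding w trig_wave by (simp only: right_diff_distrib mult.assoc)
  qed
  finally show ?thesis .
qed

text \<open>
  The wave has modulus \<open>1\<close>, and its derivative along each edge is \<open>i \<kappa>\<close> times the wave, so the boundary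
  terms at the two ends cancel.
\<close>

lemma H_wave_wave: "H \<kappa> wave wave = 0"
  unfolding H_wave
  by (intro sum.neutral ballI) (simp add: wave_vertex complex_norm_square[symmetric] del: of_real_power)

lemma H_wave_odd:
  assumes u: "u \<in> odd_functions"
  shows "H \<kappa> wave u = 0"
  unfolding H_wave by (intro sum.neutral ballI) (simp add: odd_functionsD[OF u])

definition trial :: "('v + 'e \<times> nat \<Rightarrow> complex) set" where
  "trial = fun_space.span (insert wave (delta ` odd_nodes))"

lemma trialE:
  assumes "y \<in> trial"
  obtains u c where "y = u + fun_scale c wave" "u \<in> odd_functions"
proof -
  obtain c where "y - fun_scale c wave \<in> fun_space.span (delta ` odd_nodes)"
    using assms unfolding trial_def fun_space.span_breakdown_eq by blast
  then have "y - fun_scale c wave \<in> odd_functions"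
    unfolding span_delta[OF finite_odd_nodes] odd_functions_def .
  then show ?thesis using that[of "y - fun_scale c wave" c] by simp
qed

lemma trial_form:
  assumes u: "u \<in> odd_functions"
  shows "Re (H \<kappa> (u + fun_scale c wave) (u + fun_scale c wave)) = Re (H \<kappa> u u)"
proof -
  have "H \<kappa> u wave = 0" using H_wave_odd[OF u] flow.F.H_sym[of \<kappa> u wave] by simp
  then show ?thesis
    by (simp add: flow.F.form_add flow.F.H_scale flow.F.H_scale_right H_wave_wave)
qed

lemma trial_subspace: "fun_space.subspace trial" "trial \<subseteq> fun_space.span D"
proof -
  show "fun_space.subspace trial" by (simp add: trial_def fun_space.subspace_span)
  show "trial \<subseteq> fun_space.span D"
    unfolding trial_def
    using wave_span odd_nodes_subset
    by (intro fun_space.span_minimal fun_space.subspace_span) (auto intro: fun_space.span_base)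
qed

text \<open>
  The wave is not a combination of the indicators of odd nodes since it is nonzero at the vertices.
\<close>

lemma trial_dim: "fun_space.dim trial = Suc (\<Sum>e\<in>arcs G. r e)"
proof -
  obtain e where e: "e \<in> arcs G" using arcs_nonempty by blast
  have "wave (Inl (tail G e)) \<noteq> 0" using e by (simp add: wave_vertex)
  then have w: "wave \<notin> fun_space.span (delta ` odd_nodes)"
    unfolding span_delta[OF finite_odd_nodes] using vertex_not_odd by blast
  then have "wave \<notin> delta ` odd_nodes" using fun_space.span_base by blast
  then have "card (insert wave (delta ` odd_nodes)) = Suc (card odd_nodes)"
    using finite_odd_nodes by (simp add: card_delta)
  moreover have "fun_space.independent (insert wave (delta ` odd_nodes))"
    using w independent_delta[OF finite_odd_nodes] by (intro fun_space.independent_insertI)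
  ultimately show ?thesis
    unfolding trial_def using fun_space.dim_span_eq_card_independent card_odd_nodes by metis
qed

lemma trial_nonpos: "y \<in> trial \<Longrightarrow> Re (H \<kappa> y y) \<le> 0"
  by (metis trialE trial_form odd_form_nonpos)

text \<open>
  Let \<open>y = u + c exp (i \<kappa> \<phi>)\<close> be in the kernel, with \<open>u\<close> supported on the odd nodes. From \<open>H \<kappa> u u = 0\<close> it
  follows that \<open>u = 0\<close> on \<open>e0\<close>, since \<open>e0\<close> has a strictly negative diagonal coefficient or no odd
  nodes. So \<open>y\<close> carries
  the current \<open>\<kappa> |c|\<^sup>2\<close> on \<open>e0\<close>, which is \<open>0\<close>; and \<open>y = u\<close> vanishes at the vertices.
\<close>

lemma trial_kernel_trivial:
  assumes e0: "e0 \<in> arcs G" "\<kappa> * L e0 \<noteq> r e0 * pi" and y: "y \<in> trial" "y \<in> flow.F.kernel \<kappa>"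
  shows "y = 0"
proof -
  obtain u c where uc: "y = u + fun_scale c wave" and u: "u \<in> odd_functions"
    using trialE[OF y(1)] by blast
  have \<kappa>: "0 \<le> \<kappa>" "\<kappa> \<le> \<kappa>" using \<kappa>_pos by auto
  have "y \<in> fun_space.span D" using y(2) flow.F.kernel_subset by blast
  then have "H \<kappa> y y = 0" using y(2) by (simp add: flow.F.kernel_def)
  then have "Re (H \<kappa> u u) = 0" using trial_form[OF u, of c] unfolding uc by simp
  then have u0: "u (node e0 j) = 0" if "j \<le> parts e0" for j
    by (rule odd_form_zero[OF u _ e0 that])
  have yn: "y (node e0 j) = c * wave (node e0 j)" if "j \<le> parts e0" for j
    using u0[OF that] by (simp add: uc fun_scale_def)
  let ?a = "cis (\<kappa> * height (tail G e0))"
  have "slope \<kappa> y e0 = c * (of_real (coupling \<kappa> e0) * wave (node e0 1) - of_real (diag_coeff \<kappa> e0) * wave (node e0 0))"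
    unfolding slope_def using yn[of 0] yn[of 1] n_pos[OF e0(1)] by (simp add: algebra_simps del: node_0)
  also have "of_real (coupling \<kappa> e0) * wave (node e0 1) - of_real (diag_coeff \<kappa> e0) * wave (node e0 0) = \<i> * of_real \<kappa> * ?a"
    using wave_node[OF e0(1), of 0] wave_node[OF e0(1), of 1] n_pos[OF e0(1)]
      coefficients_trig(1)[OF e0(1) \<kappa>, of ?a "\<i> * of_real \<kappa> * ?a" 0] by (simp del: node_0)
  finally have sl: "slope \<kappa> y e0 = \<i> * of_real \<kappa> * (c * ?a)" by simp
  have yt: "y (Inl (tail G e0)) = c * ?a"
    using yn[of 0] e0 by (simp add: wave_vertex)
  have "slope \<kappa> y e0 * cnj (y (Inl (tail G e0))) = \<i> * of_real \<kappa> * ((c * ?a) * cnj (c * ?a))"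
    unfolding sl yt by (simp only: mult.assoc)
  also have "(c * ?a) * cnj (c * ?a) = of_real ((cmod c)\<^sup>2)"
    by (simp only: complex_norm_square[symmetric] norm_mult norm_cis mult_1_right)
  finally have "Im (slope \<kappa> y e0 * cnj (y (Inl (tail G e0)))) = \<kappa> * (cmod c)\<^sup>2"
    by simp
  then have "c = 0" using kernel_no_current[OF \<kappa> y(2) e0(1)] \<kappa>_pos by simp
  then have "y (Inl v) = 0" for v using uc odd_functionsD[OF u] by (simp add: fun_scale_def)
  then show ?thesis using kernel_vanishing_at_vertices[OF \<kappa>_pos order_refl y(2)] by blast
qed

text \<open>
  All diagonal coefficients are \<open>0\<close> and every cell has an odd end, so \<open>H \<kappa>\<close> vanishes on functions that
  are \<open>0\<close> at the odd nodes. A larger negative system would contain such a function in its span.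
\<close>

lemma orthonormal_commensurable:
  assumes int: "\<And>e. e \<in> arcs G \<Longrightarrow> \<kappa> * L e = r e * pi" and B: "flow.F.orthonormal \<kappa> (-1) B"
  shows "card B \<le> (\<Sum>e\<in>arcs G. r e)"
proof (rule ccontr)
  assume "\<not> ?thesis"
  then have less: "card odd_nodes < card B" by (simp add: card_odd_nodes)
  have ind: "fun_space.independent B" by (rule flow.F.orthonormal_independent[OF B]) simp
  have fin: "finite B" using B by (simp add: flow.F.orthonormal_def)
  obtain u where u: "u \<in> fun_space.span B" "u \<noteq> 0" "\<And>i. i \<in> odd_nodes \<Longrightarrow> u i = 0"
  proof (rule fun_space.common_zero[OF finite_odd_nodes fin, of "\<lambda>i u. u i" "fun_space.span B"])
    show "card odd_nodes < fun_space.dim (fun_space.span B)"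
      using less fun_space.dim_span_eq_card_independent[OF ind] by simp
  qed (use that in \<open>auto simp: fun_scale_def fun_space.subspace_span\<close>)
  have "H \<kappa> u u = 0"
    unfolding H_def
  proof (intro sum.neutral ballI)
    fix e j assume e: "e \<in> arcs G" "j \<in> {..<parts e}"
    have r: "r e \<noteq> 0"
    proof
      assume "r e = 0"
      then show False using int[OF e(1)] \<kappa>_pos length_pos[OF e(1)] by simp
    qed
    have "u (node e j) = 0 \<or> u (node e (Suc j)) = 0"
      using node_odd_iff[OF e(1) _ r] e u(3) by (metis Suc_leI even_Suc lessThan_iff less_imp_le)
    then show "cell (diag_coeff \<kappa> e) (coupling \<kappa> e) (u (node e j)) (u (node e (Suc j))) (u (node e j)) (u (node e (Suc j))) = 0"
      using diag_coeff_sign(3)[OF e(1) r int[OF e(1)]] by (auto simp: cell_def)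
  qed
  then show False using flow.F.orthonormal_definite[OF B u(1,2)] by simp
qed

end

section \<open>Counting eigenvalues\<close>

definition reaches :: "('e edge_fun \<times> 'e edge_fun) set \<Rightarrow> nat \<Rightarrow> real \<Rightarrow> bool" where
  "reaches A k x \<longleftrightarrow> (\<exists>M. finite M \<and> M \<subseteq> {..x} \<and> k \<le> (\<Sum>\<mu>\<in>M. eigenvalue_mult A \<mu>))"

lemma kth_eigenvalue_reaches: "kth_eigenvalue A k = Inf {x. reaches A k x}"
  by (simp add: kth_eigenvalue_def reaches_def)

lemma reaches_mono: "reaches A k x \<Longrightarrow> j \<le> k \<Longrightarrow> reaches A j x"
  unfolding reaches_def by (meson order_trans)

lemma nonneg_part_mult:
  assumes fin: "finite M" and neg: "\<And>\<mu>. \<mu> < 0 \<Longrightarrow> eigenvalue_mult A \<mu> = 0"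
  shows "(\<Sum>\<mu>\<in>M. eigenvalue_mult A \<mu>) = (\<Sum>s\<in>sqrt ` (M \<inter> {0..}). eigenvalue_mult A (s\<^sup>2))"
proof -
  have "(\<Sum>\<mu>\<in>M. eigenvalue_mult A \<mu>) = (\<Sum>\<mu>\<in>M \<inter> {0..}. eigenvalue_mult A \<mu>)"
  proof (rule sum.mono_neutral_right)
    show "\<forall>\<mu>\<in>M - M \<inter> {0..}. eigenvalue_mult A \<mu> = 0" by (intro ballI neg) auto
  qed (use fin in auto)
  also have "\<dots> = (\<Sum>s\<in>sqrt ` (M \<inter> {0..}). eigenvalue_mult A (s\<^sup>2))"
    by (subst sum.reindex) (auto simp: inj_on_def intro!: sum.cong)
  finally show ?thesis .
qed

lemma sum_squares_mult:
  assumes "\<Lambda> \<subseteq> {0..}"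
  shows "(\<Sum>\<mu>\<in>power2 ` \<Lambda>. eigenvalue_mult A \<mu>) = (\<Sum>s\<in>\<Lambda>. eigenvalue_mult A (s\<^sup>2))"
proof -
  have "inj_on power2 \<Lambda>" using assms by (auto simp: inj_on_def power2_eq_iff_nonneg subset_iff)
  then show ?thesis by (simp add: sum.reindex)
qed

context metric_graph
begin

abbreviation "mult_std \<equiv> eigenvalue_mult (standard_laplacian G L)"
abbreviation "mult_dir \<equiv> eigenvalue_mult (dirichlet_laplacian G L)"

definition half_wave_count :: "real \<Rightarrow> nat" where
  "half_wave_count \<kappa> = (\<Sum>e\<in>arcs G. half_waves \<kappa> e)"

lemma half_waves_mono: "\<kappa> \<le> \<kappa>' \<Longrightarrow> e \<in> arcs G \<Longrightarrow> half_waves \<kappa> e \<le> half_waves \<kappa>' e"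
  unfolding half_waves_def using length_pos[of e]
  by (intro nat_mono floor_mono divide_right_mono mult_right_mono) auto

lemma half_wave_count_mono: "\<kappa> \<le> \<kappa>' \<Longrightarrow> half_wave_count \<kappa> \<le> half_wave_count \<kappa>'"
  unfolding half_wave_count_def by (intro sum_mono half_waves_mono)

lemma half_wave_count_0 [simp]: "half_wave_count 0 = 0"
  by (simp add: half_wave_count_def half_waves_def)

text \<open>
  The floor function is right continuous. This is what makes the infimum in the definition of the
  Dirichlet eigenvalues a minimum.
\<close>

lemma half_wave_count_right_continuous:
  assumes "0 \<le> \<kappa>"
  obtains \<delta> where "\<delta> > 0" "\<And>\<kappa>'. \<kappa>' < \<kappa> + \<delta> \<Longrightarrow> half_wave_count \<kappa>' \<le> half_wave_count \<kappa>"
proof -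
  have "\<forall>\<^sub>F \<kappa>' in nhds \<kappa>. \<forall>e\<in>arcs G. \<kappa>' * L e / pi < of_int (\<lfloor>\<kappa> * L e / pi\<rfloor> + 1)"
  proof (intro eventually_ball_finite ballI)
    fix e
    have "((\<lambda>\<kappa>'. \<kappa>' * L e / pi) \<longlongrightarrow> \<kappa> * L e / pi) (nhds \<kappa>)"
      by (intro tendsto_intros filterlim_ident) simp
    then show "\<forall>\<^sub>F \<kappa>' in nhds \<kappa>. \<kappa>' * L e / pi < of_int (\<lfloor>\<kappa> * L e / pi\<rfloor> + 1)"
      by (rule order_tendstoD(2)) linarith
  qed simp
  then obtain d where d: "d > 0" "\<And>\<kappa>' e. dist \<kappa>' \<kappa> < d \<Longrightarrow> e \<in> arcs G \<Longrightarrow> \<kappa>' * L e / pi < of_int (\<lfloor>\<kappa> * L e / pi\<rfloor> + 1)"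
    by (auto simp: eventually_nhds_metric)
  show ?thesis
  proof (rule that[OF d(1)])
    fix \<kappa>' assume \<kappa>': "\<kappa>' < \<kappa> + d"
    show "half_wave_count \<kappa>' \<le> half_wave_count \<kappa>"
    proof (cases "\<kappa>' \<le> \<kappa>")
      case True then show ?thesis by (rule half_wave_count_mono)
    next
      case False
      then have "dist \<kappa>' \<kappa> < d" using \<kappa>' by (simp add: dist_real_def)
      then have "\<lfloor>\<kappa>' * L e / pi\<rfloor> \<le> \<lfloor>\<kappa> * L e / pi\<rfloor>" if "e \<in> arcs G" for e
        using d(2)[OF _ that, of \<kappa>'] by linarith
      then show ?thesis
        unfolding half_wave_count_def half_waves_def by (intro sum_mono nat_mono)
    qed
  qed
qed

text \<open>
  One pair for each Dirichlet eigenvalue \<open>s\<^sup>2 \<le> \<kappa>\<^sup>2\<close>, counted with multiplicity. No pair has \<open>s = 0\<close>, since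
  \<open>sin_freq 0 (L e) = L e\<close>.
\<close>

definition dirichlet_pairs :: "real \<Rightarrow> (real \<times> 'e) set" where
  "dirichlet_pairs \<kappa> = {(s, e). 0 \<le> s \<and> s \<le> \<kappa> \<and> e \<in> arcs G \<and> sin_freq s (L e) = 0}"

lemma dirichlet_pairs_bij:
  assumes \<kappa>: "0 \<le> \<kappa>"
  shows "bij_betw (\<lambda>(e, m). (real m * pi / L e, e)) (SIGMA e:arcs G. {1..half_waves \<kappa> e}) (dirichlet_pairs \<kappa>)"
  unfolding bij_betw_def
proof (intro conjI equalityI)
  have nz: "L e \<noteq> 0" if "e \<in> arcs G" for e using length_pos[OF that] by simp
  show "inj_on (\<lambda>(e, m). (real m * pi / L e, e)) (SIGMA e:arcs G. {1..half_waves \<kappa> e})"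
    by (auto simp: inj_on_def nz)
  have hw: "m \<le> half_waves \<kappa> e \<longleftrightarrow> real m * pi / L e \<le> \<kappa>" if "e \<in> arcs G" for m e
  proof -
    have "m \<le> half_waves \<kappa> e \<longleftrightarrow> real m \<le> \<kappa> * L e / pi"
    proof -
      have "0 \<le> \<lfloor>\<kappa> * L e / pi\<rfloor>" using \<kappa> length_pos[OF that] by simp
      then show ?thesis unfolding half_waves_def by (simp only: le_nat_iff le_floor_iff of_int_of_nat_eq)
    qed
    also have "\<dots> \<longleftrightarrow> real m * pi / L e \<le> \<kappa>" using length_pos[OF that] by (simp add: field_simps)
    finally show ?thesis .
  qed
  show "(\<lambda>(e, m). (real m * pi / L e, e)) ` (SIGMA e:arcs G. {1..half_waves \<kappa> e}) \<subseteq> dirichlet_pairs \<kappa>"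
  proof
    fix p assume "p \<in> (\<lambda>(e, m). (real m * pi / L e, e)) ` (SIGMA e:arcs G. {1..half_waves \<kappa> e})"
    then obtain q where q: "q \<in> (SIGMA e:arcs G. {1..half_waves \<kappa> e})" "p = (case q of (e, m) \<Rightarrow> (real m * pi / L e, e))"
      by blast
    obtain e m where "q = (e, m)" by (cases q)
    then have p: "p = (real m * pi / L e, e)" "e \<in> arcs G" "1 \<le> m" "m \<le> half_waves \<kappa> e" using q by auto
    have "sin_freq (real m * pi / L e) (L e) = 0"
      using nz[OF p(2)] p(3) by (simp add: sin_freq_def)
    then show "p \<in> dirichlet_pairs \<kappa>"
      using p hw[OF p(2)] length_pos[OF p(2)] by (simp add: dirichlet_pairs_def)
  qed
  show "dirichlet_pairs \<kappa> \<subseteq> (\<lambda>(e, m). (real m * pi / L e, e)) ` (SIGMA e:arcs G. {1..half_waves \<kappa> e})"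
  proof
    fix p assume "p \<in> dirichlet_pairs \<kappa>"
    then obtain s e where p: "p = (s, e)" "0 \<le> s" "s \<le> \<kappa>" "e \<in> arcs G" "sin_freq s (L e) = 0"
      by (auto simp: dirichlet_pairs_def)
    have s: "s \<noteq> 0" using p(5) nz[OF p(4)] by (auto simp: sin_freq_def)
    then have "sin (s * L e) = 0" using p(5) by (simp add: sin_freq_def)
    then obtain i :: int where i: "s * L e = of_int i * pi" using sin_zero_iff_int2 by blast
    have "0 < s * L e" using s p(2) length_pos[OF p(4)] by simp
    then have "0 < i" using i by (simp add: zero_less_mult_iff)
    then obtain m where m: "i = int m" "1 \<le> m" by (metis int_one_le_iff_zero_less nat_0_le nat_le_iff of_nat_1 zle_int zero_less_imp_eq_int)
    have sm: "s = real m * pi / L e" using i m nz[OF p(4)] by (simp add: field_simps)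
    then have "m \<le> half_waves \<kappa> e" using hw[OF p(4)] p(3) by simp
    then show "p \<in> (\<lambda>(e, m). (real m * pi / L e, e)) ` (SIGMA e:arcs G. {1..half_waves \<kappa> e})"
      using p sm m by (intro image_eqI[of _ _ "(e, m)"]) auto
  qed
qed

lemma card_dirichlet_pairs:
  assumes "0 \<le> \<kappa>"
  shows "finite (dirichlet_pairs \<kappa>)" "card (dirichlet_pairs \<kappa>) = half_wave_count \<kappa>"
  using bij_betw_finite[OF dirichlet_pairs_bij[OF assms]] bij_betw_same_card[OF dirichlet_pairs_bij[OF assms]]
  by (auto simp: half_wave_count_def)

lemma sum_dirichlet_mult:
  assumes "finite \<Lambda>" "\<Lambda> \<subseteq> {0..}"
  shows "(\<Sum>s\<in>\<Lambda>. mult_dir (s\<^sup>2)) = card (SIGMA s:\<Lambda>. {e\<in>arcs G. sin_freq s (L e) = 0})"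
proof -
  have "(\<Sum>s\<in>\<Lambda>. mult_dir (s\<^sup>2)) = (\<Sum>s\<in>\<Lambda>. card {e\<in>arcs G. sin_freq s (L e) = 0})"
    by (intro sum.cong refl dirichlet_mult) (use assms in auto)
  then show ?thesis using assms(1) by (subst card_SigmaI) auto
qed

lemma dirichlet_reaches_iff:
  assumes k: "1 \<le> k"
  shows "reaches (dirichlet_laplacian G L) k x \<longleftrightarrow> 0 \<le> x \<and> k \<le> half_wave_count (sqrt x)"
proof
  assume "reaches (dirichlet_laplacian G L) k x"
  then obtain M where M: "finite M" "M \<subseteq> {..x}" "k \<le> (\<Sum>\<mu>\<in>M. mult_dir \<mu>)"
    by (auto simp: reaches_def)
  let ?\<Lambda> = "sqrt ` (M \<inter> {0..})"
  have k': "k \<le> (\<Sum>s\<in>?\<Lambda>. mult_dir (s\<^sup>2))"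
  proof -
    have "(\<Sum>\<mu>\<in>M. mult_dir \<mu>) = (\<Sum>s\<in>?\<Lambda>. mult_dir (s\<^sup>2))"
      by (rule nonneg_part_mult[OF M(1)]) (rule negative_mult(2))
    then show ?thesis using M(3) by simp
  qed
  then have "M \<inter> {0..} \<noteq> {}" using k by auto
  then have x: "0 \<le> x" using M(2) by force
  have "k \<le> card (SIGMA s:?\<Lambda>. {e\<in>arcs G. sin_freq s (L e) = 0})"
    using k' M(1) by (subst (asm) sum_dirichlet_mult) auto
  also have "\<dots> \<le> card (dirichlet_pairs (sqrt x))"
    by (rule card_mono) (use card_dirichlet_pairs x M(2) in \<open>auto simp: dirichlet_pairs_def\<close>)
  finally show "0 \<le> x \<and> k \<le> half_wave_count (sqrt x)"
    using x by (simp add: card_dirichlet_pairs)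
next
  assume x: "0 \<le> x \<and> k \<le> half_wave_count (sqrt x)"
  let ?\<Lambda> = "fst ` dirichlet_pairs (sqrt x)"
  have fin: "finite ?\<Lambda>" using card_dirichlet_pairs(1)[of "sqrt x"] x by simp
  have sub: "?\<Lambda> \<subseteq> {0..}" by (auto simp: dirichlet_pairs_def)
  have "k \<le> card (dirichlet_pairs (sqrt x))" using x card_dirichlet_pairs(2)[of "sqrt x"] by simp
  also have "\<dots> \<le> card (SIGMA s:?\<Lambda>. {e\<in>arcs G. sin_freq s (L e) = 0})"
    by (rule card_mono) (use fin in \<open>force simp: dirichlet_pairs_def\<close>)+
  also have "\<dots> = (\<Sum>\<mu>\<in>power2 ` ?\<Lambda>. mult_dir \<mu>)"
    using sum_dirichlet_mult[OF fin sub] sum_squares_mult[OF sub, of "dirichlet_laplacian G L"] by simp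
  finally have "k \<le> (\<Sum>\<mu>\<in>power2 ` ?\<Lambda>. mult_dir \<mu>)" .
  moreover have "power2 ` ?\<Lambda> \<subseteq> {..x}"
  proof -
    have "s\<^sup>2 \<le> x" if "0 \<le> s" "s \<le> sqrt x" for s
      using power_mono[OF that(2,1), of 2] x by simp
    then show ?thesis by (auto simp: dirichlet_pairs_def)
  qed
  moreover have "finite (power2 ` ?\<Lambda>)" using fin by simp
  ultimately show "reaches (dirichlet_laplacian G L) k x"
    unfolding reaches_def by (intro exI[of _ "power2 ` ?\<Lambda>"] conjI)
qed

lemma standard_reaches_nonneg:
  assumes "1 \<le> k" "reaches (standard_laplacian G L) k x"
  shows "0 \<le> x"
proof (rule ccontr)
  assume x: "\<not> 0 \<le> x"
  obtain M where M: "finite M" "M \<subseteq> {..x}" "k \<le> (\<Sum>\<mu>\<in>M. mult_std \<mu>)"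
    using assms(2) by (auto simp: reaches_def)
  have "(\<Sum>\<mu>\<in>M. mult_std \<mu>) = 0"
    using M(2) x by (intro sum.neutral ballI negative_mult(1)) force
  then show False using M(3) assms(1) by simp
qed

lemma dirichlet_kth_attained:
  assumes k: "1 \<le> k"
  obtains \<kappa> where "0 < \<kappa>" "kth_eigenvalue (dirichlet_laplacian G L) k = \<kappa>\<^sup>2" "k \<le> half_wave_count \<kappa>"
proof -
  let ?R = "{x. reaches (dirichlet_laplacian G L) k x}"
  let ?x = "Inf ?R"
  obtain e where e: "e \<in> arcs G" using arcs_nonempty by blast
  \<comment> \<open>the frequency of the \<open>k\<close>-th Dirichlet eigenfunction of the edge \<open>e\<close>\<close>
  have "k = half_waves (k * pi / L e) e" using length_pos[OF e] by (simp add: half_waves_def)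
  also have "\<dots> \<le> half_wave_count (k * pi / L e)"
    unfolding half_wave_count_def using e by (intro member_le_sum) auto
  finally have "(k * pi / L e)\<^sup>2 \<in> ?R"
    using length_pos[OF e] by (simp add: dirichlet_reaches_iff[OF k])
  then have ne: "?R \<noteq> {}" by blast
  have lower: "0 \<le> x" if "x \<in> ?R" for x using that dirichlet_reaches_iff[OF k] by simp
  have x0: "0 \<le> ?x" by (rule cInf_greatest[OF ne lower])
  obtain \<delta> where \<delta>: "\<delta> > 0" "\<And>\<kappa>'. \<kappa>' < sqrt ?x + \<delta> \<Longrightarrow> half_wave_count \<kappa>' \<le> half_wave_count (sqrt ?x)"
    using half_wave_count_right_continuous[of "sqrt ?x"] x0 by auto
  have "(sqrt ?x)\<^sup>2 < (sqrt ?x + \<delta>)\<^sup>2" using x0 \<delta>(1) by (intro power_strict_mono) auto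
  then have "?x < (sqrt ?x + \<delta>)\<^sup>2" using x0 by simp
  then obtain y where y: "y \<in> ?R" "y < (sqrt ?x + \<delta>)\<^sup>2" using cInf_lessD[OF ne] by blast
  have "0 \<le> sqrt ?x + \<delta>" using real_sqrt_ge_zero[OF x0] \<delta>(1) by linarith
  then have "sqrt y < sqrt ?x + \<delta>" using y(2) by (rule real_less_lsqrt)
  then have "half_wave_count (sqrt y) \<le> half_wave_count (sqrt ?x)" by (rule \<delta>(2))
  moreover have "k \<le> half_wave_count (sqrt y)" using y(1) dirichlet_reaches_iff[OF k] by simp
  ultimately have kx: "k \<le> half_wave_count (sqrt ?x)" by simp
  have "sqrt ?x \<noteq> 0"
  proof
    assume "sqrt ?x = 0"
    then show False using kx k by (metis half_wave_count_0 le_zero_eq not_one_le_zero)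
  qed
  then have "0 < sqrt ?x" using x0 by (metis less_eq_real_def real_sqrt_ge_zero)
  then show ?thesis
    using that[of "sqrt ?x"] kx x0 by (simp add: kth_eigenvalue_reaches)
qed

end

context trial_space
begin

lemma count_eq: "(\<Sum>e\<in>arcs G. r e) = half_wave_count \<kappa>"
  by (simp add: half_wave_count_def)

lemma standard_count_below:
  assumes "flow.F.orthonormal \<kappa> (-1) B"
  obtains \<Lambda> where "finite \<Lambda>" "\<Lambda> \<subseteq> {0..<\<kappa>}"
    "card B \<le> (\<Sum>s\<in>\<Lambda>. mult_std (s\<^sup>2))"
proof -
  obtain \<Lambda> where L: "finite \<Lambda>" "\<Lambda> \<subseteq> {0..<\<kappa>}" "card B \<le> (\<Sum>s\<in>\<Lambda>. fun_space.dim (flow.F.kernel s))"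
    using flow.flow_lower[OF assms] \<kappa>_pos by auto
  have "(\<Sum>s\<in>\<Lambda>. fun_space.dim (flow.F.kernel s)) = (\<Sum>s\<in>\<Lambda>. mult_std (s\<^sup>2))"
    by (intro sum.cong refl standard_mult[symmetric]) (use L(2) in auto)
  then show ?thesis using that L by simp
qed

text \<open>
  The negative squares of the form at \<open>\<kappa>\<close> are eigenvalues below \<open>\<kappa>\<^sup>2\<close>, and the kernel at \<open>\<kappa>\<close> is the
  eigenspace for \<open>\<kappa>\<^sup>2\<close>; together they are at least as many as the dimension of the trial space.
\<close>

lemma standard_reaches: "reaches (standard_laplacian G L) (Suc (half_wave_count \<kappa>)) (\<kappa>\<^sup>2)"
proof -
  obtain B where B: "flow.F.maximal_orthonormal \<kappa> (-1) B" using flow.F.maximal_orthonormal_exists[of "-1" \<kappa>] by auto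
  obtain \<Lambda> where L: "finite \<Lambda>" "\<Lambda> \<subseteq> {0..<\<kappa>}"
    "card B \<le> (\<Sum>s\<in>\<Lambda>. mult_std (s\<^sup>2))"
    using standard_count_below[of B] B by (auto simp: flow.F.maximal_orthonormal_def)
  have "Suc (half_wave_count \<kappa>) \<le> card B + fun_space.dim (trial \<inter> flow.F.kernel \<kappa>)"
    using flow.F.inertia[OF B trial_subspace trial_nonpos] trial_dim count_eq by simp
  also have "\<dots> \<le> card B + fun_space.dim (flow.F.kernel \<kappa>)"
    using flow.F.dim_subset_span[of "trial \<inter> flow.F.kernel \<kappa>" "flow.F.kernel \<kappa>"] flow.F.kernel_subset by simp
  also have "\<dots> \<le> (\<Sum>s\<in>insert \<kappa> \<Lambda>. mult_std (s\<^sup>2))"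
    using L standard_mult[of \<kappa>] \<kappa>_pos by (subst sum.insert) auto
  also have "\<dots> = (\<Sum>\<mu>\<in>power2 ` insert \<kappa> \<Lambda>. mult_std \<mu>)"
    by (rule sum_squares_mult[symmetric]) (use L(2) \<kappa>_pos in auto)
  finally have "Suc (half_wave_count \<kappa>) \<le> (\<Sum>\<mu>\<in>power2 ` insert \<kappa> \<Lambda>. mult_std \<mu>)" .
  moreover have "power2 ` insert \<kappa> \<Lambda> \<subseteq> {..\<kappa>\<^sup>2}"
    using L(2) by (auto intro!: power_mono)
  moreover have "finite (power2 ` insert \<kappa> \<Lambda>)" using L(1) by simp
  ultimately show ?thesis
    unfolding reaches_def by (intro exI[of _ "power2 ` insert \<kappa> \<Lambda>"] conjI)
qed

lemma standard_reaches_strict: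
  assumes e0: "e0 \<in> arcs G" "\<kappa> * L e0 \<noteq> r e0 * pi"
  obtains y where "y < \<kappa>\<^sup>2" "reaches (standard_laplacian G L) (Suc (half_wave_count \<kappa>)) y"
proof -
  obtain B where B: "flow.F.maximal_orthonormal \<kappa> (-1) B" using flow.F.maximal_orthonormal_exists[of "-1" \<kappa>] by auto
  obtain \<Lambda> where L: "finite \<Lambda>" "\<Lambda> \<subseteq> {0..<\<kappa>}"
    "card B \<le> (\<Sum>s\<in>\<Lambda>. mult_std (s\<^sup>2))"
    using standard_count_below[of B] B by (auto simp: flow.F.maximal_orthonormal_def)
  have "trial \<inter> flow.F.kernel \<kappa> \<subseteq> fun_space.span {}"
    using trial_kernel_trivial[OF e0] by auto
  from fun_space.dim_le_card[OF this] have "fun_space.dim (trial \<inter> flow.F.kernel \<kappa>) = 0" by simp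
  then have "Suc (half_wave_count \<kappa>) \<le> card B"
    using flow.F.inertia[OF B trial_subspace trial_nonpos] trial_dim count_eq by simp
  also have "\<dots> \<le> (\<Sum>\<mu>\<in>power2 ` \<Lambda>. mult_std \<mu>)"
    using L(3) sum_squares_mult[of \<Lambda> "standard_laplacian G L"] L(2) by (simp add: subset_iff)
  finally have k: "Suc (half_wave_count \<kappa>) \<le> (\<Sum>\<mu>\<in>power2 ` \<Lambda>. mult_std \<mu>)" .
  then have ne: "power2 ` \<Lambda> \<noteq> {}" by auto
  \<comment> \<open>finitely many eigenvalues below \<open>\<kappa>\<^sup>2\<close> stay away from it\<close>
  let ?y = "Max (power2 ` \<Lambda>)"
  have "?y \<in> power2 ` \<Lambda>" using ne L(1) by (intro Max_in) auto
  then obtain s where s: "s \<in> \<Lambda>" "?y = s\<^sup>2" by blast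
  have "?y < \<kappa>\<^sup>2" unfolding s(2) by (rule power_strict_mono) (use s(1) L(2) in auto)
  moreover have "power2 ` \<Lambda> \<subseteq> {..?y}" using L(1) by auto
  moreover have "finite (power2 ` \<Lambda>)" using L(1) by simp
  ultimately have "reaches (standard_laplacian G L) (Suc (half_wave_count \<kappa>)) ?y"
    unfolding reaches_def using k by (intro exI[of _ "power2 ` \<Lambda>"] conjI)
  with \<open>?y < \<kappa>\<^sup>2\<close> show ?thesis by (rule that)
qed

lemma standard_reaches_commensurable:
  assumes int: "\<And>e. e \<in> arcs G \<Longrightarrow> \<kappa> * L e = r e * pi"
    and x: "reaches (standard_laplacian G L) (Suc (half_wave_count \<kappa>)) x"
  shows "\<kappa>\<^sup>2 \<le> x"
proof (rule ccontr)
  assume less: "\<not> \<kappa>\<^sup>2 \<le> x"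
  obtain M where M: "finite M" "M \<subseteq> {..x}"
    "Suc (half_wave_count \<kappa>) \<le> (\<Sum>\<mu>\<in>M. mult_std \<mu>)"
    using x by (auto simp: reaches_def)
  define \<Lambda> where "\<Lambda> = sqrt ` (M \<inter> {0..})"
  have L: "finite \<Lambda>" "\<Lambda> \<subseteq> {0..<\<kappa>}"
  proof -
    show "finite \<Lambda>" using M(1) by (simp add: \<Lambda>_def)
    have "sqrt \<mu> < \<kappa>" if "\<mu> \<in> M" for \<mu>
    proof -
      have "\<mu> < \<kappa>\<^sup>2" using that M(2) less by force
      then show ?thesis using \<kappa>_pos by (metis less_imp_le real_sqrt_less_iff real_sqrt_unique)
    qed
    then show "\<Lambda> \<subseteq> {0..<\<kappa>}" by (auto simp: \<Lambda>_def)
  qed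
  obtain B where B: "flow.F.orthonormal \<kappa> (-1) B" "card B = (\<Sum>s\<in>\<Lambda>. fun_space.dim (flow.F.kernel s))"
    using flow.flow_upper[OF L] by auto
  have "(\<Sum>s\<in>\<Lambda>. fun_space.dim (flow.F.kernel s)) = (\<Sum>s\<in>\<Lambda>. mult_std (s\<^sup>2))"
    by (intro sum.cong refl standard_mult[symmetric]) (use L(2) in auto)
  moreover have "(\<Sum>\<mu>\<in>M. mult_std \<mu>) =
      (\<Sum>s\<in>\<Lambda>. mult_std (s\<^sup>2))"
    unfolding \<Lambda>_def by (rule nonneg_part_mult[OF M(1)]) (rule negative_mult(1))
  ultimately have "card B = (\<Sum>\<mu>\<in>M. mult_std \<mu>)"
    using B(2) by simp
  moreover have "card B \<le> half_wave_count \<kappa>"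
    using orthonormal_commensurable[OF int B(1)] by (simp add: count_eq)
  ultimately show False using M(3) by simp
qed

end

context metric_graph
begin

text \<open>
  With a common denominator \<open>Q\<close> of the numbers \<open>L e / L a\<close> for a fixed edge \<open>a\<close>, the frequency
  \<open>Q \<pi> / L a\<close> works.
\<close>

lemma common_frequency:
  assumes rat: "\<And>e e'. e \<in> arcs G \<Longrightarrow> e' \<in> arcs G \<Longrightarrow> L e / L e' \<in> \<rat>"
  obtains \<kappa> where "0 < \<kappa>" "\<And>e. e \<in> arcs G \<Longrightarrow> \<kappa> * L e = half_waves \<kappa> e * pi"
proof -
  obtain a where a: "a \<in> arcs G" using arcs_nonempty by blast
  have "\<exists>p q :: nat. 0 < q \<and> L e / L a = real p / real q" if e: "e \<in> arcs G" for e
  proof -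
    have pos: "0 < L e / L a" using length_pos a e by simp
    obtain p q :: nat where "q \<noteq> 0" "\<bar>L e / L a\<bar> = real p / real q"
      by (rule Rats_abs_nat_div_natE[OF rat[OF e a]])
    then have "L e / L a = real p / real q" unfolding abs_of_pos[OF pos] by simp
    then show ?thesis using \<open>q \<noteq> 0\<close> by blast
  qed
  then obtain p q :: "'e \<Rightarrow> nat" where pq: "\<And>e. e \<in> arcs G \<Longrightarrow> 0 < q e \<and> L e / L a = real (p e) / real (q e)"
    by metis
  define Q where "Q = (\<Prod>e\<in>arcs G. q e)"
  have Q: "0 < Q" using pq unfolding Q_def by (intro prod_pos) auto
  define \<kappa> where "\<kappa> = real Q * pi / L a"
  show ?thesis
  proof (rule that[of \<kappa>])
    show "0 < \<kappa>" using Q length_pos[OF a] by (simp add: \<kappa>_def)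
    fix e assume e: "e \<in> arcs G"
    \<comment> \<open>so \<open>\<kappa> L e / \<pi> = (Q / q e) p e\<close> is a natural number\<close>
    have "q e dvd Q" unfolding Q_def by (rule dvd_prodI) (use e in auto)
    then obtain d where d: "Q = q e * d" by blast
    have "\<kappa> * L e = real Q * (L e / L a) * pi" by (simp add: \<kappa>_def)
    also have "real Q * (L e / L a) = real (d * p e)" using pq[OF e] d by (simp add: field_simps)
    finally have *: "\<kappa> * L e = real (d * p e) * pi" .
    then have "half_waves \<kappa> e = d * p e" unfolding half_waves_def * by (simp del: of_nat_mult)
    then show "\<kappa> * L e = half_waves \<kappa> e * pi" using * by simp
  qed
qed

end

theorem theorem4p1:
  fixes G :: "('v, 'e) pre_digraph" and L :: "'e \<Rightarrow> real"
  assumes "metric_tree G L"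
  shows "(\<forall>k\<ge>1. kth_eigenvalue (standard_laplacian G L) (k + 1)
                   \<le> kth_eigenvalue (dirichlet_laplacian G L) k) \<and>
         ((\<forall>k\<ge>1. kth_eigenvalue (standard_laplacian G L) (k + 1)
                   < kth_eigenvalue (dirichlet_laplacian G L) k) \<longleftrightarrow>
            (\<exists>e\<in>arcs G. \<exists>e'\<in>arcs G. L e / L e' \<notin> \<rat>))"
proof -
  interpret metric_graph G L using assms by (simp add: metric_tree_def)
  have trial: "trial_space G L \<kappa>" if "0 < \<kappa>" for \<kappa>
    using that assms connected_incident
    by unfold_locales (auto simp: metric_tree_def)
  let ?S = "standard_laplacian G L" and ?D = "dirichlet_laplacian G L"
  have upper: "kth_eigenvalue ?S (k + 1) \<le> x" if "reaches ?S (k + 1) x" for k x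
    unfolding kth_eigenvalue_reaches
    by (rule cInf_lower) (use that standard_reaches_nonneg in \<open>auto intro!: bdd_belowI[of _ 0]\<close>)
  have weak: "kth_eigenvalue ?S (k + 1) \<le> kth_eigenvalue ?D k" if k: "1 \<le> k" for k
  proof -
    obtain \<kappa> where \<kappa>: "0 < \<kappa>" "kth_eigenvalue ?D k = \<kappa>\<^sup>2" "k \<le> half_wave_count \<kappa>"
      by (rule dirichlet_kth_attained[OF k])
    interpret trial_space G L \<kappa> by (rule trial[OF \<kappa>(1)])
    have "reaches ?S (k + 1) (\<kappa>\<^sup>2)" by (rule reaches_mono[OF standard_reaches]) (use \<kappa> in simp)
    then show ?thesis using upper \<kappa>(2) by simp
  qed
  moreover have strict: "kth_eigenvalue ?S (k + 1) < kth_eigenvalue ?D k"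
    if k: "1 \<le> k" and e: "e \<in> arcs G" "e' \<in> arcs G" "L e / L e' \<notin> \<rat>" for k e e'
  proof -
    obtain \<kappa> where \<kappa>: "0 < \<kappa>" "kth_eigenvalue ?D k = \<kappa>\<^sup>2" "k \<le> half_wave_count \<kappa>"
      by (rule dirichlet_kth_attained[OF k])
    interpret trial_space G L \<kappa> by (rule trial[OF \<kappa>(1)])
    \<comment> \<open>otherwise \<open>L e / L e'\<close> is the quotient of two numbers of half waves\<close>
    have "\<exists>e0\<in>arcs G. \<kappa> * L e0 \<noteq> half_waves \<kappa> e0 * pi"
    proof (rule ccontr)
      assume "\<not> ?thesis"
      then have "\<kappa> * L e = half_waves \<kappa> e * pi" "\<kappa> * L e' = half_waves \<kappa> e' * pi" using e by auto
      moreover have "L e / L e' = (\<kappa> * L e) / (\<kappa> * L e')" using \<kappa>(1) by simp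
      ultimately have "L e / L e' = half_waves \<kappa> e / half_waves \<kappa> e'" by simp
      then show False using e(3) by simp
    qed
    then obtain e0 where "e0 \<in> arcs G" "\<kappa> * L e0 \<noteq> half_waves \<kappa> e0 * pi" by blast
    then obtain y where y: "y < \<kappa>\<^sup>2" "reaches ?S (Suc (half_wave_count \<kappa>)) y"
      by (rule standard_reaches_strict)
    have "reaches ?S (k + 1) y" by (rule reaches_mono[OF y(2)]) (use \<kappa> in simp)
    then show ?thesis using upper[of k y] y(1) \<kappa>(2) by simp
  qed
  moreover have "\<exists>k\<ge>1. kth_eigenvalue ?D k \<le> kth_eigenvalue ?S (k + 1)"
    if rat: "\<And>e e'. e \<in> arcs G \<Longrightarrow> e' \<in> arcs G \<Longrightarrow> L e / L e' \<in> \<rat>"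
  proof -
    obtain \<kappa> where \<kappa>: "0 < \<kappa>" "\<And>e. e \<in> arcs G \<Longrightarrow> \<kappa> * L e = half_waves \<kappa> e * pi"
      using common_frequency[OF rat] by blast
    interpret trial_space G L \<kappa> by (rule trial[OF \<kappa>(1)])
    \<comment> \<open>the last index \<open>k\<close> at which the \<open>k\<close>-th Dirichlet eigenvalue is \<open>\<kappa>\<^sup>2\<close>\<close>
    let ?k = "half_wave_count \<kappa>"
    obtain a where a: "a \<in> arcs G" using arcs_nonempty by blast
    have "half_waves \<kappa> a \<noteq> 0"
    proof
      assume "half_waves \<kappa> a = 0"
      then show False using \<kappa>(2)[OF a] \<kappa>(1) length_pos[OF a] by simp
    qed
    then have k: "1 \<le> ?k"
      unfolding half_wave_count_def using a by (meson finite_arcs le_trans less_one linorder_not_less member_le_sum zero_le)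
    have "reaches ?D ?k (\<kappa>\<^sup>2)" using dirichlet_reaches_iff[OF k] \<kappa>(1) by simp
    then have "kth_eigenvalue ?D ?k \<le> \<kappa>\<^sup>2"
      unfolding kth_eigenvalue_reaches
      by (intro cInf_lower) (use dirichlet_reaches_iff[OF k] in \<open>auto intro!: bdd_belowI[of _ 0]\<close>)
    also have "\<kappa>\<^sup>2 \<le> kth_eigenvalue ?S (?k + 1)"
      unfolding kth_eigenvalue_reaches
    proof (rule cInf_greatest)
      show "{x. reaches ?S (?k + 1) x} \<noteq> {}" using standard_reaches by auto
      fix x assume "x \<in> {x. reaches ?S (?k + 1) x}"
      then show "\<kappa>\<^sup>2 \<le> x" using standard_reaches_commensurable[OF \<kappa>(2)] by simp
    qed
    finally show ?thesis using k by blast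
  qed
  ultimately show ?thesis by (metis not_le)
qed

end
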